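(* Let $n\ge2$. For every $\lambda<0$ there exist bounded coefficients $b,c\in C^\infty(\mathbb{R}^n)$ ($b$ vector-valued, $c$ scalar) such that the operator $\mathcal{L}:=\Delta+b\cdot\nabla+c$ satisfies $\lambda_1(-\mathcal{L},\mathbb{R}^n)=\lambda$, and $\mathcal{L}u=0$ admits a classical solution $u$ on $\mathbb{R}^n$ such that, for some sequence $R_i\to\infty$ and some $K>0$, $$u(x)\equiv0\ \text{ on }|x|=R_i,\qquad\text{and}\qquad\limsup_{|x|\to\infty}e^{K|x|}|u(x)|=1.$$
   Context: $\lambda_1(-\mathcal{L},B_R)$ denotes the first (principal) Dirichlet eigenvalue of $-\mathcal{L}$ in the ball $B_R=\{|x|<R\}$: the real, simple eigenvalue with smallest real part, characterized by the existence of a positive eigenfunction $\varphi_1\in H^1_0(B_R)$ with $-\mathcal{L}\varphi_1=\lambda_1\varphi_1$; and $\lambda_1(-\mathcal{L},\mathbb{R}^n):=\lim_{R\to\infty}\lambda_1(-\mathcal{L},B_R)\in[-\infty,\infty)$. *)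

theory Defs
  imports "HOL-Analysis.Analysis"
begin

definition partial_deriv ::
    "'a::euclidean_space \<Rightarrow> ('a \<Rightarrow> 'b::real_normed_vector) \<Rightarrow> 'a \<Rightarrow> 'b" where
  "partial_deriv i f x = frechet_derivative f (at x) i"

primrec C_k :: "nat \<Rightarrow> ('a::euclidean_space \<Rightarrow> 'b::real_normed_vector) \<Rightarrow> bool" where
  "C_k 0 f \<longleftrightarrow> continuous_on UNIV f"
| "C_k (Suc k) f \<longleftrightarrow>
     (\<forall>x. f differentiable (at x)) \<and> (\<forall>i\<in>Basis. C_k k (partial_deriv i f))"

definition C_infinity :: "('a::euclidean_space \<Rightarrow> 'b::real_normed_vector) \<Rightarrow> bool" where
  "C_infinity f \<longleftrightarrow> (\<forall>k. C_k k f)"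

definition grad :: "('a::euclidean_space \<Rightarrow> real) \<Rightarrow> 'a \<Rightarrow> 'a" where
  "grad u x = (\<Sum>i\<in>Basis. partial_deriv i u x *\<^sub>R i)"

definition laplacian :: "('a::euclidean_space \<Rightarrow> real) \<Rightarrow> 'a \<Rightarrow> real" where
  "laplacian u x = (\<Sum>i\<in>Basis. partial_deriv i (partial_deriv i u) x)"

definition elliptic_op ::
    "('a::euclidean_space \<Rightarrow> 'a) \<Rightarrow> ('a \<Rightarrow> real) \<Rightarrow> ('a \<Rightarrow> real) \<Rightarrow> 'a \<Rightarrow> real" where
  "elliptic_op b c u x = laplacian u x + b x \<bullet> grad u x + c x * u x"

definition test_function :: "'a::euclidean_space set \<Rightarrow> ('a \<Rightarrow> real) \<Rightarrow> bool" where
  "test_function \<Omega> \<eta> \<longleftrightarrow>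
     C_infinity \<eta> \<and> compact (closure {x. \<eta> x \<noteq> 0}) \<and> closure {x. \<eta> x \<noteq> 0} \<subseteq> \<Omega>"

definition square_integrable ::
    "'a::euclidean_space set \<Rightarrow> ('a \<Rightarrow> 'b::euclidean_space) \<Rightarrow> bool" where
  "square_integrable \<Omega> f \<longleftrightarrow>
     f \<in> borel_measurable (lebesgue_on \<Omega>) \<and> integrable (lebesgue_on \<Omega>) (\<lambda>x. (norm (f x))\<^sup>2)"

(* H^1_0 is the closure of the test functions in the H^1 norm.  A member is represented by a
   function u together with its weak gradient g; values outside \<Omega> are irrelevant. *)
definition H10 ::
    "'a::euclidean_space set \<Rightarrow> ('a \<Rightarrow> real) \<Rightarrow> ('a \<Rightarrow> 'a) \<Rightarrow> bool" where
  "H10 \<Omega> u g \<longleftrightarrow>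
     square_integrable \<Omega> u \<and> square_integrable \<Omega> g \<and>
     (\<exists>\<phi>. (\<forall>k::nat. test_function \<Omega> (\<phi> k)) \<and>
        (\<lambda>k. LINT x|lebesgue_on \<Omega>. (\<phi> k x - u x)\<^sup>2) \<longlonglongrightarrow> 0 \<and>
        (\<lambda>k. LINT x|lebesgue_on \<Omega>. (norm (grad (\<phi> k) x - g x))\<^sup>2) \<longlonglongrightarrow> 0)"

(* u lies in H^1_0 and solves -(Laplacian u + b . grad u + c u) = f in the weak sense, i.e. after
   one integration by parts against test functions. *)
definition dirichlet_solution ::
    "('a::euclidean_space \<Rightarrow> 'a) \<Rightarrow> ('a \<Rightarrow> real) \<Rightarrow> 'a set \<Rightarrow> ('a \<Rightarrow> real) \<Rightarrow> ('a \<Rightarrow> real) \<Rightarrow> bool"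
  where
  "dirichlet_solution b c \<Omega> u f \<longleftrightarrow>
     (\<exists>g. H10 \<Omega> u g \<and>
       (\<forall>\<eta>. test_function \<Omega> \<eta> \<longrightarrow>
          (LINT x|lebesgue_on \<Omega>.
             g x \<bullet> grad \<eta> x - (b x \<bullet> g x) * \<eta> x - c x * u x * \<eta> x)
          = (LINT x|lebesgue_on \<Omega>. f x * \<eta> x)))"

(* b and c are real, so the complexified operator acts on real and imaginary parts separately. *)
definition complex_dirichlet_solution ::
    "('a::euclidean_space \<Rightarrow> 'a) \<Rightarrow> ('a \<Rightarrow> real) \<Rightarrow> 'a set \<Rightarrow>
     ('a \<Rightarrow> complex) \<Rightarrow> ('a \<Rightarrow> complex) \<Rightarrow> bool" where
  "complex_dirichlet_solution b c \<Omega> \<psi> h \<longleftrightarrow>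
     dirichlet_solution b c \<Omega> (\<lambda>x. Re (\<psi> x)) (\<lambda>x. Re (h x)) \<and>
     dirichlet_solution b c \<Omega> (\<lambda>x. Im (\<psi> x)) (\<lambda>x. Im (h x))"

definition dirichlet_eigenvalue ::
    "('a::euclidean_space \<Rightarrow> 'a) \<Rightarrow> ('a \<Rightarrow> real) \<Rightarrow> 'a set \<Rightarrow> complex \<Rightarrow> bool" where
  "dirichlet_eigenvalue b c \<Omega> \<nu> \<longleftrightarrow>
     (\<exists>\<psi>. complex_dirichlet_solution b c \<Omega> \<psi> (\<lambda>x. \<nu> * \<psi> x) \<and>
          \<not> (AE x in lebesgue_on \<Omega>. \<psi> x = 0))"

(* Positive eigenfunction \<phi>; algebraic simplicity; smallest real part.  With A the Dirichlet
   realization of -L, the second conjunct says that the kernel of (A - \<mu>)^2 is spanned by \<phi>: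
   A \<psi> = \<mu> \<psi> + \<zeta> and A \<zeta> = \<mu> \<zeta> force \<psi> to be a multiple of \<phi>.  The case \<zeta> = 0 is geometric
   simplicity. *)
definition is_principal_eigenvalue ::
    "('a::euclidean_space \<Rightarrow> 'a) \<Rightarrow> ('a \<Rightarrow> real) \<Rightarrow> 'a set \<Rightarrow> real \<Rightarrow> bool" where
  "is_principal_eigenvalue b c \<Omega> \<mu> \<longleftrightarrow>
     (\<exists>\<phi>. (\<forall>x\<in>\<Omega>. 0 < \<phi> x) \<and> dirichlet_solution b c \<Omega> \<phi> (\<lambda>x. \<mu> * \<phi> x) \<and>
        (\<forall>\<psi> \<zeta>.
           complex_dirichlet_solution b c \<Omega> \<psi> (\<lambda>x. of_real \<mu> * \<psi> x + \<zeta> x) \<and>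
           complex_dirichlet_solution b c \<Omega> \<zeta> (\<lambda>x. of_real \<mu> * \<zeta> x) \<longrightarrow>
           (\<exists>a::complex. AE x in lebesgue_on \<Omega>. \<psi> x = a * of_real (\<phi> x)))) \<and>
     (\<forall>\<nu>. dirichlet_eigenvalue b c \<Omega> \<nu> \<longrightarrow> \<mu> \<le> Re \<nu>)"

definition principal_eigenvalue ::
    "('a::euclidean_space \<Rightarrow> 'a) \<Rightarrow> ('a \<Rightarrow> real) \<Rightarrow> 'a set \<Rightarrow> real" where
  "principal_eigenvalue b c \<Omega> = (THE \<mu>. is_principal_eigenvalue b c \<Omega> \<mu>)"

end

theory Submission
  imports Defs
begin

text \<open>
  The operator is conjugate to the Laplacian: for a positive smooth function \<open>P\<close> the coefficients
  \<open>b\<close> and \<open>c\<close> are chosen such that \<open>L (P w) = P (\<Delta> w - \<Lambda> w)\<close> for all \<open>w\<close>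
  (lemma \<open>elliptic_op_conj\<close>).  Conjugation does not change the Dirichlet eigenvalues of a ball, so the
  principal eigenvalue of \<open>- L\<close> in the ball of radius \<open>R\<close> is \<open>\<Lambda>\<close> plus that of \<open>- \<Delta>\<close>, which by scaling
  is a constant times \<open>1 / R\<^sup>2\<close>; it tends to \<open>\<Lambda>\<close>.  On the whole space, since \<open>\<Lambda> < 0\<close>, the equation
  \<open>\<Delta> w = \<Lambda> w\<close> has an oscillating radial solution (a Bessel function times a power of \<open>r\<close>), whose
  zeros are spheres with radii tending to infinity and whose amplitude decays like \<open>r\<close> to the power
  \<open>- (n - 1) / 2\<close>.  Hence \<open>u = P w\<close> solves \<open>L u = 0\<close>, and with
  \<open>P = exp (- sqrt (1 + |x|\<^sup>2))\<close> times the power \<open>(n - 1) / 4\<close> of \<open>1 + |x|\<^sup>2\<close> the amplitude of \<open>u\<close> is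
  comparable to \<open>exp (- |x|)\<close>, while \<open>b\<close> and \<open>c\<close> are bounded, because \<open>\<nabla>P / P\<close> and \<open>\<Delta>P / P\<close> are.
  A constant factor normalizes the upper limit.

  The principal eigenvalue in a ball is found without spectral theory.  In the weight \<open>\<rho> = 1 / P\<^sup>2\<close> the
  operator is symmetric, and an explicit positive solution \<open>\<Phi>\<close> of \<open>- L \<Phi> = \<mu> \<Phi>\<close> with zero boundary
  values is at hand, namely \<open>P\<close> times the radial eigenfunction rescaled so that its first zero lies on
  the boundary.  Picone's identity (lemma \<open>picone_identity\<close>) writes the quadratic form of \<open>- L - \<mu>\<close> at
  \<open>\<theta>\<close> as the integral of \<open>\<rho> \<Phi>\<^sup>2 |\<nabla>(\<theta> / \<Phi>)|\<^sup>2\<close>.  So the form is nonnegative, which bounds the real part of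
  every eigenvalue from below, and it vanishes only if \<open>\<theta> / \<Phi>\<close> is constant, which gives simplicity;
  generalized eigenfunctions are excluded by symmetry.  The case of equality for a limit of test
  functions rests on a Poincare inequality on smaller balls (lemma \<open>poincare_ball\<close>), and
  \<open>\<Phi>\<close> lies in \<open>H\<^sup>1\<^sub>0\<close> because it is smooth and vanishes on the sphere
  (lemma \<open>H10_vanishing_on_sphere\<close>).

  For the radial solution, \<open>r\<close> to the power \<open>(n - 1) / 2\<close> times \<open>w\<close> satisfies
  \<open>y'' = (C / r\<^sup>2 - 1) y\<close>.  Comparison with a sine of lower frequency yields infinitely many zeros, and
  the energy \<open>y\<^sup>2 + y'\<^sup>2\<close> stays between two positive constants, because its relative rate of change is
  at most \<open>|C| / r\<^sup>2\<close>.
\<close>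

section \<open>Gradients\<close>

lemma partial_deriv_eq:
  assumes "(f has_derivative f') (at x)"
  shows "partial_deriv i f x = f' i"
  using frechet_derivative_at[OF assms] by (simp add: partial_deriv_def)

lemma has_derivative_grad:
  fixes f :: "'a::euclidean_space \<Rightarrow> real"
  assumes "f differentiable (at x)"
  shows "(f has_derivative (\<lambda>h. grad f x \<bullet> h)) (at x)"
proof -
  have *: "(f has_derivative frechet_derivative f (at x)) (at x)"
    using assms frechet_derivative_works by blast
  then interpret bounded_linear "frechet_derivative f (at x)"
    by (rule has_derivative_bounded_linear)
  have "frechet_derivative f (at x) h = grad f x \<bullet> h" for h
  proof -
    have "frechet_derivative f (at x) h = frechet_derivative f (at x) (\<Sum>i\<in>Basis. (h \<bullet> i) *\<^sub>R i)"
      by (simp add: euclidean_representation)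
    also have "\<dots> = grad f x \<bullet> h"
      by (simp only: sum scaleR grad_def partial_deriv_def inner_sum_left inner_scaleR_left)
         (auto intro!: sum.cong simp: inner_commute)
    finally show ?thesis .
  qed
  with * show ?thesis by (metis ext)
qed

lemma grad_eq:
  fixes f :: "'a::euclidean_space \<Rightarrow> real"
  assumes "(f has_derivative (\<lambda>h. G \<bullet> h)) (at x)"
  shows "grad f x = G"
  by (simp add: grad_def partial_deriv_eq[OF assms] euclidean_representation)

lemma grad_inner_Basis:
  assumes "i \<in> Basis"
  shows "grad f x \<bullet> i = partial_deriv i f x"
  using assms by (simp add: grad_def inner_sum_left inner_Basis if_distrib cong: if_cong)

lemma grad_mult:
  fixes f g :: "'a::euclidean_space \<Rightarrow> real"
  assumes "f differentiable (at x)" "g differentiable (at x)"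
  shows "grad (\<lambda>x. f x * g x) x = f x *\<^sub>R grad g x + g x *\<^sub>R grad f x"
  by (rule grad_eq)
     (rule has_derivative_eq_rhs[OF has_derivative_mult[OF assms[THEN has_derivative_grad]]],
      auto simp: inner_add_left algebra_simps)

lemma grad_compose:
  fixes f :: "'a::euclidean_space \<Rightarrow> real"
  assumes "(g has_real_derivative d) (at (f x))" "f differentiable (at x)"
  shows "grad (\<lambda>x. g (f x)) x = d *\<^sub>R grad f x"
  by (rule grad_eq)
     (rule has_derivative_eq_rhs[OF has_derivative_compose[OF assms(2)[THEN has_derivative_grad]
        assms(1)[unfolded has_field_derivative_def]]], auto)

section \<open>Closure properties of smooth functions\<close>

lemma C_k_Suc_imp: "C_k (Suc k) f \<Longrightarrow> C_k k f"
proof (induction k arbitrary: f)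
  case 0
  then show ?case
    by (auto intro!: continuous_at_imp_continuous_on differentiable_imp_continuous_within)
qed auto

lemma C_k_const: "C_k k (\<lambda>x. a)"
proof (induction k arbitrary: a)
  case (Suc k)
  have "partial_deriv i (\<lambda>x::'a. a) = (\<lambda>x. 0)" for i
    by (intro ext, subst partial_deriv_eq[OF has_derivative_const]) simp
  then show ?case using Suc[of 0] by simp
qed simp

lemma partial_deriv_add:
  assumes "f differentiable (at x)" "g differentiable (at x)"
  shows "partial_deriv i (\<lambda>x. f x + g x) x = partial_deriv i f x + partial_deriv i g x"
  using partial_deriv_eq[OF has_derivative_add[OF assms[unfolded frechet_derivative_works]]]
  by (simp add: partial_deriv_def)

lemma C_k_add: "C_k k f \<Longrightarrow> C_k k g \<Longrightarrow> C_k k (\<lambda>x. f x + g x)"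
proof (induction k arbitrary: f g)
  case (Suc k)
  then have "partial_deriv i (\<lambda>x. f x + g x) = (\<lambda>x. partial_deriv i f x + partial_deriv i g x)" for i
    by (intro ext) (simp add: partial_deriv_add)
  with Suc show ?case by simp
qed (auto intro: continuous_on_add)

lemma (in bounded_bilinear) partial_deriv_prod:
  assumes "f differentiable (at x)" "g differentiable (at x)"
  shows "partial_deriv i (\<lambda>x. prod (f x) (g x)) x
         = prod (f x) (partial_deriv i g x) + prod (partial_deriv i f x) (g x)"
  using partial_deriv_eq[OF FDERIV[OF assms[unfolded frechet_derivative_works]]]
  by (simp add: partial_deriv_def)

lemma (in bounded_bilinear) C_k_prod:
  "C_k k f \<Longrightarrow> C_k k g \<Longrightarrow> C_k k (\<lambda>x. prod (f x) (g x))"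
proof (induction k arbitrary: f g)
  case 0
  then show ?case by (auto intro: continuous_on)
next
  case (Suc k)
  have "partial_deriv i (\<lambda>x. prod (f x) (g x))
      = (\<lambda>x. prod (f x) (partial_deriv i g x) + prod (partial_deriv i f x) (g x))" for i
    using Suc by (intro ext) (simp add: partial_deriv_prod)
  moreover have "(\<lambda>x. prod (f x) (g x)) differentiable (at x)" for x
  proof -
    have "(f has_derivative frechet_derivative f (at x)) (at x)"
      "(g has_derivative frechet_derivative g (at x)) (at x)"
      using Suc.prems by (simp_all add: frechet_derivative_works[symmetric])
    from FDERIV[OF this] show ?thesis by (rule differentiableI)
  qed
  ultimately show ?case
    using Suc C_k_Suc_imp[OF Suc.prems(1)] C_k_Suc_imp[OF Suc.prems(2)]
    by (simp add: C_k_add)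
qed

lemmas C_k_mult = bounded_bilinear.C_k_prod[OF bounded_bilinear_mult]
lemmas C_k_scaleR = bounded_bilinear.C_k_prod[OF bounded_bilinear_scaleR]
lemmas C_k_inner = bounded_bilinear.C_k_prod[OF bounded_bilinear_inner]

lemma C_k_ident: "C_k k (\<lambda>x. x)"
proof (cases k)
  case (Suc m)
  have "partial_deriv i (\<lambda>x::'a. x) = (\<lambda>x. i)" for i
    by (intro ext, subst partial_deriv_eq[OF has_derivative_ident]) simp
  then show ?thesis using Suc by (simp add: C_k_const)
qed simp

text \<open>
  Composition with a function of one real variable.  Smoothness of the outer function is given by
  the sequence of its derivatives, which is what is at hand for powers, for sums of power series
  and for the flat function \<open>exp (- 1 / t)\<close>, and which allows it to be smooth only on a set \<open>S\<close>
  containing the values of the inner function.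
\<close>

lemma C_k_compose:
  fixes f :: "'a::euclidean_space \<Rightarrow> real" and G :: "nat \<Rightarrow> real \<Rightarrow> real"
  assumes G: "\<And>m t. t \<in> S \<Longrightarrow> (G m has_real_derivative G (Suc m) t) (at t)"
    and f: "\<And>x. f x \<in> S"
  shows "C_k k f \<Longrightarrow> C_k k (\<lambda>x. G m (f x))"
proof (induction k arbitrary: m)
  case 0
  have "isCont (\<lambda>x. G m (f x)) x" for x
    using 0 f[of x] G[THEN DERIV_isCont, of "f x" m]
    by (auto simp: continuous_on_eq_continuous_at intro: isCont_o2[where f = f and g = "G m"])
  then show ?case by (simp add: continuous_at_imp_continuous_on)
next
  case (Suc k)
  have D: "((\<lambda>x. G m (f x)) has_derivative (\<lambda>h. frechet_derivative f (at x) h * G (Suc m) (f x))) (at x)" for x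
  proof -
    have "(f has_derivative frechet_derivative f (at x)) (at x)"
      using Suc.prems frechet_derivative_works by auto
    from has_derivative_compose[OF this G[OF f, unfolded has_field_derivative_def], of m]
    show ?thesis by (simp add: mult.commute)
  qed
  then have "partial_deriv i (\<lambda>x. G m (f x)) = (\<lambda>x. partial_deriv i f x * G (Suc m) (f x))" for i
    by (intro ext) (simp add: partial_deriv_eq[OF D], simp add: partial_deriv_def)
  moreover have "(\<lambda>x. G m (f x)) differentiable (at x)" for x
    by (rule differentiableI[OF D])
  ultimately show ?case
    using Suc.prems Suc.IH[OF C_k_Suc_imp[OF Suc.prems]] by (simp add: C_k_mult)
qed

lemma C_infinity_const: "C_infinity (\<lambda>x. a)"
  by (simp add: C_infinity_def C_k_const)
lemma C_infinity_ident: "C_infinity (\<lambda>x. x)"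
  by (simp add: C_infinity_def C_k_ident)
lemma C_infinity_add: "C_infinity f \<Longrightarrow> C_infinity g \<Longrightarrow> C_infinity (\<lambda>x. f x + g x)"
  by (simp add: C_infinity_def C_k_add)
lemma C_infinity_mult:
  fixes f :: "'a::euclidean_space \<Rightarrow> real"
  shows "C_infinity f \<Longrightarrow> C_infinity g \<Longrightarrow> C_infinity (\<lambda>x. f x * g x)"
  by (simp add: C_infinity_def C_k_mult)
lemma C_infinity_scaleR: "C_infinity f \<Longrightarrow> C_infinity g \<Longrightarrow> C_infinity (\<lambda>x. f x *\<^sub>R g x)"
  by (simp add: C_infinity_def C_k_scaleR)
lemma C_infinity_inner: "C_infinity f \<Longrightarrow> C_infinity g \<Longrightarrow> C_infinity (\<lambda>x. f x \<bullet> g x)"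
  by (simp add: C_infinity_def C_k_inner)
lemma C_infinity_compose:
  fixes f :: "'a::euclidean_space \<Rightarrow> real"
  assumes "\<And>m t. t \<in> S \<Longrightarrow> (G m has_real_derivative G (Suc m) t) (at t)"
    and "\<And>x. f x \<in> S" and "C_infinity f"
  shows "C_infinity (\<lambda>x. G m (f x))"
  unfolding C_infinity_def
proof
  show "C_k k (\<lambda>x. G m (f x))" for k
    by (rule C_k_compose[where S = S and G = G and f = f])
       (use assms(3) in \<open>auto simp: C_infinity_def intro: assms(1,2)\<close>)
qed

lemma C_infinity_cmult:
  fixes f :: "'a::euclidean_space \<Rightarrow> real"
  shows "C_infinity f \<Longrightarrow> C_infinity (\<lambda>x. a * f x)"
  by (rule C_infinity_mult[OF C_infinity_const])

lemma C_infinity_exp: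
  fixes f :: "'a::euclidean_space \<Rightarrow> real"
  assumes "C_infinity f"
  shows "C_infinity (\<lambda>x. exp (f x))"
  by (rule C_infinity_compose[where G = "\<lambda>_. exp" and S = UNIV]) (auto simp: DERIV_exp assms)

lemma C_infinity_powr:
  fixes f :: "'a::euclidean_space \<Rightarrow> real"
  assumes "C_infinity f" "\<And>x. 0 < f x"
  shows "C_infinity (\<lambda>x. f x powr a)"
proof -
  define G where "G = (\<lambda>m t. (\<Prod>i<m. a - real i) * t powr (a - real m))"
  have "(G m has_real_derivative G (Suc m) t) (at t)" if "t \<in> {0<..}" for m t
  proof -
    have "((\<lambda>t. (\<Prod>i<m. a - real i) * t powr (a - real m)) has_real_derivative
          (\<Prod>i<m. a - real i) * ((a - real m) * t powr (a - real m - 1))) (at t)"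
      using that by (intro DERIV_cmult has_real_derivative_powr) auto
    then show ?thesis by (simp add: G_def algebra_simps)
  qed
  then have "C_infinity (\<lambda>x. G 0 (f x))"
    by (rule C_infinity_compose[where S = "{0<..}"]) (use assms in auto)
  then show ?thesis by (simp add: G_def)
qed

lemma C_infinity_imp_differentiable: "C_infinity f \<Longrightarrow> f differentiable (at x)"
  unfolding C_infinity_def by (metis C_k.simps(2))

lemma C_infinity_imp_continuous_on: "C_infinity f \<Longrightarrow> continuous_on S f"
  by (auto intro!: continuous_at_imp_continuous_on differentiable_imp_continuous_within
      C_infinity_imp_differentiable)

lemma C_infinity_partial_deriv: "C_infinity f \<Longrightarrow> i \<in> Basis \<Longrightarrow> C_infinity (partial_deriv i f)"
  unfolding C_infinity_def by (metis C_k.simps(2))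

lemma C_infinity_sum:
  "finite I \<Longrightarrow> (\<And>i. i \<in> I \<Longrightarrow> C_infinity (f i)) \<Longrightarrow> C_infinity (\<lambda>x. \<Sum>i\<in>I. f i x)"
  by (induction I rule: finite_induct) (auto simp: C_infinity_const intro: C_infinity_add)

lemma C_infinity_grad:
  fixes f :: "'a::euclidean_space \<Rightarrow> real"
  assumes "C_infinity f" shows "C_infinity (grad f)"
proof -
  have "C_infinity (\<lambda>x. \<Sum>i\<in>Basis. partial_deriv i f x *\<^sub>R i)"
    by (intro C_infinity_sum C_infinity_scaleR C_infinity_const C_infinity_partial_deriv assms) auto
  moreover have "(\<lambda>x. \<Sum>i\<in>Basis. partial_deriv i f x *\<^sub>R i) = grad f"
    by (simp add: fun_eq_iff grad_def)
  ultimately show ?thesis by simp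
qed

lemma zero_outside_support:
  assumes "x \<notin> closure {x. \<eta> x \<noteq> 0}"
  shows "\<eta> x = 0"
proof (rule ccontr)
  assume "\<eta> x \<noteq> 0"
  then have "x \<in> {x. \<eta> x \<noteq> 0}" by simp
  then have "x \<in> closure {x. \<eta> x \<noteq> 0}" by (rule subsetD[OF closure_subset])
  with assms show False by contradiction
qed

text \<open>
  Stated for every function vanishing with \<open>\<eta>\<close>, since it serves both for \<open>\<eta>\<close> itself and for
  its products and quotients with other functions.
\<close>

lemma has_derivative_outside_support:
  fixes \<eta> f :: "'a::euclidean_space \<Rightarrow> real"
  assumes x: "x \<notin> closure {x. \<eta> x \<noteq> 0}" and f: "\<And>y. \<eta> y = 0 \<Longrightarrow> f y = 0"
  shows "(f has_derivative (\<lambda>h. 0)) (at x)" "\<eta> x = 0"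
proof -
  have z: "f y = 0" if "y \<in> - closure {x. \<eta> x \<noteq> 0}" for y
    using f[OF zero_outside_support[OF ComplD[OF that]]] .
  show "(f has_derivative (\<lambda>h. 0)) (at x)"
    by (rule has_derivative_transform_within_open[of "\<lambda>_. 0" _ _ _ "- closure {x. \<eta> x \<noteq> 0}"])
       (use x in \<open>simp_all only: z has_derivative_const open_Compl closed_closure Compl_iff simp_thms\<close>)
  show "\<eta> x = 0" by (rule zero_outside_support[OF x])
qed

text \<open>
  Dividing by a function that may have zeros outside \<open>\<Omega>\<close> preserves smoothness, because near the
  complement of the support of \<open>\<eta>\<close> the quotient vanishes, whatever the denominator does there.
\<close>

lemma C_k_quotient:
  fixes \<eta> w :: "'a::euclidean_space \<Rightarrow> real"
  assumes "C_k k \<eta>" "C_k k w" "closure {x. \<eta> x \<noteq> 0} \<subseteq> \<Omega>" "\<And>x. x \<in> \<Omega> \<Longrightarrow> w x \<noteq> 0"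
  shows "C_k k (\<lambda>x. \<eta> x / w x)"
  using assms
proof (induction k arbitrary: \<eta> w)
  case 0
  have "isCont (\<lambda>x. \<eta> x / w x) x" for x
  proof (cases "x \<in> closure {x. \<eta> x \<noteq> 0}")
    case True
    then show ?thesis
      using 0 by (intro isCont_divide) (auto simp: continuous_on_eq_continuous_at)
  next
    case False
    have "\<forall>\<^sub>F y in nhds x. \<eta> y / w y = 0"
    proof -
      have "\<forall>\<^sub>F y in nhds x. y \<in> - closure {x. \<eta> x \<noteq> 0}"
        using False by (intro eventually_nhds_in_open) auto
      then show ?thesis
      proof (rule eventually_mono)
        fix y assume "y \<in> - closure {x. \<eta> x \<noteq> 0}"
        from zero_outside_support[OF ComplD[OF this]] show "\<eta> y / w y = 0" by simp
      qed
    qed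
    from isCont_cong[OF this] show ?thesis by simp
  qed
  then show ?case by (simp add: continuous_at_imp_continuous_on)
next
  case (Suc k)
  let ?S = "closure {x. \<eta> x \<noteq> 0}"
  have out: "((\<lambda>x. \<eta> x / w x) has_derivative (\<lambda>h. 0)) (at x)"
    "(\<eta> has_derivative (\<lambda>h. 0)) (at x)" "\<eta> x = 0" if "x \<notin> ?S" for x
    using has_derivative_outside_support[of x \<eta> "\<lambda>x. \<eta> x / w x"]
      has_derivative_outside_support[of x \<eta> \<eta>] that by auto
  have inn: "((\<lambda>x. \<eta> x / w x) has_derivative
      (\<lambda>h. (frechet_derivative \<eta> (at x) h * w x - \<eta> x * frechet_derivative w (at x) h) / (w x * w x))) (at x)"
    if "x \<in> ?S" for x
  proof -
    have d: "(\<eta> has_derivative frechet_derivative \<eta> (at x)) (at x)"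
      "(w has_derivative frechet_derivative w (at x)) (at x)"
      using Suc.prems(1,2) by (simp_all add: frechet_derivative_works[symmetric])
    have w: "w x \<noteq> 0" using that Suc.prems by auto
    show ?thesis by (rule has_derivative_divide'[OF d w])
  qed
  have diff: "(\<lambda>x. \<eta> x / w x) differentiable (at x)" for x
    using differentiableI[OF inn[of x]] differentiableI[OF out(1)[of x]] by blast
  have eq: "partial_deriv i (\<lambda>x. \<eta> x / w x) =
     (\<lambda>x. (partial_deriv i \<eta> x * w x + (-1) * (\<eta> x * partial_deriv i w x)) / (w x * w x))" for i
  proof
    fix x
    show "partial_deriv i (\<lambda>x. \<eta> x / w x) x =
      (partial_deriv i \<eta> x * w x + (-1) * (\<eta> x * partial_deriv i w x)) / (w x * w x)"
    proof (cases "x \<in> ?S")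
      case True
      show ?thesis using partial_deriv_eq[OF inn[OF True], of i] by (simp add: partial_deriv_def)
    next
      case False
      show ?thesis
        using partial_deriv_eq[OF out(1)[OF False], of i] partial_deriv_eq[OF out(2)[OF False], of i]
          out(3)[OF False] by simp
    qed
  qed
  have "C_k k (\<lambda>x. (partial_deriv i \<eta> x * w x + (-1) * (\<eta> x * partial_deriv i w x)) / (w x * w x))"
    if i: "i \<in> Basis" for i
  proof (rule Suc.IH)
    show "C_k k (\<lambda>x. partial_deriv i \<eta> x * w x + (-1) * (\<eta> x * partial_deriv i w x))"
      using Suc.prems(1,2) i C_k_Suc_imp[OF Suc.prems(1)] C_k_Suc_imp[OF Suc.prems(2)]
      by (intro C_k_add C_k_mult C_k_const) auto
    show "C_k k (\<lambda>x. w x * w x)"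
      using C_k_Suc_imp[OF Suc.prems(2)] by (intro C_k_mult)
    have "partial_deriv i \<eta> x * w x + (-1) * (\<eta> x * partial_deriv i w x) = 0" if "x \<notin> ?S" for x
      using partial_deriv_eq[OF out(2)[OF that], of i] out(3)[OF that] by simp
    then have "{x. partial_deriv i \<eta> x * w x + (-1) * (\<eta> x * partial_deriv i w x) \<noteq> 0} \<subseteq> ?S" by auto
    then show "closure {x. partial_deriv i \<eta> x * w x + (-1) * (\<eta> x * partial_deriv i w x) \<noteq> 0} \<subseteq> \<Omega>"
      by (rule subset_trans[OF closure_minimal[OF _ closed_closure] Suc.prems(3)])
    show "w x * w x \<noteq> 0" if "x \<in> \<Omega>" for x using Suc.prems(4) that by simp
  qed
  then show ?case using diff eq by simp
qed

lemma test_function_subset: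
  assumes "test_function \<Omega> \<eta>" "C_infinity \<theta>" "\<And>x. \<eta> x = 0 \<Longrightarrow> \<theta> x = 0"
  shows "test_function \<Omega> \<theta>"
proof -
  have "{x. \<theta> x \<noteq> 0} \<subseteq> {x. \<eta> x \<noteq> 0}" using assms(3) by auto
  then have "closure {x. \<theta> x \<noteq> 0} \<subseteq> closure {x. \<eta> x \<noteq> 0}" by (rule closure_mono)
  with assms show ?thesis
    unfolding test_function_def
    using compact_Int_closed[of "closure {x. \<eta> x \<noteq> 0}" "closure {x. \<theta> x \<noteq> 0}"]
    by (auto simp: inf.absorb2)
qed

lemma test_function_mult:
  assumes "test_function \<Omega> \<eta>" "C_infinity g"
  shows "test_function \<Omega> (\<lambda>x. g x * \<eta> x)"
  using assms by (intro test_function_subset[OF assms(1)] C_infinity_mult)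
    (auto simp: test_function_def)

lemma test_function_divide:
  assumes "test_function \<Omega> \<eta>" "C_infinity w" "\<And>x. x \<in> \<Omega> \<Longrightarrow> 0 < w x"
  shows "test_function \<Omega> (\<lambda>x. \<eta> x / w x)"
proof (rule test_function_subset[OF assms(1)])
  show "C_infinity (\<lambda>x. \<eta> x / w x)"
    unfolding C_infinity_def
  proof
    fix k
    have "C_k k \<eta>" "C_k k w" "closure {x. \<eta> x \<noteq> 0} \<subseteq> \<Omega>" "\<And>x. x \<in> \<Omega> \<Longrightarrow> w x \<noteq> 0"
      using assms unfolding test_function_def C_infinity_def by (blast, blast, blast, force)
    then show "C_k k (\<lambda>x. \<eta> x / w x)" by (rule C_k_quotient)
  qed
qed auto

lemma test_function_zero_outside:
  assumes "test_function \<Omega> \<eta>" "x \<notin> \<Omega>"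
  shows "\<eta> x = 0" "grad \<eta> x = 0"
proof -
  have x: "x \<notin> closure {x. \<eta> x \<noteq> 0}" using assms by (auto simp: test_function_def)
  show "\<eta> x = 0" using has_derivative_outside_support(2)[OF x, of \<eta>] by simp
  show "grad \<eta> x = 0"
    using has_derivative_outside_support(1)[OF x, of \<eta>] by (intro grad_eq) simp
qed

section \<open>Integration against test functions\<close>

lemma lipschitz_of_grad_bound:
  fixes f :: "'a::euclidean_space \<Rightarrow> real"
  assumes "convex S" "\<And>x. f differentiable (at x)" "\<And>x. x \<in> S \<Longrightarrow> norm (grad f x) \<le> B"
    and "x \<in> S" "y \<in> S"
  shows "\<bar>f x - f y\<bar> \<le> B * norm (x - y)"
proof -
  have "norm (f x - f y) \<le> B * norm (x - y)"
  proof (rule differentiable_bound[OF assms(1) _ _ assms(4,5)])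
    show "(f has_derivative (\<lambda>h. grad f z \<bullet> h)) (at z within S)" for z
      using has_derivative_grad[OF assms(2)] by (rule has_derivative_at_withinI)
    show "onorm (\<lambda>h. grad f z \<bullet> h) \<le> B" if "z \<in> S" for z
    proof (rule onorm_le)
      fix h
      have "norm (grad f z \<bullet> h) \<le> norm (grad f z) * norm h" by (simp add: Cauchy_Schwarz_ineq2)
      also have "\<dots> \<le> B * norm h" using assms(3)[OF that] by (intro mult_right_mono) auto
      finally show "norm (grad f z \<bullet> h) \<le> B * norm h" .
    qed
  qed
  then show ?thesis by simp
qed

lemma integrable_continuous_support:
  fixes f :: "'a::euclidean_space \<Rightarrow> real"
  assumes "continuous_on UNIV f" "compact K" "\<And>x. x \<notin> K \<Longrightarrow> f x = 0"
  shows "integrable lborel f"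
proof -
  have "integrable lborel (\<lambda>x. indicator K x *\<^sub>R f x)"
    using assms by (intro borel_integrable_compact) (auto intro: continuous_on_subset)
  moreover have "(\<lambda>x. indicator K x *\<^sub>R f x) = f"
    using assms(3) by (auto simp: fun_eq_iff indicator_def)
  ultimately show ?thesis by simp
qed

text \<open>
  Integrating a partial derivative is differentiating the integral of a translate, and that
  integral does not depend on the translation.
\<close>

lemma integral_partial_deriv_eq_0:
  fixes h :: "'a::euclidean_space \<Rightarrow> real"
  assumes h: "C_infinity h" and K: "compact K" "\<And>x. x \<notin> K \<Longrightarrow> h x = 0" and i: "i \<in> Basis"
  shows "(LINT x|lborel. partial_deriv i h x) = 0"
proof -
  have dh: "h differentiable (at x)" for x using h by (rule C_infinity_imp_differentiable)
  have conth: "continuous_on S h" for S using h by (rule C_infinity_imp_continuous_on)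
  have contg: "continuous_on UNIV (grad h)"
    using h by (intro C_infinity_imp_continuous_on C_infinity_grad)
  obtain r where r: "K \<subseteq> ball 0 r"
    using K(1) compact_imp_bounded bounded_subset_ballD by blast
  have "h x = 0" if "x \<notin> ball 0 r" for x using K(2) r that by blast
  then have h0: "h x = 0" if "norm x \<ge> r" for x using that by auto
  define t where "t = (\<lambda>n::nat. inverse (real (Suc n)))"
  have t: "0 < t n" "t n \<le> 1" for n by (auto simp: t_def inverse_le_1_iff)
  have t0: "t \<longlonglongrightarrow> 0" unfolding t_def by (rule LIMSEQ_inverse_real_of_nat)
  define q where "q = (\<lambda>n x. (h (x + t n *\<^sub>R i) - h x) / t n)"
  have "\<exists>B. \<forall>x\<in>cball 0 (r + 2). norm (grad h x) \<le> B"
    using compact_imp_bounded[OF compact_continuous_image[OF continuous_on_subset[OF contg] compact_cball]]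
    unfolding bounded_iff by auto
  then obtain B where B: "\<And>x. x \<in> cball 0 (r + 2) \<Longrightarrow> norm (grad h x) \<le> B" by blast
  have qb: "norm (q n x) \<le> indicator (cball 0 (r + 1)) x * B" for n x
  proof (cases "x \<in> cball 0 (r + 1)")
    case True
    have "norm (x + t n *\<^sub>R i) \<le> norm x + norm (t n *\<^sub>R i)" by (rule norm_triangle_ineq)
    also have "\<dots> \<le> r + 2" using True t[of n] i by auto
    finally have "\<bar>h (x + t n *\<^sub>R i) - h x\<bar> \<le> B * norm (x + t n *\<^sub>R i - x)"
      using True B by (intro lipschitz_of_grad_bound[of "cball 0 (r + 2)"] dh) auto
    also have "\<dots> = B * t n" using t[of n] i by simp
    finally show ?thesis using True t[of n] by (simp add: q_def abs_divide field_simps)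
  next
    case False
    then have n: "norm x > r + 1" by simp
    have "norm x \<le> norm (x + t n *\<^sub>R i) + norm (t n *\<^sub>R i)"
      using norm_triangle_ineq4[of "x + t n *\<^sub>R i" "t n *\<^sub>R i"] by simp
    then have "norm (x + t n *\<^sub>R i) \<ge> r" using n t[of n] i by auto
    then show ?thesis using False n h0 by (simp add: q_def)
  qed
  have inth: "integrable lborel h" by (rule integrable_continuous_support[OF conth K])
  have hm: "h \<in> borel_measurable borel" using conth by (rule borel_measurable_continuous_onI)
  have tr: "integrable lborel (\<lambda>x. h (x + a))" "(LINT x|lborel. h (x + a)) = (LINT x|lborel. h x)" for a
  proof -
    have "integrable (distr lborel borel ((+) a)) h" by (subst lborel_distr_plus) (rule inth)
    then show "integrable lborel (\<lambda>x. h (x + a))"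
      by (subst (asm) integrable_distr_eq) (auto simp: hm add.commute)
    have "(LINT x|lborel. h x) = (LINT x|distr lborel borel ((+) a). h x)"
      by (subst lborel_distr_plus) simp
    also have "\<dots> = (LINT x|lborel. h (a + x))" by (subst integral_distr) (auto simp: hm)
    finally show "(LINT x|lborel. h (x + a)) = (LINT x|lborel. h x)" by (simp add: add.commute)
  qed
  have q0: "(LINT x|lborel. q n x) = 0" for n
    using tr[of "t n *\<^sub>R i"] inth by (simp add: q_def)
  have lim: "(\<lambda>n. q n x) \<longlonglongrightarrow> partial_deriv i h x" for x
  proof -
    have "((\<lambda>s. x + s *\<^sub>R i) has_derivative (\<lambda>s. s *\<^sub>R i)) (at 0)"
      by (auto intro!: derivative_eq_intros)
    moreover have "(h has_derivative (\<lambda>v. grad h x \<bullet> v)) (at (x + 0 *\<^sub>R i))"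
      using has_derivative_grad[OF dh[of x]] by simp
    ultimately have "((\<lambda>s. h (x + s *\<^sub>R i)) has_derivative (\<lambda>s. grad h x \<bullet> (s *\<^sub>R i))) (at 0)"
      by (rule has_derivative_compose)
    then have "((\<lambda>s. h (x + s *\<^sub>R i)) has_field_derivative partial_deriv i h x) (at 0)"
      unfolding has_field_derivative_def
      by (rule has_derivative_eq_rhs) (simp add: fun_eq_iff grad_inner_Basis[OF i])
    then have "((\<lambda>s. (h (x + s *\<^sub>R i) - h x) / s) \<longlongrightarrow> partial_deriv i h x) (at 0)"
      by (simp add: has_field_derivative_iff)
    moreover have "filterlim t (at 0) sequentially"
      using t0 t(1) by (auto simp: filterlim_at less_imp_neq[symmetric] intro!: always_eventually)
    ultimately show ?thesis
      unfolding q_def by (rule filterlim_compose)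
  qed
  have "(\<lambda>n. LINT x|lborel. q n x) \<longlonglongrightarrow> (LINT x|lborel. partial_deriv i h x)"
  proof (rule integral_dominated_convergence[where w = "\<lambda>x. indicator (cball 0 (r + 1)) x * B"])
    show "partial_deriv i h \<in> borel_measurable lborel"
      using C_infinity_imp_continuous_on[OF C_infinity_partial_deriv[OF h i]]
      by (simp add: borel_measurable_continuous_onI)
    show "q n \<in> borel_measurable lborel" for n
      unfolding q_def using borel_measurable_integrable[OF tr(1)] hm by simp
    have "integrable lborel (\<lambda>x. indicator (cball 0 (r + 1)) x *\<^sub>R B)"
      by (intro borel_integrable_compact) auto
    then show "integrable lborel (\<lambda>x. indicator (cball 0 (r + 1)) x * B)" by simp
  qed (use lim qb in auto)
  then show ?thesis unfolding q0 by (simp add: LIMSEQ_const_iff)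
qed

lemma test_functionD:
  assumes "test_function \<Omega> \<eta>"
  shows "C_infinity \<eta>" "compact (closure {x. \<eta> x \<noteq> 0})" "closure {x. \<eta> x \<noteq> 0} \<subseteq> \<Omega>"
  using assms unfolding test_function_def by blast+

lemma grad_integrable_support:
  fixes \<eta> v :: "'a::euclidean_space \<Rightarrow> real"
  assumes v: "C_infinity v" and \<eta>: "test_function \<Omega> \<eta>"
  shows "integrable lborel (\<lambda>x. laplacian v x * \<eta> x + grad v x \<bullet> grad \<eta> x)"
    and "(LINT x|lborel. laplacian v x * \<eta> x + grad v x \<bullet> grad \<eta> x) = 0"
proof -
  define K where "K = closure {x. \<eta> x \<noteq> 0}"
  have K: "compact K" "\<And>x. x \<notin> K \<Longrightarrow> \<eta> x = 0"
    unfolding K_def using \<eta> zero_outside_support by (blast dest: test_functionD, blast)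
  have C: "C_infinity \<eta>" using \<eta> by (simp add: test_function_def)
  let ?h = "\<lambda>i x. partial_deriv i v x * \<eta> x"
  have hC: "C_infinity (?h i)" if "i \<in> Basis" for i
    using v C that by (intro C_infinity_mult C_infinity_partial_deriv)
  have eq: "laplacian v x * \<eta> x + grad v x \<bullet> grad \<eta> x = (\<Sum>i\<in>Basis. partial_deriv i (?h i) x)" for x
  proof -
    have "partial_deriv i (?h i) x = partial_deriv i v x * partial_deriv i \<eta> x
        + partial_deriv i (partial_deriv i v) x * \<eta> x" if "i \<in> Basis" for i
      using C_infinity_imp_differentiable[OF C_infinity_partial_deriv[OF v that]]
        C_infinity_imp_differentiable[OF C]
      by (rule bounded_bilinear.partial_deriv_prod[OF bounded_bilinear_mult])
    moreover have "grad v x \<bullet> grad \<eta> x = (\<Sum>i\<in>Basis. partial_deriv i v x * partial_deriv i \<eta> x)"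
      by (subst euclidean_inner) (simp add: grad_inner_Basis)
    ultimately show ?thesis
      by (simp add: laplacian_def sum_distrib_right sum.distrib)
  qed
  have int: "integrable lborel (partial_deriv i (?h i))" if i: "i \<in> Basis" for i
  proof (rule integrable_continuous_support[OF _ K(1)])
    show "continuous_on UNIV (partial_deriv i (?h i))"
      using C_infinity_imp_continuous_on[OF C_infinity_partial_deriv[OF hC[OF i] i]] .
    fix x assume "x \<notin> K"
    then have "(?h i has_derivative (\<lambda>h. 0)) (at x)"
      unfolding K_def by (rule has_derivative_outside_support) simp
    then show "partial_deriv i (?h i) x = 0" by (simp add: partial_deriv_eq)
  qed
  show "integrable lborel (\<lambda>x. laplacian v x * \<eta> x + grad v x \<bullet> grad \<eta> x)"
    unfolding eq using int by (intro Bochner_Integration.integrable_sum)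
  show "(LINT x|lborel. laplacian v x * \<eta> x + grad v x \<bullet> grad \<eta> x) = 0"
    unfolding eq
    using int integral_partial_deriv_eq_0[OF hC K(1)] K(2)
    by (subst Bochner_Integration.integral_sum) auto
qed

lemma LINT_lebesgue_on:
  fixes f :: "'a::euclidean_space \<Rightarrow> real"
  assumes "f \<in> borel_measurable borel" "\<And>x. x \<notin> \<Omega> \<Longrightarrow> f x = 0" "\<Omega> \<in> sets lebesgue"
  shows "(LINT x|lebesgue_on \<Omega>. f x) = (LINT x|lborel. f x)"
    and "integrable (lebesgue_on \<Omega>) f \<longleftrightarrow> integrable lborel f"
proof -
  have *: "(\<lambda>x. indicator \<Omega> x *\<^sub>R f x) = f"
    using assms(2) by (auto simp: fun_eq_iff indicator_def)
  show "(LINT x|lebesgue_on \<Omega>. f x) = (LINT x|lborel. f x)"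
    using assms(1,3) integral_restrict_space[of \<Omega> lebesgue f]
    by (simp add: *[simplified] integral_completion)
  show "integrable (lebesgue_on \<Omega>) f \<longleftrightarrow> integrable lborel f"
    using assms(1,3) integrable_restrict_space[of \<Omega> lebesgue f]
    by (simp add: *[simplified] integrable_completion)
qed

text \<open>
  The integration by parts leaves no boundary term, because the test function vanishes near the
  boundary.
\<close>

lemma classical_imp_weak:
  fixes v :: "'a::euclidean_space \<Rightarrow> real"
  assumes v: "C_infinity v" and eqn: "\<And>x. x \<in> \<Omega> \<Longrightarrow> elliptic_op b c v x = - \<mu> * v x"
    and \<Omega>: "\<Omega> \<in> sets lebesgue" and \<eta>: "test_function \<Omega> \<eta>"
  shows "(LINT x|lebesgue_on \<Omega>. grad v x \<bullet> grad \<eta> x - (b x \<bullet> grad v x) * \<eta> x - c x * v x * \<eta> x)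
    = (LINT x|lebesgue_on \<Omega>. \<mu> * v x * \<eta> x)"
proof -
  have C: "C_infinity \<eta>" using \<eta> by (simp add: test_function_def)
  have "(LINT x|lebesgue_on \<Omega>. grad v x \<bullet> grad \<eta> x - (b x \<bullet> grad v x) * \<eta> x - c x * v x * \<eta> x)
    = (LINT x|lebesgue_on \<Omega>. (laplacian v x * \<eta> x + grad v x \<bullet> grad \<eta> x) + \<mu> * v x * \<eta> x)"
  proof (rule Bochner_Integration.integral_cong)
    fix x assume "x \<in> space (lebesgue_on \<Omega>)"
    then have "elliptic_op b c v x * \<eta> x = - \<mu> * v x * \<eta> x" using eqn by simp
    then show "grad v x \<bullet> grad \<eta> x - (b x \<bullet> grad v x) * \<eta> x - c x * v x * \<eta> x =
        (laplacian v x * \<eta> x + grad v x \<bullet> grad \<eta> x) + \<mu> * v x * \<eta> x"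
      unfolding elliptic_op_def by (simp add: algebra_simps)
  qed simp
  also have "\<dots> = (LINT x|lebesgue_on \<Omega>. laplacian v x * \<eta> x + grad v x \<bullet> grad \<eta> x)
      + (LINT x|lebesgue_on \<Omega>. \<mu> * v x * \<eta> x)"
  proof (rule Bochner_Integration.integral_add)
    show "integrable (lebesgue_on \<Omega>) (\<lambda>x. laplacian v x * \<eta> x + grad v x \<bullet> grad \<eta> x)"
      using grad_integrable_support(1)[OF v \<eta>] test_function_zero_outside[OF \<eta>] \<Omega>
      by (subst LINT_lebesgue_on(2)) (auto dest: borel_measurable_integrable)
    have c: "continuous_on UNIV (\<lambda>x. \<mu> * v x * \<eta> x)"
      using C v by (intro continuous_intros C_infinity_imp_continuous_on)
    have "integrable lborel (\<lambda>x. \<mu> * v x * \<eta> x)"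
    proof (rule integrable_continuous_support[OF c])
      show "compact (closure {x. \<eta> x \<noteq> 0})" using \<eta> by (rule test_functionD)
      show "\<mu> * v x * \<eta> x = 0" if "x \<notin> closure {x. \<eta> x \<noteq> 0}" for x
        using zero_outside_support[OF that] by simp
    qed
    then show "integrable (lebesgue_on \<Omega>) (\<lambda>x. \<mu> * v x * \<eta> x)"
      using test_function_zero_outside[OF \<eta>] \<Omega>
      by (subst LINT_lebesgue_on(2)) (auto dest: borel_measurable_integrable)
  qed
  also have "(LINT x|lebesgue_on \<Omega>. laplacian v x * \<eta> x + grad v x \<bullet> grad \<eta> x) = 0"
    using grad_integrable_support[OF v \<eta>] test_function_zero_outside[OF \<eta>] \<Omega>
    by (subst LINT_lebesgue_on(1)) (auto dest: borel_measurable_integrable)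
  finally show ?thesis by simp
qed

section \<open>Square integrable functions on a bounded domain\<close>

lemma square_integrable_continuous:
  fixes f :: "'a::euclidean_space \<Rightarrow> 'b::euclidean_space"
  assumes "continuous_on UNIV f" "bounded \<Omega>" "\<Omega> \<in> sets lebesgue"
  shows "square_integrable \<Omega> f"
proof -
  have m: "f \<in> borel_measurable (lebesgue_on \<Omega>)"
    using assms continuous_imp_measurable_on_sets_lebesgue continuous_on_subset by blast
  interpret finite_measure "lebesgue_on \<Omega>"
    using assms by (intro finite_measure_lebesgue_on bounded_set_imp_lmeasurable)
  have "bounded (f ` closure \<Omega>)"
    using assms by (intro compact_imp_bounded compact_continuous_image)
      (auto intro: continuous_on_subset simp: compact_closure)
  then obtain B where B: "\<And>x. x \<in> closure \<Omega> \<Longrightarrow> norm (f x) \<le> B"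
    unfolding bounded_iff by auto
  have "integrable (lebesgue_on \<Omega>) (\<lambda>x. (norm (f x))\<^sup>2)"
  proof (rule integrable_const_bound[where B = "B\<^sup>2"])
    show "AE x in lebesgue_on \<Omega>. norm ((norm (f x))\<^sup>2) \<le> B\<^sup>2"
      using B closure_subset[of \<Omega>] by (intro AE_I2) (auto intro!: power_mono)
  qed (use m in measurable)
  with m show ?thesis by (simp add: square_integrable_def)
qed

lemma square_integrable_measurable: "square_integrable \<Omega> f \<Longrightarrow> f \<in> borel_measurable (lebesgue_on \<Omega>)"
  by (simp add: square_integrable_def)

lemma square_integrable_inner:
  assumes "square_integrable \<Omega> f" "square_integrable \<Omega> g"
  shows "integrable (lebesgue_on \<Omega>) (\<lambda>x. f x \<bullet> g x)"
proof (rule Bochner_Integration.integrable_bound[where f = "\<lambda>x. (norm (f x))\<^sup>2 + (norm (g x))\<^sup>2"])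
  have [measurable]: "f \<in> borel_measurable (lebesgue_on \<Omega>)" "g \<in> borel_measurable (lebesgue_on \<Omega>)"
    using assms by (auto simp: square_integrable_def)
  show "(\<lambda>x. f x \<bullet> g x) \<in> borel_measurable (lebesgue_on \<Omega>)" by measurable
  show "AE x in lebesgue_on \<Omega>. norm (f x \<bullet> g x) \<le> norm ((norm (f x))\<^sup>2 + (norm (g x))\<^sup>2)"
  proof (rule AE_I2)
    fix x
    have "\<bar>f x \<bullet> g x\<bar> \<le> norm (f x) * norm (g x)" by (rule Cauchy_Schwarz_ineq2)
    also have "\<dots> \<le> (norm (f x))\<^sup>2 + (norm (g x))\<^sup>2"
      using sum_squares_bound[of "norm (f x)" "norm (g x)"]
        mult_nonneg_nonneg[OF norm_ge_zero norm_ge_zero, of "f x" "g x"] by linarith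
    finally show "norm (f x \<bullet> g x) \<le> norm ((norm (f x))\<^sup>2 + (norm (g x))\<^sup>2)" by simp
  qed
qed (use assms in \<open>auto simp: square_integrable_def\<close>)

lemma square_integrable_mult:
  fixes f g :: "'a::euclidean_space \<Rightarrow> real"
  assumes "square_integrable \<Omega> f" "square_integrable \<Omega> g"
  shows "integrable (lebesgue_on \<Omega>) (\<lambda>x. f x * g x)"
  using square_integrable_inner[OF assms] by simp

lemma square_integrable_bounded_mult:
  fixes f :: "'a::euclidean_space \<Rightarrow> 'b::euclidean_space"
  assumes f: "square_integrable \<Omega> f" and w: "w \<in> borel_measurable (lebesgue_on \<Omega>)"
    and B: "\<And>x. x \<in> \<Omega> \<Longrightarrow> \<bar>w x\<bar> \<le> B"
  shows "square_integrable \<Omega> (\<lambda>x. w x *\<^sub>R f x)"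
  unfolding square_integrable_def
proof
  have [measurable]: "f \<in> borel_measurable (lebesgue_on \<Omega>)" using f by (simp add: square_integrable_def)
  note w[measurable]
  show "(\<lambda>x. w x *\<^sub>R f x) \<in> borel_measurable (lebesgue_on \<Omega>)" by measurable
  show "integrable (lebesgue_on \<Omega>) (\<lambda>x. (norm (w x *\<^sub>R f x))\<^sup>2)"
  proof (rule Bochner_Integration.integrable_bound[where f = "\<lambda>x. B\<^sup>2 * (norm (f x))\<^sup>2"])
    show "AE x in lebesgue_on \<Omega>. norm ((norm (w x *\<^sub>R f x))\<^sup>2) \<le> norm (B\<^sup>2 * (norm (f x))\<^sup>2)"
    proof (rule AE_I2)
      fix x assume "x \<in> space (lebesgue_on \<Omega>)"
      then have "\<bar>w x\<bar>\<^sup>2 \<le> B\<^sup>2" using B by (intro power_mono) auto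
      then show "norm ((norm (w x *\<^sub>R f x))\<^sup>2) \<le> norm (B\<^sup>2 * (norm (f x))\<^sup>2)"
        by (simp add: power_mult_distrib mult_right_mono)
    qed
  qed (use f in \<open>auto simp: square_integrable_def\<close>)
qed

lemma square_integrable_add:
  fixes f g :: "'a::euclidean_space \<Rightarrow> 'b::euclidean_space"
  assumes "square_integrable \<Omega> f" "square_integrable \<Omega> g"
  shows "square_integrable \<Omega> (\<lambda>x. f x + g x)"
proof -
  have "integrable (lebesgue_on \<Omega>) (\<lambda>x. (norm (f x))\<^sup>2 + (norm (g x))\<^sup>2 + 2 * (f x \<bullet> g x))"
    using assms square_integrable_inner[OF assms] by (auto simp: square_integrable_def)
  moreover have "(\<lambda>x. (norm (f x + g x))\<^sup>2) = (\<lambda>x. (norm (f x))\<^sup>2 + (norm (g x))\<^sup>2 + 2 * (f x \<bullet> g x))"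
    by (simp add: fun_eq_iff power2_norm_eq_inner inner_add_left inner_add_right inner_commute)
  ultimately show ?thesis
    using assms by (auto simp: square_integrable_def)
qed

lemma square_integrable_cmult:
  fixes f :: "'a::euclidean_space \<Rightarrow> 'b::euclidean_space"
  assumes "square_integrable \<Omega> f" shows "square_integrable \<Omega> (\<lambda>x. a *\<^sub>R f x)"
  using assms by (intro square_integrable_bounded_mult[where B = "\<bar>a\<bar>"]) auto

lemma square_integrable_diff:
  fixes f g :: "'a::euclidean_space \<Rightarrow> 'b::euclidean_space"
  assumes "square_integrable \<Omega> f" "square_integrable \<Omega> g"
  shows "square_integrable \<Omega> (\<lambda>x. f x - g x)"
  using square_integrable_add[OF assms(1) square_integrable_cmult[OF assms(2), of "-1"]] by simp

text \<open>
  The absolute value stands inside the integral so that \<open>h = 1\<close> turns \<open>L\<^sup>2\<close> convergence into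
  \<open>L\<^sup>1\<close> convergence.
\<close>

lemma L2_inner_tendsto_0:
  fixes h :: "'a::euclidean_space \<Rightarrow> 'b::euclidean_space" and d :: "nat \<Rightarrow> 'a \<Rightarrow> 'b"
  assumes h: "square_integrable \<Omega> h" and d: "\<And>k. square_integrable \<Omega> (d k)"
    and lim: "(\<lambda>k. LINT x|lebesgue_on \<Omega>. (norm (d k x))\<^sup>2) \<longlonglongrightarrow> 0"
  shows "(\<lambda>k. LINT x|lebesgue_on \<Omega>. \<bar>h x \<bullet> d k x\<bar>) \<longlonglongrightarrow> 0"
proof -
  define H where "H = (LINT x|lebesgue_on \<Omega>. (norm (h x))\<^sup>2)"
  define D where "D = (\<lambda>k. LINT x|lebesgue_on \<Omega>. (norm (d k x))\<^sup>2)"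
  \<comment> \<open>The integrand is at most \<open>t |h|\<^sup>2 + |d|\<^sup>2 / t\<close>; this \<open>t\<close> makes both integrals tend to 0 and is
    never 0.\<close>
  define t where "t = (\<lambda>k. sqrt (D k) + inverse (real (Suc k)))"
  have D0: "0 \<le> D k" for k by (simp add: D_def)
  have t: "0 < t k" for k using D0[of k] by (simp add: t_def add_nonneg_pos)
  have bd: "(LINT x|lebesgue_on \<Omega>. \<bar>h x \<bullet> d k x\<bar>) \<le> t k * H + sqrt (D k)" for k
  proof -
    have "(LINT x|lebesgue_on \<Omega>. \<bar>h x \<bullet> d k x\<bar>)
      \<le> (LINT x|lebesgue_on \<Omega>. t k * (norm (h x))\<^sup>2 + (norm (d k x))\<^sup>2 / t k)"
    proof (rule integral_mono)
      show "integrable (lebesgue_on \<Omega>) (\<lambda>x. \<bar>h x \<bullet> d k x\<bar>)"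
        using square_integrable_inner[OF h d] by (rule integrable_abs)
      show "integrable (lebesgue_on \<Omega>) (\<lambda>x. t k * (norm (h x))\<^sup>2 + (norm (d k x))\<^sup>2 / t k)"
        using h d by (auto simp: square_integrable_def)
      fix x
      have *: "\<bar>h x \<bullet> d k x\<bar> \<le> norm (h x) * norm (d k x)" by (rule Cauchy_Schwarz_ineq2)
      have s: "sqrt (t k) * sqrt (t k) = t k" "sqrt (t k) > 0" using t[of k] by auto
      have "2 * (norm (h x) * norm (d k x)) = 2 * (sqrt (t k) * norm (h x)) * (norm (d k x) / sqrt (t k))"
        using s by (simp add: field_simps)
      also have "\<dots> \<le> (sqrt (t k) * norm (h x))\<^sup>2 + (norm (d k x) / sqrt (t k))\<^sup>2"
        by (rule sum_squares_bound)
      also have "\<dots> = t k * (norm (h x))\<^sup>2 + (norm (d k x))\<^sup>2 / t k"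
        using t[of k] by (simp add: power_mult_distrib power_divide)
      finally show "\<bar>h x \<bullet> d k x\<bar> \<le> t k * (norm (h x))\<^sup>2 + (norm (d k x))\<^sup>2 / t k"
        using * by (smt (verit) mult_nonneg_nonneg norm_ge_zero)
    qed
    also have "\<dots> = t k * H + D k / t k"
      using h d by (subst Bochner_Integration.integral_add) (auto simp: square_integrable_def H_def D_def)
    also have "D k / t k \<le> sqrt (D k)"
    proof -
      have "D k = sqrt (D k) * sqrt (D k)" using D0[of k] by simp
      also have "\<dots> \<le> sqrt (D k) * t k" using D0[of k] by (intro mult_left_mono) (auto simp: t_def)
      finally show ?thesis using t[of k] by (simp add: divide_le_eq mult.commute)
    qed
    finally show ?thesis by simp
  qed
  have lim0: "(\<lambda>k. t k * H + sqrt (D k)) \<longlonglongrightarrow> 0"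
  proof -
    have "(\<lambda>k. sqrt (D k)) \<longlonglongrightarrow> sqrt 0"
      using lim unfolding D_def by (rule tendsto_real_sqrt)
    moreover from this have "t \<longlonglongrightarrow> sqrt 0 + 0"
      unfolding t_def by (intro tendsto_add LIMSEQ_inverse_real_of_nat)
    ultimately have "(\<lambda>k. t k * H + sqrt (D k)) \<longlonglongrightarrow> (sqrt 0 + 0) * H + sqrt 0"
      by (intro tendsto_add tendsto_mult tendsto_const)
    then show ?thesis by simp
  qed
  have nn: "0 \<le> (LINT x|lebesgue_on \<Omega>. \<bar>h x \<bullet> d k x\<bar>)" for k
    by (rule Bochner_Integration.integral_nonneg) simp
  show ?thesis
    by (rule tendsto_sandwich[OF always_eventually[OF allI[OF nn]]
          always_eventually[OF allI[OF bd]] tendsto_const lim0])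
qed

lemma L2_inner_tendsto:
  fixes h :: "'a::euclidean_space \<Rightarrow> 'b::euclidean_space" and f :: "nat \<Rightarrow> 'a \<Rightarrow> 'b"
  assumes h: "square_integrable \<Omega> h" and f: "\<And>k. square_integrable \<Omega> (f k)" "square_integrable \<Omega> g"
    and lim: "(\<lambda>k. LINT x|lebesgue_on \<Omega>. (norm (f k x - g x))\<^sup>2) \<longlonglongrightarrow> 0"
  shows "(\<lambda>k. LINT x|lebesgue_on \<Omega>. h x \<bullet> f k x) \<longlonglongrightarrow> (LINT x|lebesgue_on \<Omega>. h x \<bullet> g x)"
proof -
  have d: "square_integrable \<Omega> (\<lambda>x. f k x - g x)" for k
    by (intro square_integrable_diff f)
  have "norm ((LINT x|lebesgue_on \<Omega>. h x \<bullet> f k x) - (LINT x|lebesgue_on \<Omega>. h x \<bullet> g x))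
      \<le> (LINT x|lebesgue_on \<Omega>. \<bar>h x \<bullet> (f k x - g x)\<bar>)" for k
  proof -
    have "(LINT x|lebesgue_on \<Omega>. h x \<bullet> f k x) - (LINT x|lebesgue_on \<Omega>. h x \<bullet> g x)
      = (LINT x|lebesgue_on \<Omega>. h x \<bullet> (f k x - g x))"
      by (simp add: inner_diff_right square_integrable_inner[OF h f(1)] square_integrable_inner[OF h f(2)])
    then show ?thesis by (simp add: integral_abs_bound)
  qed
  then have "(\<lambda>k. (LINT x|lebesgue_on \<Omega>. h x \<bullet> f k x) - (LINT x|lebesgue_on \<Omega>. h x \<bullet> g x)) \<longlonglongrightarrow> 0"
    by (intro Lim_null_comparison[OF always_eventually L2_inner_tendsto_0[OF h d lim]]) auto
  then show ?thesis by (simp add: LIM_zero_iff)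
qed

lemma L2_weighted_norm_tendsto:
  fixes f :: "nat \<Rightarrow> 'a::euclidean_space \<Rightarrow> 'b::euclidean_space"
  assumes w: "w \<in> borel_measurable (lebesgue_on \<Omega>)" "\<And>x. x \<in> \<Omega> \<Longrightarrow> \<bar>w x\<bar> \<le> B"
    and f: "\<And>k. square_integrable \<Omega> (f k)" "square_integrable \<Omega> g"
    and lim: "(\<lambda>k. LINT x|lebesgue_on \<Omega>. (norm (f k x - g x))\<^sup>2) \<longlonglongrightarrow> 0"
  shows "(\<lambda>k. LINT x|lebesgue_on \<Omega>. w x * (norm (f k x))\<^sup>2)
      \<longlonglongrightarrow> (LINT x|lebesgue_on \<Omega>. w x * (norm (g x))\<^sup>2)"
proof -
  let ?I = "\<lambda>\<phi>. LINT x|lebesgue_on \<Omega>. \<phi> x"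
  have wg: "square_integrable \<Omega> (\<lambda>x. w x *\<^sub>R g x)"
    by (rule square_integrable_bounded_mult[OF f(2) w])
  have d: "square_integrable \<Omega> (\<lambda>x. f k x - g x)" for k
    by (intro square_integrable_diff f)
  have wd: "square_integrable \<Omega> (\<lambda>x. w x *\<^sub>R (f k x - g x))" for k
    by (rule square_integrable_bounded_mult[OF d w])
  have wdd: "integrable (lebesgue_on \<Omega>) (\<lambda>x. w x * (norm (f k x - g x))\<^sup>2)" for k
    using square_integrable_inner[OF wd d, of k k] by (simp add: power2_norm_eq_inner)
  have wgg: "integrable (lebesgue_on \<Omega>) (\<lambda>x. w x * (norm (g x))\<^sup>2)"
    using square_integrable_inner[OF wg f(2)] by (simp add: power2_norm_eq_inner)
  have wgf: "integrable (lebesgue_on \<Omega>) (\<lambda>x. (w x *\<^sub>R g x) \<bullet> f k x)" for k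
    by (rule square_integrable_inner[OF wg f(1)])
  have eq: "?I (\<lambda>x. w x * (norm (f k x))\<^sup>2)
      = ?I (\<lambda>x. w x * (norm (f k x - g x))\<^sup>2) + 2 * ?I (\<lambda>x. (w x *\<^sub>R g x) \<bullet> f k x)
        - ?I (\<lambda>x. w x * (norm (g x))\<^sup>2)" for k
  proof -
    have "?I (\<lambda>x. w x * (norm (f k x))\<^sup>2)
      = ?I (\<lambda>x. w x * (norm (f k x - g x))\<^sup>2 + 2 * ((w x *\<^sub>R g x) \<bullet> f k x) - w x * (norm (g x))\<^sup>2)"
      by (intro Bochner_Integration.integral_cong refl)
         (simp add: power2_norm_eq_inner inner_diff_left inner_diff_right inner_commute algebra_simps)
    then show ?thesis using wdd wgg wgf by simp
  qed
  have bd: "norm (?I (\<lambda>x. w x * (norm (f k x - g x))\<^sup>2)) \<le> B * ?I (\<lambda>x. (norm (f k x - g x))\<^sup>2)" for k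
  proof -
    have "norm (?I (\<lambda>x. w x * (norm (f k x - g x))\<^sup>2)) \<le> ?I (\<lambda>x. norm (w x * (norm (f k x - g x))\<^sup>2))"
      by (rule integral_norm_bound)
    also have "\<dots> \<le> ?I (\<lambda>x. B * (norm (f k x - g x))\<^sup>2)"
    proof (rule integral_mono[OF integrable_norm[OF wdd]])
      show "integrable (lebesgue_on \<Omega>) (\<lambda>x. B * (norm (f k x - g x))\<^sup>2)"
        using d[of k] by (simp add: square_integrable_def)
      show "norm (w x * (norm (f k x - g x))\<^sup>2) \<le> B * (norm (f k x - g x))\<^sup>2"
        if "x \<in> space (lebesgue_on \<Omega>)" for x
        using w(2)[of x] that by (simp add: abs_mult mult_right_mono)
    qed
    finally show ?thesis by simp
  qed
  have "(\<lambda>k. ?I (\<lambda>x. w x * (norm (f k x - g x))\<^sup>2)) \<longlonglongrightarrow> 0"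
    by (rule Lim_null_comparison[OF always_eventually[OF allI[OF bd]] tendsto_mult_right_zero[OF lim]])
  then have "(\<lambda>k. ?I (\<lambda>x. w x * (norm (f k x))\<^sup>2)) \<longlonglongrightarrow>
      0 + 2 * ?I (\<lambda>x. (w x *\<^sub>R g x) \<bullet> g x) - ?I (\<lambda>x. w x * (norm (g x))\<^sup>2)"
    unfolding eq by (intro tendsto_intros L2_inner_tendsto[OF wg f lim])
  then show ?thesis by (simp add: power2_norm_eq_inner)
qed

section \<open>The symmetrized weak form and Picone's identity\<close>

lemma open_in_sets_lebesgue: "open S \<Longrightarrow> S \<in> sets lebesgue"
  by (simp add: sets_completionI_sets)

text \<open>
  Operators \<open>\<Delta> + b \<bullet> \<nabla> + c\<close> that are symmetric with respect to a weight \<open>\<rho>\<close>: if \<open>\<nabla>\<rho> = \<rho> b\<close>,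
  then \<open>\<rho> (\<Delta> u + b \<bullet> \<nabla>u) = div (\<rho> \<nabla>u)\<close>.
\<close>

locale symmetrizable =
  fixes \<Omega> :: "'a::euclidean_space set" and b :: "'a \<Rightarrow> 'a" and c \<rho> :: "'a \<Rightarrow> real"
  assumes open_domain: "open \<Omega>" and bounded_domain: "bounded \<Omega>"
    and smooth_weight: "C_infinity \<rho>" and weight_pos: "\<And>x. 0 < \<rho> x"
    and grad_weight: "\<And>x. grad \<rho> x = \<rho> x *\<^sub>R b x"
    and cont_c: "continuous_on UNIV c"
begin

abbreviation "M \<equiv> lebesgue_on \<Omega>"

text \<open>
  The bilinear form of \<open>- L\<close> in \<open>L\<^sup>2(\<rho>)\<close>.  The gradients are separate arguments, because an
  element of \<open>H\<^sup>1\<^sub>0\<close> comes with its weak gradient as a second function.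
\<close>

definition form :: "('a \<Rightarrow> real) \<Rightarrow> ('a \<Rightarrow> 'a) \<Rightarrow> ('a \<Rightarrow> real) \<Rightarrow> ('a \<Rightarrow> 'a) \<Rightarrow> real" where
  "form u g v h = (LINT x|M. \<rho> x * (g x \<bullet> h x - c x * u x * v x))"

definition ip :: "('a \<Rightarrow> real) \<Rightarrow> ('a \<Rightarrow> real) \<Rightarrow> real" where
  "ip u v = (LINT x|M. \<rho> x * u x * v x)"

lemma domain_measurable: "\<Omega> \<in> sets lebesgue"
  using open_domain by (rule open_in_sets_lebesgue)

lemma continuous_bound:
  fixes w :: "'a \<Rightarrow> real"
  assumes "continuous_on UNIV w"
  obtains B where "w \<in> borel_measurable M" "\<And>x. x \<in> \<Omega> \<Longrightarrow> \<bar>w x\<bar> \<le> B"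
proof -
  have "w \<in> borel_measurable M"
    using assms continuous_imp_measurable_on_sets_lebesgue continuous_on_subset domain_measurable by blast
  moreover have "bounded (w ` closure \<Omega>)"
    using assms bounded_domain by (intro compact_imp_bounded compact_continuous_image)
      (auto intro: continuous_on_subset simp: compact_closure)
  then obtain B where "\<forall>x\<in>closure \<Omega>. \<bar>w x\<bar> \<le> B" unfolding bounded_iff by auto
  then have "\<bar>w x\<bar> \<le> B" if "x \<in> \<Omega>" for x using that closure_subset[of \<Omega>] by blast
  ultimately show thesis using that by blast
qed

lemma continuous_mult_sq:
  fixes f :: "'a \<Rightarrow> 'b::euclidean_space"
  assumes "continuous_on UNIV w" "square_integrable \<Omega> f"
  shows "square_integrable \<Omega> (\<lambda>x. w x *\<^sub>R f x)"
  by (rule continuous_bound[OF assms(1)]) (rule square_integrable_bounded_mult[OF assms(2)])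

lemma cont_weight: "continuous_on UNIV \<rho>"
  using smooth_weight by (rule C_infinity_imp_continuous_on)

lemma cont_weight_c: "continuous_on UNIV (\<lambda>x. \<rho> x * c x)"
  using cont_weight cont_c by (intro continuous_on_mult)

lemma sq_weight: "square_integrable \<Omega> f \<Longrightarrow> square_integrable \<Omega> (\<lambda>x. \<rho> x *\<^sub>R f x)"
  by (rule continuous_mult_sq[OF cont_weight])

lemma sq_weight_c: "square_integrable \<Omega> u \<Longrightarrow> square_integrable \<Omega> (\<lambda>x. (\<rho> x * c x) * u x)"
  using continuous_mult_sq[OF cont_weight_c, of u] by (simp add: mult.assoc)

lemma sq_test:
  assumes "test_function \<Omega> \<theta>"
  shows "square_integrable \<Omega> \<theta>" "square_integrable \<Omega> (grad \<theta>)"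
  using test_functionD(1)[OF assms]
  by (auto intro!: square_integrable_continuous C_infinity_imp_continuous_on C_infinity_grad
      bounded_domain domain_measurable)

lemma ip_integrable:
  assumes "square_integrable \<Omega> u" "square_integrable \<Omega> v"
  shows "integrable M (\<lambda>x. \<rho> x * u x * v x)"
  using square_integrable_mult[OF sq_weight[OF assms(1)] assms(2)] by simp

lemma form_integrable:
  assumes "square_integrable \<Omega> u" "square_integrable \<Omega> g" "square_integrable \<Omega> v" "square_integrable \<Omega> h"
  shows "integrable M (\<lambda>x. (\<rho> x *\<^sub>R g x) \<bullet> h x)" "integrable M (\<lambda>x. ((\<rho> x * c x) * u x) * v x)"
    "integrable M (\<lambda>x. \<rho> x * (g x \<bullet> h x - c x * u x * v x))"
proof -
  show 1: "integrable M (\<lambda>x. (\<rho> x *\<^sub>R g x) \<bullet> h x)"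
    by (rule square_integrable_inner[OF sq_weight[OF assms(2)] assms(4)])
  show 2: "integrable M (\<lambda>x. ((\<rho> x * c x) * u x) * v x)"
    by (rule square_integrable_mult[OF sq_weight_c[OF assms(1)] assms(3)])
  show "integrable M (\<lambda>x. \<rho> x * (g x \<bullet> h x - c x * u x * v x))"
    using Bochner_Integration.integrable_diff[OF 1 2] by (simp add: algebra_simps)
qed

lemma form_eq:
  assumes "square_integrable \<Omega> u" "square_integrable \<Omega> g" "square_integrable \<Omega> v" "square_integrable \<Omega> h"
  shows "form u g v h = (LINT x|M. (\<rho> x *\<^sub>R g x) \<bullet> h x) - (LINT x|M. ((\<rho> x * c x) * u x) * v x)"
  unfolding form_def Bochner_Integration.integral_diff[OF form_integrable(1,2)[OF assms], symmetric]
  by (simp add: algebra_simps)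

lemma form_commute: "form u g v h = form v h u g"
  unfolding form_def by (simp add: inner_commute mult.commute mult.left_commute)

lemma ip_commute: "ip u v = ip v u"
  unfolding ip_def by (simp add: mult.commute mult.left_commute)

text \<open>
  Testing with \<open>\<rho> \<theta>\<close> instead of \<open>\<theta>\<close> absorbs the drift term, because \<open>\<nabla>\<rho> = \<rho> b\<close>.
\<close>

lemma weak_imp_form:
  assumes weak: "\<And>\<eta>. test_function \<Omega> \<eta> \<Longrightarrow>
      (LINT x|M. g x \<bullet> grad \<eta> x - (b x \<bullet> g x) * \<eta> x - c x * u x * \<eta> x) = (LINT x|M. f x * \<eta> x)"
    and \<theta>: "test_function \<Omega> \<theta>"
  shows "form u g \<theta> (grad \<theta>) = ip f \<theta>"
proof -
  have t: "test_function \<Omega> (\<lambda>x. \<rho> x * \<theta> x)"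
    by (rule test_function_mult[OF \<theta> smooth_weight])
  have gr: "grad (\<lambda>x. \<rho> x * \<theta> x) x = \<rho> x *\<^sub>R (grad \<theta> x + \<theta> x *\<^sub>R b x)" for x
    using grad_mult[OF C_infinity_imp_differentiable[OF smooth_weight]
        C_infinity_imp_differentiable[OF test_functionD(1)[OF \<theta>]], of x]
    by (simp add: grad_weight scaleR_add_right mult.commute)
  have "form u g \<theta> (grad \<theta>) = (LINT x|M. g x \<bullet> grad (\<lambda>x. \<rho> x * \<theta> x) x
        - (b x \<bullet> g x) * (\<rho> x * \<theta> x) - c x * u x * (\<rho> x * \<theta> x))"
    unfolding form_def gr
    by (intro Bochner_Integration.integral_cong refl)
       (simp add: inner_add_right inner_commute algebra_simps)
  also have "\<dots> = ip f \<theta>"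
    unfolding weak[OF t] ip_def by (simp add: mult.commute mult.left_commute)
  finally show ?thesis .
qed

lemma H10_sq:
  assumes "H10 \<Omega> u g" shows "square_integrable \<Omega> u" "square_integrable \<Omega> g"
  using assms by (auto simp: H10_def)

text \<open>The bilinear and quadratic quantities used below pass to the limit along the approximating test functions.\<close>

lemma H10_approx:
  assumes "H10 \<Omega> v h"
  obtains \<phi> where "\<And>k. test_function \<Omega> (\<phi> k)"
    "\<And>u g. square_integrable \<Omega> u \<Longrightarrow> square_integrable \<Omega> g \<Longrightarrow>
       (\<lambda>k. form u g (\<phi> k) (grad (\<phi> k))) \<longlonglongrightarrow> form u g v h"
    "\<And>u. square_integrable \<Omega> u \<Longrightarrow> (\<lambda>k. ip u (\<phi> k)) \<longlonglongrightarrow> ip u v"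
    "(\<lambda>k. form (\<phi> k) (grad (\<phi> k)) (\<phi> k) (grad (\<phi> k))) \<longlonglongrightarrow> form v h v h"
    "(\<lambda>k. ip (\<phi> k) (\<phi> k)) \<longlonglongrightarrow> ip v v"
    "(\<lambda>k. LINT x|M. (norm (\<phi> k x - v x))\<^sup>2) \<longlonglongrightarrow> 0"
proof -
  obtain \<phi> where test: "\<And>k. test_function \<Omega> (\<phi> k)"
    and "(\<lambda>k. LINT x|M. (\<phi> k x - v x)\<^sup>2) \<longlonglongrightarrow> 0"
    and limg: "(\<lambda>k. LINT x|M. (norm (grad (\<phi> k) x - h x))\<^sup>2) \<longlonglongrightarrow> 0"
    using assms by (auto simp: H10_def)
  then have lim: "(\<lambda>k. LINT x|M. (norm (\<phi> k x - v x))\<^sup>2) \<longlonglongrightarrow> 0" by simp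
  note v = H10_sq[OF assms]
  note s = sq_test[OF test]
  have 1: "(\<lambda>k. form u g (\<phi> k) (grad (\<phi> k))) \<longlonglongrightarrow> form u g v h"
    if ug: "square_integrable \<Omega> u" "square_integrable \<Omega> g" for u g
    unfolding form_eq[OF ug s] form_eq[OF ug v]
    using L2_inner_tendsto[OF sq_weight_c[OF ug(1)] s(1) v(1) lim]
    by (intro tendsto_diff L2_inner_tendsto[OF sq_weight[OF ug(2)] s(2) v(2) limg]) simp
  have 2: "(\<lambda>k. ip u (\<phi> k)) \<longlonglongrightarrow> ip u v" if u: "square_integrable \<Omega> u" for u
    using L2_inner_tendsto[OF sq_weight[OF u] s(1) v(1) lim] by (simp add: ip_def)
  obtain B where B: "\<rho> \<in> borel_measurable M" "\<And>x. x \<in> \<Omega> \<Longrightarrow> \<bar>\<rho> x\<bar> \<le> B"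
    using continuous_bound[OF cont_weight] by blast
  obtain B' where B': "(\<lambda>x. \<rho> x * c x) \<in> borel_measurable M" "\<And>x. x \<in> \<Omega> \<Longrightarrow> \<bar>\<rho> x * c x\<bar> \<le> B'"
    using continuous_bound[OF cont_weight_c] by blast
  have 3: "(\<lambda>k. form (\<phi> k) (grad (\<phi> k)) (\<phi> k) (grad (\<phi> k))) \<longlonglongrightarrow> form v h v h"
    unfolding form_eq[OF s s] form_eq[OF v v]
    using L2_weighted_norm_tendsto[OF B' s(1) v(1) lim, unfolded power2_norm_eq_inner]
      L2_weighted_norm_tendsto[OF B s(2) v(2) limg, unfolded power2_norm_eq_inner]
    by (intro tendsto_diff) (simp_all add: mult.assoc)
  have 4: "(\<lambda>k. ip (\<phi> k) (\<phi> k)) \<longlonglongrightarrow> ip v v"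
    using L2_weighted_norm_tendsto[OF B s(1) v(1) lim] by (simp add: ip_def power2_eq_square mult.assoc)
  show thesis by (rule that[OF test 1 2 3 4 lim])
qed

text \<open>
  By density the equation may be tested with every element of \<open>H\<^sup>1\<^sub>0\<close>, in particular with the
  solution itself and with other solutions.
\<close>

lemma solution_form:
  assumes "dirichlet_solution b c \<Omega> u f" and f: "square_integrable \<Omega> f"
  obtains g where "H10 \<Omega> u g" "\<And>v h. H10 \<Omega> v h \<Longrightarrow> form u g v h = ip f v"
proof -
  obtain g where g: "H10 \<Omega> u g" and weak: "\<And>\<eta>. test_function \<Omega> \<eta> \<Longrightarrow>
      (LINT x|M. g x \<bullet> grad \<eta> x - (b x \<bullet> g x) * \<eta> x - c x * u x * \<eta> x) = (LINT x|M. f x * \<eta> x)"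
    using assms unfolding dirichlet_solution_def by blast
  have "form u g v h = ip f v" if vh: "H10 \<Omega> v h" for v h
  proof -
    obtain \<phi> where \<phi>: "\<And>k. test_function \<Omega> (\<phi> k)"
      "(\<lambda>k. form u g (\<phi> k) (grad (\<phi> k))) \<longlonglongrightarrow> form u g v h"
      "(\<lambda>k. ip f (\<phi> k)) \<longlonglongrightarrow> ip f v"
      by (rule H10_approx[OF vh]) (use H10_sq[OF g] f in blast)
    have "form u g (\<phi> k) (grad (\<phi> k)) = ip f (\<phi> k)" for k
      by (rule weak_imp_form[OF weak \<phi>(1)])
    with \<phi>(2) have "(\<lambda>k. ip f (\<phi> k)) \<longlonglongrightarrow> form u g v h" by simp
    from LIMSEQ_unique[OF this \<phi>(3)] show ?thesis .
  qed
  with g that show thesis by blast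
qed

lemma ip_pos:
  assumes "square_integrable \<Omega> u"
  shows "0 \<le> ip u u" "ip u u = 0 \<Longrightarrow> AE x in M. u x = 0"
proof -
  have nn: "0 \<le> \<rho> x * u x * u x" for x using weight_pos[of x] by (simp add: mult.assoc)
  show "0 \<le> ip u u" unfolding ip_def by (rule Bochner_Integration.integral_nonneg[OF nn])
  assume "ip u u = 0"
  then have "AE x in M. \<rho> x * u x * u x = 0"
    using integral_nonneg_eq_0_iff_AE[OF ip_integrable[OF assms assms]] nn by (simp add: ip_def)
  then show "AE x in M. u x = 0"
    by (rule AE_mp) (use weight_pos in \<open>auto intro!: AE_I2 simp: less_imp_neq[symmetric]\<close>)
qed

text \<open>
  Picone's identity.  With a positive solution \<open>\<Phi>\<close> of \<open>L \<Phi> = - \<mu> \<Phi>\<close> and \<open>\<theta> = f \<Phi>\<close>,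
  one has \<open>|\<nabla>\<theta>|\<^sup>2 = \<Phi>\<^sup>2 |\<nabla>f|\<^sup>2 + \<nabla>\<Phi> \<bullet> \<nabla>(f \<theta>)\<close>, and the equation for
  \<open>\<Phi>\<close> tested with \<open>f \<theta>\<close> evaluates the last term.
\<close>

lemma picone_identity:
  assumes \<Phi>: "C_infinity \<Phi>" "\<And>x. x \<in> \<Omega> \<Longrightarrow> 0 < \<Phi> x"
    and eqn: "\<And>x. x \<in> \<Omega> \<Longrightarrow> elliptic_op b c \<Phi> x = - \<mu> * \<Phi> x"
    and \<theta>: "test_function \<Omega> \<theta>"
  shows "form \<theta> (grad \<theta>) \<theta> (grad \<theta>) - \<mu> * ip \<theta> \<theta>
      = (LINT x|M. \<rho> x * (\<Phi> x)\<^sup>2 * (norm (grad (\<lambda>x. \<theta> x / \<Phi> x) x))\<^sup>2)"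
    and "integrable M (\<lambda>x. \<rho> x * (\<Phi> x)\<^sup>2 * (norm (grad (\<lambda>x. \<theta> x / \<Phi> x) x))\<^sup>2)"
proof -
  define f where "f = (\<lambda>x. \<theta> x / \<Phi> x)"
  have f: "test_function \<Omega> f"
    unfolding f_def by (rule test_function_divide[OF \<theta> \<Phi>])
  have eq: "\<theta> x = f x * \<Phi> x" for x
    using \<Phi>(2)[of x] test_function_zero_outside(1)[OF \<theta>, of x] by (cases "x \<in> \<Omega>") (auto simp: f_def)
  have ft: "test_function \<Omega> (\<lambda>x. f x * \<theta> x)"
    by (rule test_function_mult[OF \<theta> test_functionD(1)[OF f]])
  have d: "f differentiable (at x)" "\<Phi> differentiable (at x)" "\<theta> differentiable (at x)" for x
    using test_functionD(1)[OF f] \<Phi>(1) test_functionD(1)[OF \<theta>] C_infinity_imp_differentiable by blast+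
  have g1: "grad \<theta> x = f x *\<^sub>R grad \<Phi> x + \<Phi> x *\<^sub>R grad f x" for x
    using grad_mult[OF d(1,2)] eq by (metis ext)
  have g2: "grad (\<lambda>x. f x * \<theta> x) x = f x *\<^sub>R grad \<theta> x + \<theta> x *\<^sub>R grad f x" for x
    by (rule grad_mult[OF d(1,3)])
  have s\<Phi>: "square_integrable \<Omega> \<Phi>" "square_integrable \<Omega> (grad \<Phi>)"
    using \<Phi>(1) by (auto intro!: square_integrable_continuous C_infinity_imp_continuous_on
        C_infinity_grad bounded_domain domain_measurable)
  have "form \<Phi> (grad \<Phi>) (\<lambda>x. f x * \<theta> x) (grad (\<lambda>x. f x * \<theta> x)) = ip (\<lambda>x. \<mu> * \<Phi> x) (\<lambda>x. f x * \<theta> x)"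
    by (rule weak_imp_form[OF classical_imp_weak[OF \<Phi>(1) eqn domain_measurable] ft])
  also have "\<dots> = \<mu> * ip \<theta> \<theta>"
    unfolding ip_def eq by (subst integral_mult_right_zero[symmetric]) (simp add: algebra_simps)
  finally have A: "form \<Phi> (grad \<Phi>) (\<lambda>x. f x * \<theta> x) (grad (\<lambda>x. f x * \<theta> x)) = \<mu> * ip \<theta> \<theta>" .
  have pt: "\<rho> x * (grad \<theta> x \<bullet> grad \<theta> x - c x * \<theta> x * \<theta> x)
      - \<rho> x * (grad \<Phi> x \<bullet> grad (\<lambda>x. f x * \<theta> x) x - c x * \<Phi> x * (f x * \<theta> x))
      = \<rho> x * (\<Phi> x)\<^sup>2 * (norm (grad f x))\<^sup>2" for x
    unfolding g2 unfolding g1 eq[of x]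
    unfolding power2_norm_eq_inner
    by (simp add: inner_add_left inner_add_right power2_eq_square inner_commute algebra_simps)
  note i1 = form_integrable(3)[OF sq_test[OF \<theta>] sq_test[OF \<theta>]]
  note i2 = form_integrable(3)[OF s\<Phi> sq_test[OF ft]]
  show "form \<theta> (grad \<theta>) \<theta> (grad \<theta>) - \<mu> * ip \<theta> \<theta>
      = (LINT x|M. \<rho> x * (\<Phi> x)\<^sup>2 * (norm (grad (\<lambda>x. \<theta> x / \<Phi> x) x))\<^sup>2)"
    unfolding A[symmetric] form_def Bochner_Integration.integral_diff[OF i1 i2, symmetric] pt
    by (simp add: f_def)
  show "integrable M (\<lambda>x. \<rho> x * (\<Phi> x)\<^sup>2 * (norm (grad (\<lambda>x. \<theta> x / \<Phi> x) x))\<^sup>2)"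
    using Bochner_Integration.integrable_diff[OF i1 i2] unfolding pt by (simp add: f_def)
qed

end

section \<open>Smooth functions vanishing on a sphere belong to \<open>H\<^sup>1\<^sub>0\<close> of the ball\<close>

text \<open>
  The derivatives of \<open>exp (- 1 / t)\<close>, extended by 0 to \<open>t \<le> 0\<close>, have the form
  \<open>p (1 / t) exp (- 1 / t)\<close> with polynomials \<open>p\<close>.
\<close>

primrec flat_poly :: "nat \<Rightarrow> real poly" where
  "flat_poly 0 = 1"
| "flat_poly (Suc k) = [:0, 0, 1:] * (flat_poly k - pderiv (flat_poly k))"

definition flat :: "nat \<Rightarrow> real \<Rightarrow> real" where
  "flat k t = (if 0 < t then poly (flat_poly k) (1 / t) * exp (- (1 / t)) else 0)"

lemma poly_exp_tendsto_0: "((\<lambda>z. poly p z * exp (- z)) \<longlongrightarrow> (0::real)) at_top"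
proof -
  have "((\<lambda>z. \<Sum>i\<le>degree p. coeff p i * (z ^ i / exp z)) \<longlongrightarrow> (\<Sum>i\<le>degree p. coeff p i * 0)) at_top"
    by (intro tendsto_sum tendsto_mult tendsto_const tendsto_power_div_exp_0)
  then show ?thesis
    by (simp add: poly_altdef sum_distrib_right exp_minus divide_inverse mult.assoc)
qed

lemma has_derivative_flat: "(flat k has_real_derivative flat (Suc k) t) (at t)"
proof -
  consider "0 < t" | "t < 0" | "t = 0" by linarith
  then show ?thesis
  proof cases
    case 1
    have "((\<lambda>t. poly (flat_poly k) (1 / t) * exp (- (1 / t))) has_real_derivative flat (Suc k) t) (at t)"
      using 1 by (auto intro!: derivative_eq_intros DERIV_chain2[OF poly_DERIV]
          simp: flat_def field_simps power2_eq_square)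
    then show ?thesis
      by (rule DERIV_cong_ev[OF refl _ refl, THEN iffD1, rotated])
         (use 1 in \<open>auto simp: flat_def intro!: eventually_nhds_in_open[of "{0<..}", THEN eventually_mono]\<close>)
  next
    case 2
    have "((\<lambda>t. 0) has_real_derivative flat (Suc k) t) (at t)"
      using 2 by (simp add: flat_def)
    then show ?thesis
      by (rule DERIV_cong_ev[OF refl _ refl, THEN iffD1, rotated])
         (use 2 in \<open>auto simp: flat_def intro!: eventually_nhds_in_open[of "{..<0}", THEN eventually_mono]\<close>)
  next
    case 3
    have "((\<lambda>h. flat k h / h) \<longlongrightarrow> 0) (at_right 0)"
    proof -
      have "((\<lambda>h::real. poly (pCons 0 (flat_poly k)) (1 / h) * exp (- (1 / h))) \<longlongrightarrow> 0) (at_right 0)"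
        using filterlim_compose[OF poly_exp_tendsto_0 filterlim_inverse_at_top_right]
        by (simp only: inverse_eq_divide)
      then show ?thesis
        by (rule Lim_transform_eventually)
           (auto simp: flat_def eventually_at_right_field intro!: exI[of _ 1])
    qed
    moreover have "((\<lambda>h. flat k h / h) \<longlongrightarrow> 0) (at_left 0)"
      by (rule Lim_transform_eventually[OF tendsto_const])
         (auto simp: flat_def eventually_at_left_field intro!: exI[of _ "-1"])
    ultimately have "((\<lambda>h. flat k h / h) \<longlongrightarrow> 0) (at 0)"
      by (simp add: filterlim_at_split)
    then show ?thesis using 3 by (simp add: has_field_derivative_iff flat_def)
  qed
qed

lemma flat_0: "0 < t \<Longrightarrow> flat 0 t = exp (- (1 / t))" "t \<le> 0 \<Longrightarrow> flat k t = 0"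
  by (simp_all add: flat_def)

lemma flat_0_bounds: "0 \<le> flat 0 t" "flat 0 t \<le> 1"
  by (auto simp: flat_def)

lemma flat_1: "0 < t \<Longrightarrow> flat (Suc 0) t = (1 / t)\<^sup>2 * exp (- (1 / t))"
  by (simp add: flat_def power2_eq_square)

text \<open>
  Below, \<open>t + 1\<close> is \<open>k (R\<^sup>2 - |x|\<^sup>2)\<close>, and the product controls the gradient of the cutoff multiplied
  by a function that vanishes on the sphere.
\<close>

lemma flat_1_bounds: "0 \<le> (t + 1) * flat (Suc 0) t" "(t + 1) * flat (Suc 0) t \<le> 2"
proof -
  have "0 \<le> (t + 1) * flat (Suc 0) t \<and> (t + 1) * flat (Suc 0) t \<le> 2"
  proof (cases "0 < t")
    case True
    define z where "z = 1 / t"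
    have z: "0 < z" using True by (simp add: z_def)
    have "(t + 1) * flat (Suc 0) t = (z + z\<^sup>2) * exp (- z)"
      using True by (simp add: flat_1 z_def power2_eq_square field_simps)
    moreover have "z + z\<^sup>2 \<le> 2 * exp z"
      using exp_lower_Taylor_quadratic[of z] z by (simp add: power2_eq_square)
    then have "(z + z\<^sup>2) * exp (- z) \<le> 2"
      by (simp add: exp_minus field_simps)
    ultimately show ?thesis using z by auto
  qed (simp add: flat_0)
  then show "0 \<le> (t + 1) * flat (Suc 0) t" "(t + 1) * flat (Suc 0) t \<le> 2" by auto
qed

lemma flat_0_tendsto: "(flat 0 \<longlongrightarrow> 1) at_top"
proof -
  have "((\<lambda>t::real. exp (- inverse t)) \<longlongrightarrow> exp (- 0)) at_top"
    by (intro tendsto_intros tendsto_inverse_0_at_top filterlim_ident)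
  then have "((\<lambda>t::real. exp (- inverse t)) \<longlongrightarrow> 1) at_top" by simp
  then show ?thesis
    by (rule Lim_transform_eventually)
       (auto simp: flat_0 inverse_eq_divide intro!: eventually_mono[OF eventually_gt_at_top[of 0]])
qed

lemma flat_1_tendsto: "((\<lambda>t. (t + 1) * flat (Suc 0) t) \<longlongrightarrow> 0) at_top"
proof -
  have "((\<lambda>t::real. (inverse t + (inverse t)\<^sup>2) * exp (- inverse t)) \<longlongrightarrow> (0 + 0\<^sup>2) * exp (- 0)) at_top"
    by (intro tendsto_intros tendsto_inverse_0_at_top filterlim_ident)
  then have "((\<lambda>t::real. (inverse t + (inverse t)\<^sup>2) * exp (- inverse t)) \<longlongrightarrow> 0) at_top" by simp
  then show ?thesis
    by (rule Lim_transform_eventually)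
       (auto simp: flat_1 power2_eq_square field_simps intro!: eventually_mono[OF eventually_gt_at_top[of 0]])
qed

text \<open>
  The value at \<open>x\<close> is compared with the value 0 at the nearest point of the sphere.  The bound is
  expressed by \<open>R\<^sup>2 - |x|\<^sup>2\<close> instead of \<open>R - |x|\<close>, because the former is smooth in \<open>x\<close>.
\<close>

lemma lipschitz_vanishing_on_sphere:
  fixes v :: "'a::euclidean_space \<Rightarrow> real"
  assumes "C_infinity v" "0 < R" "\<And>x. norm x = R \<Longrightarrow> v x = 0"
  obtains L where "0 \<le> L" "\<And>x. x \<in> ball 0 R \<Longrightarrow> norm (grad v x) \<le> L"
    "\<And>x. x \<in> ball 0 R \<Longrightarrow> \<bar>v x\<bar> \<le> L / R * (R\<^sup>2 - x \<bullet> x)"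
proof -
  have "bounded (grad v ` cball 0 R)"
    using assms(1) by (intro compact_imp_bounded compact_continuous_image
        C_infinity_imp_continuous_on C_infinity_grad compact_cball)
  then obtain L where L: "0 < L" "\<And>x. x \<in> cball 0 R \<Longrightarrow> norm (grad v x) \<le> L"
    unfolding bounded_pos by auto
  have "\<bar>v x\<bar> \<le> L / R * (R\<^sup>2 - x \<bullet> x)" if "x \<in> ball 0 R" for x
  proof -
    obtain y :: 'a where y: "norm y = R" "norm (x - y) = R - norm x"
    proof (cases "x = 0")
      case True
      then show ?thesis
        using that[of "R *\<^sub>R (SOME i. i \<in> Basis)"] assms(2) by (simp add: SOME_Basis)
    next
      case False
      have "x - (R / norm x) *\<^sub>R x = (1 - R / norm x) *\<^sub>R x" by (simp add: scaleR_diff_left)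
      then have "norm (x - (R / norm x) *\<^sub>R x) = \<bar>1 - R / norm x\<bar> * norm x"
        by (simp only: norm_scaleR)
      also have "\<bar>1 - R / norm x\<bar> = R / norm x - 1" using \<open>x \<in> ball 0 R\<close> False by simp
      also have "(R / norm x - 1) * norm x = R - norm x" using False by (simp add: left_diff_distrib)
      finally have "norm (x - (R / norm x) *\<^sub>R x) = R - norm x" .
      then show ?thesis using that[of "(R / norm x) *\<^sub>R x"] assms(2) False by simp
    qed
    have "\<bar>v x - v y\<bar> \<le> L * norm (x - y)"
      using L(2) y(1) that C_infinity_imp_differentiable[OF assms(1)]
      by (intro lipschitz_of_grad_bound[of "cball 0 R"]) auto
    then have "\<bar>v x\<bar> \<le> L * (R - norm x)" using assms(3)[OF y(1)] y(2) by simp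
    also have "\<dots> \<le> L / R * ((R - norm x) * (R + norm x))"
    proof -
      have "(R - norm x) * R \<le> (R - norm x) * (R + norm x)"
        using that by (intro mult_left_mono) auto
      then have "L / R * ((R - norm x) * R) \<le> L / R * ((R - norm x) * (R + norm x))"
        by (rule mult_left_mono) (use L(1) assms(2) in simp)
      then show ?thesis using assms(2) by simp
    qed
    also have "(R - norm x) * (R + norm x) = R\<^sup>2 - x \<bullet> x"
      by (simp add: power2_norm_eq_inner[symmetric] power2_eq_square algebra_simps)
    finally show ?thesis .
  qed
  with L that[of L] show thesis by simp
qed

text \<open>
  The approximations are \<open>\<chi> v\<close> with the cutoff \<open>\<chi> = flat 0 (k (R\<^sup>2 - |x|\<^sup>2) - 1)\<close>.
  Since \<open>|v| \<le> C (R\<^sup>2 - |x|\<^sup>2)\<close>, the term \<open>v \<nabla>\<chi>\<close> stays bounded, although \<open>\<nabla>\<chi>\<close>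
  does not, and it tends to 0 pointwise, so that dominated convergence applies.
\<close>

lemma H10_vanishing_on_sphere:
  fixes v :: "'a::euclidean_space \<Rightarrow> real"
  assumes v: "C_infinity v" and R: "0 < R" and v0: "\<And>x. norm x = R \<Longrightarrow> v x = 0"
  shows "H10 (ball 0 R) v (grad v)"
proof -
  let ?B = "ball (0::'a) R"
  obtain L where L: "0 \<le> L" "\<And>x. x \<in> ?B \<Longrightarrow> norm (grad v x) \<le> L"
    "\<And>x. x \<in> ?B \<Longrightarrow> \<bar>v x\<bar> \<le> L / R * (R\<^sup>2 - x \<bullet> x)"
    using lipschitz_vanishing_on_sphere[OF assms] by blast
  have inR: "0 < R\<^sup>2 - x \<bullet> x" "R\<^sup>2 - x \<bullet> x \<le> R\<^sup>2" if "x \<in> ?B" for x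
    using that R power_strict_mono[of "norm x" R 2] by (auto simp: power2_norm_eq_inner[symmetric])
  define a where "a = (\<lambda>k (x::'a). real k * (R\<^sup>2 - x \<bullet> x) - 1)"
  define \<phi> where "\<phi> = (\<lambda>k x. flat 0 (a k x) * v x)"
  have Ca: "C_infinity (a k)" for k
  proof -
    have "C_infinity (\<lambda>x::'a. real k * (R\<^sup>2 + (-1) * (x \<bullet> x)) + (-1))"
      by (intro C_infinity_add C_infinity_cmult C_infinity_inner C_infinity_ident C_infinity_const)
    then show ?thesis by (simp add: a_def)
  qed
  have Cf: "C_infinity (\<lambda>x. flat 0 (a k x))" for k
    by (rule C_infinity_compose[where S = UNIV]) (auto simp: has_derivative_flat Ca)
  have C\<phi>: "C_infinity (\<phi> k)" for k
    unfolding \<phi>_def by (rule C_infinity_mult[OF Cf v])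
  have test: "test_function ?B (\<phi> k)" for k
  proof -
    have nz: "{x. \<phi> k x \<noteq> 0} \<subseteq> {x. a k x \<ge> 0}"
      by (auto simp: \<phi>_def flat_def split: if_splits)
    have "closed {x. a k x \<ge> 0}"
      using C_infinity_imp_continuous_on[OF Ca, of UNIV k]
      by (intro closed_Collect_le continuous_on_const) auto
    then have cl: "closure {x. \<phi> k x \<noteq> 0} \<subseteq> {x. a k x \<ge> 0}"
      using closure_minimal[OF nz] by simp
    have sub: "{x. a k x \<ge> 0} \<subseteq> ?B"
    proof
      fix x assume "x \<in> {x. a k x \<ge> 0}"
      then have *: "real k * (R\<^sup>2 - x \<bullet> x) \<ge> 1" by (simp add: a_def)
      then have "0 < R\<^sup>2 - x \<bullet> x"
        by (smt (verit) mult_nonneg_nonpos of_nat_0_le_iff)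
      then have "(norm x)\<^sup>2 < R\<^sup>2" by (simp add: power2_norm_eq_inner)
      then show "x \<in> ?B" using R power2_less_imp_less[of "norm x" R] by simp
    qed
    have "bounded (closure {x. \<phi> k x \<noteq> 0})"
      using cl sub by (metis bounded_ball bounded_subset)
    then show ?thesis
      unfolding test_function_def using C\<phi> cl sub by (simp only: compact_eq_bounded_closed) auto
  qed
  have grada: "grad (a k) x = (- 2 * real k) *\<^sub>R x" for k x
    unfolding a_def by (rule grad_eq) (auto intro!: derivative_eq_intros simp: inner_commute algebra_simps)
  have grad\<phi>: "grad (\<phi> k) x = flat 0 (a k x) *\<^sub>R grad v x
      + (v x * flat (Suc 0) (a k x) * (- 2 * real k)) *\<^sub>R x" for k x
  proof -
    have "grad (\<lambda>x. flat 0 (a k x)) x = flat (Suc 0) (a k x) *\<^sub>R grad (a k) x"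
      by (rule grad_compose[OF has_derivative_flat C_infinity_imp_differentiable[OF Ca]])
    then show ?thesis
      unfolding \<phi>_def grad_mult[OF C_infinity_imp_differentiable[OF Cf] C_infinity_imp_differentiable[OF v]]
      by (simp add: grada mult.assoc)
  qed
  have chain: "norm ((v x * flat (Suc 0) (a k x) * (- 2 * real k)) *\<^sub>R x)
      \<le> 2 * L * ((a k x + 1) * flat (Suc 0) (a k x))" if x: "x \<in> ?B" for k x
  proof -
    have f1: "0 \<le> flat (Suc 0) (a k x)"
      by (cases "0 < a k x") (auto simp: flat_1 flat_0)
    have "norm ((v x * flat (Suc 0) (a k x) * (- 2 * real k)) *\<^sub>R x)
      = \<bar>v x\<bar> * (flat (Suc 0) (a k x) * (2 * real k)) * norm x"
      using f1 by (simp add: abs_mult)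
    also have "\<dots> \<le> (L / R * (R\<^sup>2 - x \<bullet> x)) * (flat (Suc 0) (a k x) * (2 * real k)) * R"
      using L(1,3) x f1 R inR[OF x] by (intro mult_mono) auto
    also have "\<dots> = 2 * L * ((a k x + 1) * flat (Suc 0) (a k x))"
      using R by (simp add: a_def field_simps)
    finally show ?thesis .
  qed
  have alim: "filterlim (\<lambda>k. a k x) at_top sequentially" if "x \<in> ?B" for x
  proof -
    have "filterlim (\<lambda>k. (R\<^sup>2 - x \<bullet> x) * real k) at_top sequentially"
      using inR(1)[OF that] by (intro filterlim_tendsto_pos_mult_at_top[OF tendsto_const] filterlim_real_sequentially)
    then have "filterlim (\<lambda>k. -1 + (R\<^sup>2 - x \<bullet> x) * real k) at_top sequentially"
      by (rule filterlim_tendsto_add_at_top[OF tendsto_const])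
    then show ?thesis by (simp add: a_def mult.commute)
  qed
  have f0lim: "(\<lambda>k. flat 0 (a k x)) \<longlonglongrightarrow> 1" if "x \<in> ?B" for x
    by (rule filterlim_compose[OF flat_0_tendsto alim[OF that]])
  have f1lim: "(\<lambda>k. (a k x + 1) * flat (Suc 0) (a k x)) \<longlonglongrightarrow> 0" if "x \<in> ?B" for x
    by (rule filterlim_compose[OF flat_1_tendsto alim[OF that]])
  interpret finite_measure "lebesgue_on ?B"
    by (intro finite_measure_lebesgue_on bounded_set_imp_lmeasurable bounded_ball open_in_sets_lebesgue open_ball)
  have meas: "(\<lambda>x. (norm (\<phi> k x - v x))\<^sup>2) \<in> borel_measurable (lebesgue_on ?B)"
    "(\<lambda>x. (norm (grad (\<phi> k) x - grad v x))\<^sup>2) \<in> borel_measurable (lebesgue_on ?B)" for k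
    by (intro continuous_imp_measurable_on_sets_lebesgue open_in_sets_lebesgue open_ball
        continuous_intros C_infinity_imp_continuous_on C_infinity_grad C\<phi> v)+
  have "(\<lambda>k. LINT x|lebesgue_on ?B. (norm (\<phi> k x - v x))\<^sup>2) \<longlonglongrightarrow> (LINT x|lebesgue_on ?B. (0::real))"
  proof (rule integral_dominated_convergence[where w = "\<lambda>x. (L * R)\<^sup>2"])
    show "AE x in lebesgue_on ?B. (\<lambda>k. (norm (\<phi> k x - v x))\<^sup>2) \<longlonglongrightarrow> 0"
    proof (rule AE_I2)
      fix x assume "x \<in> space (lebesgue_on ?B)"
      then have "x \<in> ?B" by simp
      then have "(\<lambda>k. (norm (flat 0 (a k x) * v x - v x))\<^sup>2) \<longlonglongrightarrow> (norm (1 * v x - v x))\<^sup>2"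
        by (intro tendsto_power tendsto_norm tendsto_diff tendsto_mult tendsto_const f0lim)
      then show "(\<lambda>k. (norm (\<phi> k x - v x))\<^sup>2) \<longlonglongrightarrow> 0" by (simp add: \<phi>_def)
    qed
    show "AE x in lebesgue_on ?B. norm ((norm (\<phi> k x - v x))\<^sup>2) \<le> (L * R)\<^sup>2" for k
    proof (rule AE_I2)
      fix x assume "x \<in> space (lebesgue_on ?B)"
      then have x: "x \<in> ?B" by simp
      have "\<phi> k x - v x = (flat 0 (a k x) - 1) * v x" by (simp add: \<phi>_def algebra_simps)
      moreover have "\<bar>flat 0 (a k x) - 1\<bar> \<le> 1"
        using flat_0_bounds[of "a k x"] by auto
      ultimately have "\<bar>\<phi> k x - v x\<bar> \<le> 1 * \<bar>v x\<bar>"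
        unfolding abs_mult by (metis abs_ge_zero abs_mult mult_right_mono)
      also have "\<dots> \<le> L / R * R\<^sup>2"
        using L(3)[OF x] inR(2)[OF x] L(1) R by (smt (verit) divide_nonneg_pos mult_left_mono)
      also have "\<dots> = L * R" using R by (simp add: power2_eq_square)
      finally have "(norm (\<phi> k x - v x))\<^sup>2 \<le> (L * R)\<^sup>2" by (intro power_mono) auto
      then show "norm ((norm (\<phi> k x - v x))\<^sup>2) \<le> (L * R)\<^sup>2" by simp
    qed
  qed (use meas in auto)
  moreover have "(\<lambda>k. LINT x|lebesgue_on ?B. (norm (grad (\<phi> k) x - grad v x))\<^sup>2)
      \<longlonglongrightarrow> (LINT x|lebesgue_on ?B. (0::real))"
  proof (rule integral_dominated_convergence[where w = "\<lambda>x. (5 * L)\<^sup>2"])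
    have diff: "grad (\<phi> k) x - grad v x = (flat 0 (a k x) - 1) *\<^sub>R grad v x
      + (v x * flat (Suc 0) (a k x) * (- 2 * real k)) *\<^sub>R x" for k x
      unfolding grad\<phi> by (simp add: algebra_simps)
    have le: "norm (grad (\<phi> k) x - grad v x) \<le>
       \<bar>flat 0 (a k x) - 1\<bar> * L + 2 * L * ((a k x + 1) * flat (Suc 0) (a k x))" if x: "x \<in> ?B" for k x
    proof -
      have "norm ((flat 0 (a k x) - 1) *\<^sub>R grad v x) \<le> \<bar>flat 0 (a k x) - 1\<bar> * L"
        using L(2)[OF x] by (simp add: mult_left_mono)
      then show ?thesis
        unfolding diff using chain[OF x, of k] by (intro order_trans[OF norm_triangle_ineq add_mono])
    qed
    show "AE x in lebesgue_on ?B. (\<lambda>k. (norm (grad (\<phi> k) x - grad v x))\<^sup>2) \<longlonglongrightarrow> 0"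
    proof (rule AE_I2)
      fix x assume "x \<in> space (lebesgue_on ?B)"
      then have x: "x \<in> ?B" by simp
      have "(\<lambda>k. \<bar>flat 0 (a k x) - 1\<bar> * L + 2 * L * ((a k x + 1) * flat (Suc 0) (a k x)))
          \<longlonglongrightarrow> \<bar>1 - 1\<bar> * L + 2 * L * 0"
        by (intro tendsto_add tendsto_mult tendsto_const tendsto_rabs tendsto_diff f0lim[OF x] f1lim[OF x])
      then have "(\<lambda>k. \<bar>flat 0 (a k x) - 1\<bar> * L + 2 * L * ((a k x + 1) * flat (Suc 0) (a k x))) \<longlonglongrightarrow> 0"
        by simp
      then have "(\<lambda>k. norm (grad (\<phi> k) x - grad v x)) \<longlonglongrightarrow> 0"
        by (rule tendsto_sandwich[OF always_eventually[OF allI[OF norm_ge_zero]]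
              always_eventually[OF allI[OF le[OF x]]] tendsto_const])
      then have "(\<lambda>k. (norm (grad (\<phi> k) x - grad v x))\<^sup>2) \<longlonglongrightarrow> 0\<^sup>2" by (rule tendsto_power)
      then show "(\<lambda>k. (norm (grad (\<phi> k) x - grad v x))\<^sup>2) \<longlonglongrightarrow> 0" by simp
    qed
    show "AE x in lebesgue_on ?B. norm ((norm (grad (\<phi> k) x - grad v x))\<^sup>2) \<le> (5 * L)\<^sup>2" for k
    proof (rule AE_I2)
      fix x assume "x \<in> space (lebesgue_on ?B)"
      then have x: "x \<in> ?B" by simp
      have "\<bar>flat 0 (a k x) - 1\<bar> * L \<le> 1 * L"
        using flat_0_bounds[of "a k x"] L(1) by (intro mult_right_mono) auto
      moreover have "2 * L * ((a k x + 1) * flat (Suc 0) (a k x)) \<le> 2 * L * 2"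
        using flat_1_bounds(2)[of "a k x"] L(1) by (intro mult_left_mono) auto
      ultimately have "norm (grad (\<phi> k) x - grad v x) \<le> 5 * L" using le[OF x, of k] by linarith
      then have "(norm (grad (\<phi> k) x - grad v x))\<^sup>2 \<le> (5 * L)\<^sup>2" by (intro power_mono) auto
      then show "norm ((norm (grad (\<phi> k) x - grad v x))\<^sup>2) \<le> (5 * L)\<^sup>2" by simp
    qed
  qed (use meas in auto)
  moreover have "square_integrable ?B v" "square_integrable ?B (grad v)"
    by (intro square_integrable_continuous C_infinity_imp_continuous_on C_infinity_grad v
        bounded_ball open_in_sets_lebesgue open_ball)+
  ultimately show ?thesis
    unfolding H10_def using test by auto
qed

section \<open>Functions with vanishing weak gradient are constant\<close>

lemma nn_integral_affine_le:
  fixes G :: "'a::euclidean_space \<Rightarrow> ennreal"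
  assumes G: "G \<in> borel_measurable borel" and s: "1 / 2 \<le> s"
  shows "(\<integral>\<^sup>+x. G (v + s *\<^sub>R x) \<partial>lborel) \<le> 2 ^ DIM('a) * (\<integral>\<^sup>+x. G x \<partial>lborel)"
proof -
  let ?X = "\<integral>\<^sup>+x. G (v + s *\<^sub>R x) \<partial>lborel"
  have Gm: "(\<lambda>x. G (v + s *\<^sub>R x)) \<in> borel_measurable borel"
    using G by (rule measurable_compose[rotated]) measurable
  have "(\<integral>\<^sup>+x. G x \<partial>lborel)
      = (\<integral>\<^sup>+x. G x \<partial>density (distr lborel borel (\<lambda>x. v + s *\<^sub>R x)) (\<lambda>_. ennreal (\<bar>s\<bar> ^ DIM('a))))"
    using s by (subst lborel_affine[of s v]) auto
  also have "\<dots> = (\<integral>\<^sup>+x. ennreal (\<bar>s\<bar> ^ DIM('a)) * G (v + s *\<^sub>R x) \<partial>lborel)"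
    using G by (simp add: nn_integral_density nn_integral_distr)
  also have "\<dots> = ennreal (\<bar>s\<bar> ^ DIM('a)) * ?X"
    using Gm by (intro nn_integral_cmult) simp
  finally have eq: "(\<integral>\<^sup>+x. G x \<partial>lborel) = ennreal (\<bar>s\<bar> ^ DIM('a)) * ?X" .
  have "?X = ennreal (2 ^ DIM('a) * (1 / 2) ^ DIM('a)) * ?X"
    by (simp flip: power_mult_distrib)
  also have "\<dots> = 2 ^ DIM('a) * (ennreal ((1 / 2) ^ DIM('a)) * ?X)"
    by (subst ennreal_mult) (simp_all add: mult.assoc flip: ennreal_power)
  also have "\<dots> \<le> 2 ^ DIM('a) * (ennreal (\<bar>s\<bar> ^ DIM('a)) * ?X)"
    using s by (intro mult_left_mono mult_right_mono ennreal_leI power_mono) auto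
  finally show ?thesis unfolding eq .
qed

lemma segment_increment_le:
  fixes f :: "'a::euclidean_space \<Rightarrow> real"
  assumes f: "C_infinity f" and x: "x \<in> ball 0 r" and y: "y \<in> ball 0 r"
  shows "ennreal \<bar>f x - f ((1 / 2) *\<^sub>R (x + y))\<bar>
    \<le> (\<integral>\<^sup>+t. indicator {0..1 / 2} t * (ennreal (2 * r) *
          (ennreal (norm (grad f (t *\<^sub>R y + (1 - t) *\<^sub>R x))) * indicator (ball 0 r) (t *\<^sub>R y + (1 - t) *\<^sub>R x))) \<partial>lborel)"
proof -
  define p where "p = (\<lambda>t. t *\<^sub>R y + (1 - t) *\<^sub>R x)"
  have f1: "f differentiable (at z)" for z using f by (rule C_infinity_imp_differentiable)
  have cg: "continuous_on UNIV (grad f)"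
    using f by (intro C_infinity_imp_continuous_on C_infinity_grad)
  have cp: "continuous_on UNIV p" unfolding p_def by (intro continuous_intros)
  have cgp: "continuous_on T (\<lambda>t. grad f (p t) \<bullet> (y - x))" for T
    by (intro continuous_on_inner continuous_on_const continuous_on_compose2[OF cg continuous_on_subset[OF cp]]) auto
  have d: "((\<lambda>t. f (p t)) has_vector_derivative grad f (p t) \<bullet> (y - x)) (at t within T)" for t T
  proof -
    have "(p has_derivative (\<lambda>h. h *\<^sub>R (y - x))) (at t)"
      unfolding p_def by (auto intro!: derivative_eq_intros simp: algebra_simps)
    from has_derivative_compose[OF this has_derivative_grad[OF f1]]
    show ?thesis by (simp add: has_vector_derivative_def has_derivative_at_withinI)
  qed
  have int: "integrable lborel (\<lambda>t. indicator {0..1/2} t *\<^sub>R (grad f (p t) \<bullet> (y - x)))"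
    by (intro borel_integrable_compact compact_Icc cgp)
  have "(LINT t|lborel. indicator {0..1/2} t *\<^sub>R (grad f (p t) \<bullet> (y - x))) = f (p (1 / 2)) - f (p 0)"
    by (rule integral_FTC_atLeastAtMost[OF _ d cgp]) simp
  also have "p (1 / 2) = (1 / 2) *\<^sub>R (x + y)" by (simp add: p_def scaleR_add_right add.commute)
  also have "p 0 = x" by (simp add: p_def)
  finally have "\<bar>f x - f ((1 / 2) *\<^sub>R (x + y))\<bar>
      = norm (LINT t|lborel. indicator {0..1/2} t *\<^sub>R (grad f (p t) \<bullet> (y - x)))"
    by simp
  then have "ennreal \<bar>f x - f ((1 / 2) *\<^sub>R (x + y))\<bar>
      \<le> (\<integral>\<^sup>+t. ennreal (norm (indicator {0..1/2} t *\<^sub>R (grad f (p t) \<bullet> (y - x)))) \<partial>lborel)"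
    using integral_norm_bound_ennreal[OF int] by simp
  also have "\<dots> \<le> (\<integral>\<^sup>+t. indicator {0..1 / 2} t * (ennreal (2 * r) *
          (ennreal (norm (grad f (p t))) * indicator (ball 0 r) (p t))) \<partial>lborel)"
  proof (rule nn_integral_mono)
    fix t :: real
    show "ennreal (norm (indicator {0..1/2} t *\<^sub>R (grad f (p t) \<bullet> (y - x))))
      \<le> indicator {0..1 / 2} t * (ennreal (2 * r) * (ennreal (norm (grad f (p t))) * indicator (ball 0 r) (p t)))"
    proof (cases "t \<in> {0..1/2}")
      case True
      have "p t \<in> ball 0 r"
        unfolding p_def using convexD[OF convex_ball y x, of t "1 - t"] True by simp
      moreover have "norm (grad f (p t) \<bullet> (y - x)) \<le> 2 * r * norm (grad f (p t))"
      proof -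
        have "norm (grad f (p t) \<bullet> (y - x)) \<le> norm (grad f (p t)) * norm (y - x)"
          by (simp add: Cauchy_Schwarz_ineq2)
        also have "\<dots> \<le> norm (grad f (p t)) * (2 * r)"
          using norm_triangle_ineq4[of y x] x y by (intro mult_left_mono) auto
        finally show ?thesis by (simp only: mult.commute)
      qed
      moreover have "0 \<le> r" using x by (smt (verit) mem_ball_0 norm_ge_zero)
      ultimately show ?thesis using True by (simp add: ennreal_mult[symmetric] ennreal_leI)
    qed simp
  qed
  finally show ?thesis unfolding p_def .
qed

text \<open>
  The first half of the segment from \<open>x\<close> to \<open>y\<close> is swept out by dilations of ratio at least
  \<open>1 / 2\<close> when \<open>x\<close> varies, which bounds the first of the two increments over the midpoint; the
  second one follows by exchanging \<open>x\<close> and \<open>y\<close>.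
\<close>

lemma poincare_ball:
  fixes f :: "'a::euclidean_space \<Rightarrow> real"
  assumes f: "C_infinity f" and S: "S = ball 0 r"
  shows "(\<integral>\<^sup>+y. \<integral>\<^sup>+x. indicator S y * (indicator S x * ennreal \<bar>f x - f y\<bar>) \<partial>lborel \<partial>lborel)
    \<le> 2 * (emeasure lborel S * (ennreal (2 * r) * (2 ^ DIM('a) *
          (\<integral>\<^sup>+x. ennreal (norm (grad f x)) * indicator S x \<partial>lborel))))"
proof -
  define G where "G = (\<lambda>x. ennreal (norm (grad f x)) * indicator S x)"
  define A where "A = (\<integral>\<^sup>+x. G x \<partial>lborel)"
  have fm[measurable]: "f \<in> borel_measurable borel"
    using C_infinity_imp_continuous_on[OF f] by (rule borel_measurable_continuous_onI)
  have gm[measurable]: "grad f \<in> borel_measurable borel"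
    using C_infinity_imp_continuous_on[OF C_infinity_grad[OF f]] by (rule borel_measurable_continuous_onI)
  have Sm[measurable]: "S \<in> sets borel" by (simp add: S)
  have Gm[measurable]: "G \<in> borel_measurable borel" unfolding G_def by measurable
  let ?m = "\<lambda>x y::'a. (1 / 2::real) *\<^sub>R (x + y)"
  have one: "(\<integral>\<^sup>+x. indicator S x * ennreal \<bar>f x - f (?m x y)\<bar> \<partial>lborel)
      \<le> ennreal (2 * r) * (2 ^ DIM('a) * A)" if y: "y \<in> S" for y
  proof -
    have "(\<integral>\<^sup>+x. indicator S x * ennreal \<bar>f x - f (?m x y)\<bar> \<partial>lborel)
      \<le> (\<integral>\<^sup>+x. \<integral>\<^sup>+t. indicator {0..1 / 2} t * (ennreal (2 * r) * G (t *\<^sub>R y + (1 - t) *\<^sub>R x)) \<partial>lborel \<partial>lborel)"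
    proof (rule nn_integral_mono)
      fix x
      show "indicator S x * ennreal \<bar>f x - f (?m x y)\<bar>
        \<le> (\<integral>\<^sup>+t. indicator {0..1 / 2} t * (ennreal (2 * r) * G (t *\<^sub>R y + (1 - t) *\<^sub>R x)) \<partial>lborel)"
        using segment_increment_le[OF f, of x r y] y
        by (cases "x \<in> S") (simp_all add: S G_def)
    qed
    also have "\<dots> = (\<integral>\<^sup>+t. \<integral>\<^sup>+x. indicator {0..1 / 2} t * (ennreal (2 * r) * G (t *\<^sub>R y + (1 - t) *\<^sub>R x)) \<partial>lborel \<partial>lborel)"
      by (rule lborel_pair.Fubini') measurable
    also have "\<dots> \<le> (\<integral>\<^sup>+t. indicator {0..1 / 2::real} t * (ennreal (2 * r) * (2 ^ DIM('a) * A)) \<partial>lborel)"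
    proof (rule nn_integral_mono)
      fix t :: real
      have "(\<integral>\<^sup>+x. indicator {0..1 / 2} t * (ennreal (2 * r) * G (t *\<^sub>R y + (1 - t) *\<^sub>R x)) \<partial>lborel)
        = indicator {0..1 / 2} t * (ennreal (2 * r) * (\<integral>\<^sup>+x. G (t *\<^sub>R y + (1 - t) *\<^sub>R x) \<partial>lborel))"
        by (simp add: nn_integral_cmult)
      also have "\<dots> \<le> indicator {0..1 / 2} t * (ennreal (2 * r) * (2 ^ DIM('a) * A))"
        using nn_integral_affine_le[OF Gm, of "1 - t" "t *\<^sub>R y"]
        by (cases "t \<in> {0..1/2}") (auto simp: A_def intro!: mult_left_mono)
      finally show "(\<integral>\<^sup>+x. indicator {0..1 / 2} t * (ennreal (2 * r) * G (t *\<^sub>R y + (1 - t) *\<^sub>R x)) \<partial>lborel)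
         \<le> indicator {0..1 / 2} t * (ennreal (2 * r) * (2 ^ DIM('a) * A))" .
    qed
    also have "\<dots> = ennreal (1 / 2) * (ennreal (2 * r) * (2 ^ DIM('a) * A))"
      by (subst nn_integral_multc) auto
    also have "\<dots> \<le> ennreal 1 * (ennreal (2 * r) * (2 ^ DIM('a) * A))"
      by (intro mult_right_mono ennreal_leI) simp_all
    finally show ?thesis by simp
  qed
  define D where "D = (\<integral>\<^sup>+y. \<integral>\<^sup>+x. indicator S y * (indicator S x * ennreal \<bar>f x - f (?m x y)\<bar>) \<partial>lborel \<partial>lborel)"
  have "D = (\<integral>\<^sup>+y. indicator S y * (\<integral>\<^sup>+x. indicator S x * ennreal \<bar>f x - f (?m x y)\<bar> \<partial>lborel) \<partial>lborel)"
    unfolding D_def by (intro nn_integral_cong nn_integral_cmult) measurable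
  also have "\<dots> \<le> (\<integral>\<^sup>+y. indicator S y * (ennreal (2 * r) * (2 ^ DIM('a) * A)) \<partial>lborel)"
    using one by (intro nn_integral_mono) (auto split: split_indicator)
  also have "\<dots> = emeasure lborel S * (ennreal (2 * r) * (2 ^ DIM('a) * A))"
    by (subst nn_integral_multc) auto
  finally have D: "D \<le> emeasure lborel S * (ennreal (2 * r) * (2 ^ DIM('a) * A))" .
  have "(\<integral>\<^sup>+y. \<integral>\<^sup>+x. indicator S y * (indicator S x * ennreal \<bar>f x - f y\<bar>) \<partial>lborel \<partial>lborel)
    \<le> (\<integral>\<^sup>+y. \<integral>\<^sup>+x. indicator S y * (indicator S x * ennreal \<bar>f x - f (?m x y)\<bar>)
        + indicator S y * (indicator S x * ennreal \<bar>f y - f (?m y x)\<bar>) \<partial>lborel \<partial>lborel)"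
  proof (intro nn_integral_mono)
    fix x y
    have "\<bar>f x - f y\<bar> \<le> \<bar>f x - f (?m x y)\<bar> + \<bar>f y - f (?m y x)\<bar>"
      by (simp add: add.commute[of y x])
    then have "ennreal \<bar>f x - f y\<bar> \<le> ennreal \<bar>f x - f (?m x y)\<bar> + ennreal \<bar>f y - f (?m y x)\<bar>"
      by (metis abs_ge_zero ennreal_leI ennreal_plus)
    then show "indicator S y * (indicator S x * ennreal \<bar>f x - f y\<bar>)
      \<le> indicator S y * (indicator S x * ennreal \<bar>f x - f (?m x y)\<bar>)
        + indicator S y * (indicator S x * ennreal \<bar>f y - f (?m y x)\<bar>)"
      by (auto split: split_indicator)
  qed
  also have "\<dots> = D + (\<integral>\<^sup>+y. \<integral>\<^sup>+x. indicator S y * (indicator S x * ennreal \<bar>f y - f (?m y x)\<bar>) \<partial>lborel \<partial>lborel)"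
    unfolding D_def
    by (subst nn_integral_add[symmetric], measurable, intro nn_integral_cong nn_integral_add) measurable
  also have "(\<integral>\<^sup>+y. \<integral>\<^sup>+x. indicator S y * (indicator S x * ennreal \<bar>f y - f (?m y x)\<bar>) \<partial>lborel \<partial>lborel) = D"
    unfolding D_def by (subst lborel_pair.Fubini') (measurable, simp add: mult.left_commute)
  also have "D + D = 2 * D" by (simp add: mult_2)
  also have "\<dots> \<le> 2 * (emeasure lborel S * (ennreal (2 * r) * (2 ^ DIM('a) * A)))"
    using D by (intro mult_left_mono) auto
  finally show ?thesis unfolding A_def G_def .
qed

text \<open>
  The Poincare inequality passes to the limit, so that the double integral of \<open>|F x - F y|\<close>
  vanishes.
\<close>

lemma L1_limit_gradient_0_const:
  fixes f :: "nat \<Rightarrow> 'a::euclidean_space \<Rightarrow> real" and F :: "'a \<Rightarrow> real"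
  assumes f: "\<And>k. C_infinity (f k)" and F: "F \<in> borel_measurable borel" and S: "S = ball 0 r"
    and lim: "(\<lambda>k. \<integral>\<^sup>+x. ennreal \<bar>f k x - F x\<bar> * indicator S x \<partial>lborel) \<longlonglongrightarrow> 0"
    and limg: "(\<lambda>k. \<integral>\<^sup>+x. ennreal (norm (grad (f k) x)) * indicator S x \<partial>lborel) \<longlonglongrightarrow> 0"
  shows "AE y in lborel. AE x in lborel. y \<in> S \<longrightarrow> x \<in> S \<longrightarrow> F x = F y"
proof -
  note F[measurable]
  have Sm[measurable]: "S \<in> sets borel" by (simp add: S)
  have fm[measurable]: "f k \<in> borel_measurable borel" for k
    using C_infinity_imp_continuous_on[OF f] by (rule borel_measurable_continuous_onI)
  define V where "V = emeasure (lborel :: 'a measure) S"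
  have V: "V \<noteq> top" unfolding V_def S using emeasure_lborel_ball_finite[of "0::'a" r] by (simp add: less_top)
  define a where "a = (\<lambda>k. \<integral>\<^sup>+x. ennreal \<bar>f k x - F x\<bar> * indicator S x \<partial>lborel)"
  define g where "g = (\<lambda>k. \<integral>\<^sup>+x. ennreal (norm (grad (f k) x)) * indicator S x \<partial>lborel)"
  let ?I = "\<lambda>h. \<integral>\<^sup>+y. \<integral>\<^sup>+x. indicator S y * (indicator S x * ennreal (h x y)) \<partial>lborel \<partial>(lborel::'a measure)"
  have bound: "?I (\<lambda>x y. \<bar>F x - F y\<bar>) \<le> 2 * (V * a k) + 2 * (V * (ennreal (2 * r) * (2 ^ DIM('a) * g k)))" for k
  proof -
    have "?I (\<lambda>x y. \<bar>F x - F y\<bar>) \<le> (\<integral>\<^sup>+y. \<integral>\<^sup>+x. indicator S y * (indicator S x * ennreal \<bar>f k x - F x\<bar>)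
        + (indicator S y * (indicator S x * ennreal \<bar>f k y - F y\<bar>)
        + indicator S y * (indicator S x * ennreal \<bar>f k x - f k y\<bar>)) \<partial>lborel \<partial>lborel)"
    proof (intro nn_integral_mono)
      fix x y
      have "ennreal \<bar>F x - F y\<bar> \<le> ennreal (\<bar>f k x - F x\<bar> + (\<bar>f k y - F y\<bar> + \<bar>f k x - f k y\<bar>))"
        by (intro ennreal_leI) linarith
      also have "\<dots> = ennreal \<bar>f k x - F x\<bar> + (ennreal \<bar>f k y - F y\<bar> + ennreal \<bar>f k x - f k y\<bar>)"
        by simp
      finally show "indicator S y * (indicator S x * ennreal \<bar>F x - F y\<bar>)
        \<le> indicator S y * (indicator S x * ennreal \<bar>f k x - F x\<bar>)
        + (indicator S y * (indicator S x * ennreal \<bar>f k y - F y\<bar>)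
        + indicator S y * (indicator S x * ennreal \<bar>f k x - f k y\<bar>))"
        by (auto split: split_indicator)
    qed
    also have "\<dots> = ?I (\<lambda>x y. \<bar>f k x - F x\<bar>) + (?I (\<lambda>x y. \<bar>f k y - F y\<bar>) + ?I (\<lambda>x y. \<bar>f k x - f k y\<bar>))"
      by (simp add: nn_integral_add)
    also have "?I (\<lambda>x y. \<bar>f k x - F x\<bar>) = V * a k"
    proof -
      have "?I (\<lambda>x y. \<bar>f k x - F x\<bar>) = (\<integral>\<^sup>+y. indicator S y * a k \<partial>lborel)"
        unfolding a_def by (intro nn_integral_cong) (subst nn_integral_cmult[symmetric], auto simp: mult_ac)
      also have "\<dots> = V * a k" unfolding V_def by (subst nn_integral_multc) auto
      finally show ?thesis .
    qed
    also have "?I (\<lambda>x y. \<bar>f k y - F y\<bar>) = ?I (\<lambda>x y. \<bar>f k x - F x\<bar>)"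
      by (subst lborel_pair.Fubini') (measurable, simp add: mult.left_commute)
    also have "?I (\<lambda>x y. \<bar>f k x - F x\<bar>) = V * a k" by fact
    also have "V * a k + (V * a k + ?I (\<lambda>x y. \<bar>f k x - f k y\<bar>))
        \<le> V * a k + (V * a k + 2 * (V * (ennreal (2 * r) * (2 ^ DIM('a) * g k))))"
      unfolding V_def g_def by (rule add_left_mono[OF add_left_mono[OF poincare_ball[OF f S]]])
    also have "\<dots> = 2 * (V * a k) + 2 * (V * (ennreal (2 * r) * (2 ^ DIM('a) * g k)))"
      by (simp only: mult_2 add.assoc)
    finally show ?thesis .
  qed
  have "(\<lambda>k. 2 * (V * a k) + 2 * (V * (ennreal (2 * r) * (2 ^ DIM('a) * g k))))
      \<longlonglongrightarrow> 2 * (V * 0) + 2 * (V * (ennreal (2 * r) * (2 ^ DIM('a) * 0)))"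
    using lim limg V unfolding a_def[symmetric] g_def[symmetric]
    by (intro tendsto_add ennreal_tendsto_cmult) (auto simp: less_top power_less_top_ennreal)
  then have "?I (\<lambda>x y. \<bar>F x - F y\<bar>) \<le> 0"
    using bound by (intro LIMSEQ_le_const) auto
  then have "?I (\<lambda>x y. \<bar>F x - F y\<bar>) = 0" by simp
  then have "AE y in lborel. (\<integral>\<^sup>+x. indicator S y * (indicator S x * ennreal \<bar>F x - F y\<bar>) \<partial>lborel) = 0"
    by (subst (asm) nn_integral_0_iff_AE) auto
  then show ?thesis
  proof (rule eventually_mono)
    fix y assume "(\<integral>\<^sup>+x. indicator S y * (indicator S x * ennreal \<bar>F x - F y\<bar>) \<partial>lborel) = 0"
    then have "AE x in lborel. indicator S y * (indicator S x * ennreal \<bar>F x - F y\<bar>) = 0"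
      by (subst (asm) nn_integral_0_iff_AE) auto
    then show "AE x in lborel. y \<in> S \<longrightarrow> x \<in> S \<longrightarrow> F x = F y"
      by (rule eventually_mono) (auto split: split_indicator_asm)
  qed
qed

text \<open>The ball is exhausted by smaller ones, on which a positive solution is bounded away from 0.\<close>

lemma AE_const_ball:
  fixes F :: "'a::euclidean_space \<Rightarrow> real"
  assumes R: "0 < R"
    and const: "\<And>r. 0 < r \<Longrightarrow> r < R \<Longrightarrow>
      AE y in lborel. AE x in lborel. y \<in> ball 0 r \<longrightarrow> x \<in> ball 0 r \<longrightarrow> F x = F y"
  shows "\<exists>a. AE x in lborel. x \<in> ball 0 R \<longrightarrow> F x = a"
proof -
  define r where "r = (\<lambda>m. R * (1 - inverse (real (m + 2))))"
  have r: "0 < r m" "r m < R" for m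
    using R by (auto simp: r_def inverse_less_1_iff intro!: mult_pos_pos)
  have all: "AE y in lborel. \<forall>m. AE x in lborel. y \<in> ball 0 (r m) \<longrightarrow> x \<in> ball 0 (r m) \<longrightarrow> F x = F y"
    using const[OF r] by (simp add: AE_all_countable)
  have pos: "\<not> (AE y in lborel. y \<notin> ball (0::'a) R)"
  proof
    assume "AE y in lborel. y \<notin> ball (0::'a) R"
    then have "ball (0::'a) R \<in> null_sets lborel"
      by (subst AE_iff_null_sets) auto
    then have "negligible (ball (0::'a) R)"
      by (simp add: negligible_iff_null_sets null_sets_completionI)
    then show False
      using R open_not_negligible[of "ball (0::'a) R"] by auto
  qed
  have "\<exists>y\<in>ball 0 R. \<forall>m. AE x in lborel. y \<in> ball 0 (r m) \<longrightarrow> x \<in> ball 0 (r m) \<longrightarrow> F x = F y"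
  proof (rule ccontr)
    assume n: "\<not> ?thesis"
    from all have "AE y in lborel. y \<notin> ball (0::'a) R"
      by (rule eventually_mono) (use n in blast)
    with pos show False by contradiction
  qed
  then obtain y where y: "y \<in> ball 0 R"
    and "\<forall>m. AE x in lborel. y \<in> ball 0 (r m) \<longrightarrow> x \<in> ball 0 (r m) \<longrightarrow> F x = F y"
    by blast
  then have "AE x in lborel. \<forall>m. y \<in> ball 0 (r m) \<longrightarrow> x \<in> ball 0 (r m) \<longrightarrow> F x = F y"
    by (simp add: AE_all_countable)
  then have "AE x in lborel. x \<in> ball 0 R \<longrightarrow> F x = F y"
  proof (rule AE_mp, intro AE_I2 impI)
    fix x assume *: "\<forall>m. y \<in> ball 0 (r m) \<longrightarrow> x \<in> ball 0 (r m) \<longrightarrow> F x = F y" and x: "x \<in> ball 0 R"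
    have "(\<lambda>m. inverse (real (m + 2))) \<longlonglongrightarrow> 0"
      using LIMSEQ_ignore_initial_segment[OF LIMSEQ_inverse_real_of_nat, of 1] by simp
    then have "r \<longlonglongrightarrow> R * (1 - 0)"
      unfolding r_def by (intro tendsto_intros)
    then have "\<forall>\<^sub>F m in sequentially. max (norm x) (norm y) < r m"
      using x y by (intro order_tendstoD) auto
    then obtain m where "max (norm x) (norm y) < r m"
      by (meson eventually_happens trivial_limit_sequentially)
    with * show "F x = F y" by auto
  qed
  then show ?thesis by blast
qed

section \<open>The principal eigenvalue of a symmetrizable operator on a ball\<close>

context symmetrizable
begin

lemma form_lower_bound:
  assumes \<Phi>: "C_infinity \<Phi>" "\<And>x. x \<in> \<Omega> \<Longrightarrow> 0 < \<Phi> x"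
    and eqn: "\<And>x. x \<in> \<Omega> \<Longrightarrow> elliptic_op b c \<Phi> x = - \<mu> * \<Phi> x"
    and u: "H10 \<Omega> u g"
  shows "\<mu> * ip u u \<le> form u g u g"
proof -
  obtain \<phi> where test: "\<And>k. test_function \<Omega> (\<phi> k)"
    and "(\<lambda>k. form (\<phi> k) (grad (\<phi> k)) (\<phi> k) (grad (\<phi> k))) \<longlonglongrightarrow> form u g u g"
    and "(\<lambda>k. ip (\<phi> k) (\<phi> k)) \<longlonglongrightarrow> ip u u"
    by (rule H10_approx[OF u]) blast
  then have lim: "(\<lambda>k. form (\<phi> k) (grad (\<phi> k)) (\<phi> k) (grad (\<phi> k)) - \<mu> * ip (\<phi> k) (\<phi> k))
      \<longlonglongrightarrow> form u g u g - \<mu> * ip u u"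
    by (intro tendsto_diff tendsto_mult tendsto_const)
  have nn: "0 \<le> form (\<phi> k) (grad (\<phi> k)) (\<phi> k) (grad (\<phi> k)) - \<mu> * ip (\<phi> k) (\<phi> k)" for k
  proof -
    have "0 \<le> (LINT x|M. \<rho> x * (\<Phi> x)\<^sup>2 * (norm (grad (\<lambda>x. \<phi> k x / \<Phi> x) x))\<^sup>2)"
      using weight_pos by (intro Bochner_Integration.integral_nonneg) (simp add: less_imp_le)
    also have "\<dots> = form (\<phi> k) (grad (\<phi> k)) (\<phi> k) (grad (\<phi> k)) - \<mu> * ip (\<phi> k) (\<phi> k)"
      by (rule picone_identity(1)[OF \<Phi> eqn test, symmetric])
    finally show ?thesis .
  qed
  have "0 \<le> form u g u g - \<mu> * ip u u"
    by (rule LIMSEQ_le_const[OF lim]) (use nn in blast)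
  then show ?thesis by simp
qed

text \<open>
  In the case of equality the quotients \<open>\<phi>\<^sub>k / \<Phi>\<close> of the approximating test functions converge
  to \<open>u / \<Phi>\<close> and, by Picone's identity, their gradients converge to 0, in \<open>L\<^sup>1\<close> of every smaller
  concentric ball.
\<close>

lemma form_equality_imp_multiple:
  assumes \<Omega>: "\<Omega> = ball 0 R" "0 < R"
    and \<Phi>: "C_infinity \<Phi>" "\<And>x. x \<in> \<Omega> \<Longrightarrow> 0 < \<Phi> x"
    and eqn: "\<And>x. x \<in> \<Omega> \<Longrightarrow> elliptic_op b c \<Phi> x = - \<mu> * \<Phi> x"
    and u: "H10 \<Omega> u g" and equality: "form u g u g = \<mu> * ip u u"
  shows "\<exists>a. AE x in M. u x = a * \<Phi> x"
proof -
  obtain \<phi> where test: "\<And>k. test_function \<Omega> (\<phi> k)"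
    and 1: "(\<lambda>k. form (\<phi> k) (grad (\<phi> k)) (\<phi> k) (grad (\<phi> k))) \<longlonglongrightarrow> form u g u g"
    and 2: "(\<lambda>k. ip (\<phi> k) (\<phi> k)) \<longlonglongrightarrow> ip u u"
    and lim: "(\<lambda>k. LINT x|M. (norm (\<phi> k x - u x))\<^sup>2) \<longlonglongrightarrow> 0"
    by (rule H10_approx[OF u]) blast
  define f where "f = (\<lambda>k x. \<phi> k x / \<Phi> x)"
  have Cf: "C_infinity (f k)" for k
    unfolding f_def by (rule test_functionD(1)[OF test_function_divide[OF test \<Phi>]])
  define Q where "Q = (\<lambda>k. LINT x|M. \<rho> x * (\<Phi> x)\<^sup>2 * (norm (grad (f k) x))\<^sup>2)"
  have Qint: "integrable M (\<lambda>x. \<rho> x * (\<Phi> x)\<^sup>2 * (norm (grad (f k) x))\<^sup>2)" for k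
    unfolding f_def by (rule picone_identity(2)[OF \<Phi> eqn test])
  have "Q \<longlonglongrightarrow> form u g u g - \<mu> * ip u u"
  proof -
    have "Q k = form (\<phi> k) (grad (\<phi> k)) (\<phi> k) (grad (\<phi> k)) - \<mu> * ip (\<phi> k) (\<phi> k)" for k
      unfolding Q_def f_def by (rule picone_identity(1)[OF \<Phi> eqn test, symmetric])
    then have "Q = (\<lambda>k. form (\<phi> k) (grad (\<phi> k)) (\<phi> k) (grad (\<phi> k)) - \<mu> * ip (\<phi> k) (\<phi> k))"
      by blast
    then show ?thesis by (simp only:) (intro tendsto_diff tendsto_mult tendsto_const 1 2)
  qed
  then have Q0: "Q \<longlonglongrightarrow> 0" using equality by simp
  have us: "square_integrable \<Omega> u" using H10_sq[OF u] by simp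
  have um[measurable]: "u \<in> borel_measurable M" using us by (rule square_integrable_measurable)
  have cont\<Phi>: "continuous_on UNIV \<Phi>" using \<Phi>(1) by (rule C_infinity_imp_continuous_on)
  have \<Phi>m[measurable]: "\<Phi> \<in> borel_measurable M"
    by (rule continuous_bound[OF cont\<Phi>])
  define F0 where "F0 = (\<lambda>x. if x \<in> \<Omega> then u x / \<Phi> x else 0)"
  have "(\<lambda>x. u x / \<Phi> x) \<in> borel_measurable M" by measurable
  then have "F0 \<in> borel_measurable lebesgue"
    unfolding F0_def using domain_measurable by (simp add: borel_measurable_if)
  then obtain F where F: "F \<in> borel_measurable lborel" and F0F: "AE x in lborel. F0 x = F x"
    using completion_ex_borel_measurable_real by blast
  have "\<exists>a. AE x in lborel. x \<in> ball 0 R \<longrightarrow> F x = a"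
  proof (rule AE_const_ball[OF \<Omega>(2)])
    fix r :: real assume r: "0 < r" "r < R"
    define S where "S = ball (0::'a) r"
    have S\<Omega>: "S \<subseteq> \<Omega>" "cball 0 r \<subseteq> \<Omega>" using r by (auto simp: S_def \<Omega>)
    have Sl: "S \<in> sets lebesgue" "S \<in> sets borel" by (simp_all add: S_def open_in_sets_lebesgue)
    have mins: "\<exists>m>0. \<forall>x\<in>S. m \<le> w x" if "continuous_on UNIV w" "\<And>x. x \<in> \<Omega> \<Longrightarrow> 0 < w x" for w :: "'a \<Rightarrow> real"
    proof -
      have "continuous_on (cball 0 r) w" using that(1) by (rule continuous_on_subset) simp
      then obtain z where z: "z \<in> cball 0 r" "\<forall>x\<in>cball 0 r. w z \<le> w x"
        using continuous_attains_inf[of "cball 0 r" w] r by auto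
      have "0 < w z" using that(2) z(1) S\<Omega>(2) by blast
      then show ?thesis using z(2) by (intro exI[of _ "w z"]) (auto simp: S_def)
    qed
    obtain m where m: "0 < m" "\<And>x. x \<in> S \<Longrightarrow> m \<le> \<Phi> x"
      using mins[OF cont\<Phi> \<Phi>(2)] by blast
    have "continuous_on UNIV (\<lambda>x. \<rho> x * (\<Phi> x)\<^sup>2)"
      by (intro continuous_on_mult continuous_on_power cont_weight cont\<Phi>)
    moreover have "0 < \<rho> x * (\<Phi> x)\<^sup>2" if "x \<in> \<Omega>" for x
      using weight_pos[of x] \<Phi>(2)[OF that] by simp
    ultimately obtain m' where m': "0 < m'" "\<And>x. x \<in> S \<Longrightarrow> m' \<le> \<rho> x * (\<Phi> x)\<^sup>2"
      using mins by blast
    have "(\<lambda>k. \<integral>\<^sup>+x. ennreal \<bar>f k x - F x\<bar> * indicator S x \<partial>lborel) \<longlonglongrightarrow> 0"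
    proof -
      have s1: "square_integrable \<Omega> (\<lambda>x. 1 :: real)"
        by (intro square_integrable_continuous bounded_domain domain_measurable continuous_on_const)
      have d: "square_integrable \<Omega> (\<lambda>x. \<phi> k x - u x)" for k
        by (intro square_integrable_diff sq_test(1)[OF test] us)
      have L: "(\<lambda>k. LINT x|M. \<bar>\<phi> k x - u x\<bar>) \<longlonglongrightarrow> 0"
        using L2_inner_tendsto_0[OF s1 d lim] by simp
      have i1: "integrable M (\<lambda>x. \<bar>\<phi> k x - u x\<bar>)" for k
        using integrable_abs[OF square_integrable_inner[OF s1 d[of k]]] by simp
      have le: "(\<integral>\<^sup>+x. ennreal \<bar>f k x - F x\<bar> * indicator S x \<partial>lborel)
          \<le> ennreal ((LINT x|M. \<bar>\<phi> k x - u x\<bar>) / m)" for k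
      proof -
        have "(\<integral>\<^sup>+x. ennreal \<bar>f k x - F x\<bar> * indicator S x \<partial>lborel)
          = (\<integral>\<^sup>+x. ennreal \<bar>f k x - F0 x\<bar> * indicator S x \<partial>lborel)"
          by (rule nn_integral_cong_AE) (use F0F in \<open>rule eventually_mono, simp\<close>)
        also have "\<dots> = (\<integral>\<^sup>+x. ennreal \<bar>f k x - F0 x\<bar> * indicator S x \<partial>lebesgue)"
          by (rule nn_integral_completion[symmetric])
        also have "\<dots> \<le> (\<integral>\<^sup>+x. ennreal (\<bar>\<phi> k x - u x\<bar> / m) * indicator \<Omega> x \<partial>lebesgue)"
        proof (rule nn_integral_mono)
          fix x
          show "ennreal \<bar>f k x - F0 x\<bar> * indicator S x \<le> ennreal (\<bar>\<phi> k x - u x\<bar> / m) * indicator \<Omega> x"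
          proof (cases "x \<in> S")
            case True
            then have x: "x \<in> \<Omega>" using S\<Omega> by blast
            have "\<bar>f k x - F0 x\<bar> = \<bar>\<phi> k x - u x\<bar> / \<Phi> x"
              using x \<Phi>(2)[OF x] by (simp add: f_def F0_def abs_divide flip: diff_divide_distrib)
            also have "\<dots> \<le> \<bar>\<phi> k x - u x\<bar> / m"
              using m(1) m(2)[OF True] by (intro divide_left_mono mult_pos_pos) auto
            finally show ?thesis using True x by (simp add: ennreal_leI)
          qed simp
        qed
        also have "\<dots> = (\<integral>\<^sup>+x. ennreal (\<bar>\<phi> k x - u x\<bar> / m) \<partial>M)"
          using domain_measurable by (subst nn_integral_restrict_space) auto
        also have "\<dots> = ennreal (LINT x|M. \<bar>\<phi> k x - u x\<bar> / m)"
          using i1[of k] m(1) by (intro nn_integral_eq_integral) auto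
        finally show ?thesis by simp
      qed
      have "(\<lambda>k. (LINT x|M. \<bar>\<phi> k x - u x\<bar>) / m) \<longlonglongrightarrow> 0 / m"
        using m(1) by (intro tendsto_divide L tendsto_const) simp
      then have "(\<lambda>k. ennreal ((LINT x|M. \<bar>\<phi> k x - u x\<bar>) / m)) \<longlonglongrightarrow> ennreal (0 / m)"
        by (rule tendsto_ennrealI)
      then have lim_upper: "(\<lambda>k. ennreal ((LINT x|M. \<bar>\<phi> k x - u x\<bar>) / m)) \<longlonglongrightarrow> 0" by simp
      show ?thesis
        by (rule tendsto_sandwich[OF always_eventually[OF allI[OF zero_le]]
              always_eventually[OF allI[OF le]] tendsto_const lim_upper])
    qed
    moreover have "(\<lambda>k. \<integral>\<^sup>+x. ennreal (norm (grad (f k) x)) * indicator S x \<partial>lborel) \<longlonglongrightarrow> 0"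
    proof -
      have bS: "bounded S" by (simp add: S_def)
      have s1: "square_integrable S (\<lambda>x. 1 :: real)"
        by (intro square_integrable_continuous bS Sl continuous_on_const)
      have cg: "continuous_on UNIV (\<lambda>x. norm (grad (f k) x))" for k
        by (intro continuous_on_norm C_infinity_imp_continuous_on C_infinity_grad Cf)
      have d: "square_integrable S (\<lambda>x. norm (grad (f k) x))" for k
        by (intro square_integrable_continuous bS Sl cg)
      have le: "(LINT x|lebesgue_on S. (norm (norm (grad (f k) x)))\<^sup>2) \<le> Q k / m'" for k
      proof -
        have "(LINT x|lebesgue_on S. (norm (norm (grad (f k) x)))\<^sup>2)
          = (LINT x|lebesgue. indicator S x *\<^sub>R (norm (grad (f k) x))\<^sup>2)"
          using Sl by (subst integral_restrict_space) auto
        also have "\<dots> \<le> (LINT x|lebesgue. indicator \<Omega> x *\<^sub>R (\<rho> x * (\<Phi> x)\<^sup>2 * (norm (grad (f k) x))\<^sup>2 / m'))"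
        proof (rule integral_mono)
          show "integrable lebesgue (\<lambda>x. indicator S x *\<^sub>R (norm (grad (f k) x))\<^sup>2)"
            using d[of k] Sl integrable_restrict_space[of S lebesgue "\<lambda>x. (norm (grad (f k) x))\<^sup>2"]
            by (simp add: square_integrable_def)
          show "integrable lebesgue (\<lambda>x. indicator \<Omega> x *\<^sub>R (\<rho> x * (\<Phi> x)\<^sup>2 * (norm (grad (f k) x))\<^sup>2 / m'))"
            using Qint[of k] domain_measurable m'(1)
              integrable_restrict_space[of \<Omega> lebesgue "\<lambda>x. \<rho> x * (\<Phi> x)\<^sup>2 * (norm (grad (f k) x))\<^sup>2 / m'"]
            by simp
          fix x
          have "(norm (grad (f k) x))\<^sup>2 \<le> \<rho> x * (\<Phi> x)\<^sup>2 * (norm (grad (f k) x))\<^sup>2 / m'" if "x \<in> S"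
          proof -
            have "m' * (norm (grad (f k) x))\<^sup>2 \<le> \<rho> x * (\<Phi> x)\<^sup>2 * (norm (grad (f k) x))\<^sup>2"
              using m'(2)[OF that] by (intro mult_right_mono) auto
            then show ?thesis using m'(1) by (simp add: pos_le_divide_eq mult.commute)
          qed
          moreover have "0 \<le> \<rho> x * (\<Phi> x)\<^sup>2 * (norm (grad (f k) x))\<^sup>2 / m'"
            using m'(1) weight_pos[of x] by (intro divide_nonneg_nonneg mult_nonneg_nonneg) auto
          ultimately show "indicator S x *\<^sub>R (norm (grad (f k) x))\<^sup>2
            \<le> indicator \<Omega> x *\<^sub>R (\<rho> x * (\<Phi> x)\<^sup>2 * (norm (grad (f k) x))\<^sup>2 / m')"
            using S\<Omega>(1) by (auto split: split_indicator)
        qed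
        also have "\<dots> = (LINT x|M. \<rho> x * (\<Phi> x)\<^sup>2 * (norm (grad (f k) x))\<^sup>2 / m')"
          using domain_measurable by (subst integral_restrict_space) auto
        finally show ?thesis by (simp add: Q_def)
      qed
      have "(\<lambda>k. Q k / m') \<longlonglongrightarrow> 0 / m'"
        using m'(1) by (intro tendsto_divide Q0 tendsto_const) simp
      then have up: "(\<lambda>k. Q k / m') \<longlonglongrightarrow> 0" by simp
      have nn: "0 \<le> (LINT x|lebesgue_on S. (norm (norm (grad (f k) x)))\<^sup>2)" for k
        by (rule Bochner_Integration.integral_nonneg) simp
      have "(\<lambda>k. LINT x|lebesgue_on S. (norm (norm (grad (f k) x)))\<^sup>2) \<longlonglongrightarrow> 0"
        by (rule tendsto_sandwich[OF always_eventually[OF allI[OF nn]]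
              always_eventually[OF allI[OF le]] tendsto_const up])
      from L2_inner_tendsto_0[OF s1 d this]
      have "(\<lambda>k. LINT x|lebesgue_on S. norm (grad (f k) x)) \<longlonglongrightarrow> 0" by simp
      from tendsto_ennrealI[OF this]
      have "(\<lambda>k. ennreal (LINT x|lebesgue_on S. norm (grad (f k) x))) \<longlonglongrightarrow> 0" by simp
      moreover have "ennreal (LINT x|lebesgue_on S. norm (grad (f k) x))
          = (\<integral>\<^sup>+x. ennreal (norm (grad (f k) x)) * indicator S x \<partial>lborel)" for k
      proof -
        have "integrable (lebesgue_on S) (\<lambda>x. norm (grad (f k) x))"
          using square_integrable_inner[OF s1 d[of k]] by simp
        then have "ennreal (LINT x|lebesgue_on S. norm (grad (f k) x))
            = (\<integral>\<^sup>+x. ennreal (norm (grad (f k) x)) \<partial>lebesgue_on S)"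
          by (intro nn_integral_eq_integral[symmetric]) auto
        also have "\<dots> = (\<integral>\<^sup>+x. ennreal (norm (grad (f k) x)) * indicator S x \<partial>lebesgue)"
          using Sl by (subst nn_integral_restrict_space) auto
        also have "\<dots> = (\<integral>\<^sup>+x. ennreal (norm (grad (f k) x)) * indicator S x \<partial>lborel)"
          by (rule nn_integral_completion)
        finally show ?thesis .
      qed
      ultimately show ?thesis by simp
    qed
    ultimately have "AE y in lborel. AE x in lborel. y \<in> S \<longrightarrow> x \<in> S \<longrightarrow> F x = F y"
      using F by (intro L1_limit_gradient_0_const[OF Cf _ S_def]) auto
    then show "AE y in lborel. AE x in lborel. y \<in> ball 0 r \<longrightarrow> x \<in> ball 0 r \<longrightarrow> F x = F y"
      by (simp only: S_def)
  qed
  then obtain a where "AE x in lborel. x \<in> \<Omega> \<longrightarrow> F x = a" unfolding \<Omega>(1) by blast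
  then have "AE x in lborel. x \<in> \<Omega> \<longrightarrow> u x = a * \<Phi> x"
    using F0F
  proof eventually_elim
    case (elim x)
    then show ?case using \<Phi>(2)[of x] by (auto simp: F0_def field_simps)
  qed
  then have "AE x in lebesgue. x \<in> \<Omega> \<longrightarrow> u x = a * \<Phi> x" by (rule AE_completion)
  then show ?thesis
    using domain_measurable by (auto simp: AE_restrict_space_iff)
qed

lemma ip_add_left:
  assumes "square_integrable \<Omega> u" "square_integrable \<Omega> v" "square_integrable \<Omega> w"
  shows "ip (\<lambda>x. s * u x + t * v x) w = s * ip u w + t * ip v w"
proof -
  have "ip (\<lambda>x. s * u x + t * v x) w = (LINT x|M. s * (\<rho> x * u x * w x) + t * (\<rho> x * v x * w x))"
    unfolding ip_def by (intro Bochner_Integration.integral_cong) (simp_all add: algebra_simps)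
  also have "\<dots> = s * ip u w + t * ip v w"
    unfolding ip_def using ip_integrable[OF assms(1,3)] ip_integrable[OF assms(2,3)] by simp
  finally show ?thesis .
qed

text \<open>
  Algebraic simplicity follows from symmetry: if \<open>- L z = \<mu> z\<close> and \<open>- L p = \<mu> p + z\<close>, comparing
  \<open>form p z\<close> computed from either equation gives \<open>ip z z = 0\<close>.
\<close>

lemma generalized_eigenfunction_multiple:
  assumes \<Omega>: "\<Omega> = ball 0 R" "0 < R"
    and \<Phi>: "C_infinity \<Phi>" "\<And>x. x \<in> \<Omega> \<Longrightarrow> 0 < \<Phi> x"
    and eqn: "\<And>x. x \<in> \<Omega> \<Longrightarrow> elliptic_op b c \<Phi> x = - \<mu> * \<Phi> x"
    and p: "dirichlet_solution b c \<Omega> p (\<lambda>x. \<mu> * p x + z x)"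
    and z: "dirichlet_solution b c \<Omega> z (\<lambda>x. \<mu> * z x)"
  shows "\<exists>a. AE x in M. p x = a * \<Phi> x"
proof -
  have ps: "square_integrable \<Omega> p" and zs: "square_integrable \<Omega> z"
    using p z by (auto simp: dirichlet_solution_def H10_def)
  have fz: "square_integrable \<Omega> (\<lambda>x. \<mu> * z x)"
    using square_integrable_cmult[OF zs, of \<mu>] by simp
  have fp: "square_integrable \<Omega> (\<lambda>x. \<mu> * p x + z x)"
    using square_integrable_add[OF square_integrable_cmult[OF ps, of \<mu>] zs] by simp
  obtain g where g: "H10 \<Omega> p g" "\<And>v h. H10 \<Omega> v h \<Longrightarrow> form p g v h = ip (\<lambda>x. \<mu> * p x + z x) v"
    using solution_form[OF p fp] by blast
  obtain h where h: "H10 \<Omega> z h" "\<And>v k. H10 \<Omega> v k \<Longrightarrow> form z h v k = ip (\<lambda>x. \<mu> * z x) v"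
    using solution_form[OF z fz] by blast
  have lin1: "ip (\<lambda>x. \<mu> * p x + z x) w = \<mu> * ip p w + ip z w" if "square_integrable \<Omega> w" for w
    using ip_add_left[OF ps zs that, of \<mu> 1] by simp
  have lin2: "ip (\<lambda>x. \<mu> * z x) w = \<mu> * ip z w" if "square_integrable \<Omega> w" for w
    using ip_add_left[OF zs zs that, of \<mu> 0] by simp
  have "\<mu> * ip p z + ip z z = \<mu> * ip z p"
    using g(2)[OF h(1)] h(2)[OF g(1)] form_commute[of p g z h] lin1[OF zs] lin2[OF ps] by simp
  then have "ip z z = 0" using ip_commute[of p z] by simp
  then have z0: "AE x in M. z x = 0" by (rule ip_pos(2)[OF zs])
  have "ip z p = 0"
    unfolding ip_def by (rule integral_eq_zero_AE) (use z0 in \<open>rule eventually_mono, simp\<close>)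
  then have eq: "form p g p g = \<mu> * ip p p" using g(2)[OF g(1)] lin1[OF ps] by simp
  show ?thesis by (rule form_equality_imp_multiple[OF \<Omega> \<Phi> eqn g(1) eq])
qed

text \<open>
  Testing the equations for the real and imaginary parts with these parts themselves, the terms
  with the imaginary part of \<open>\<nu>\<close> cancel by symmetry.
\<close>

lemma eigenvalue_lower_bound:
  assumes \<Phi>: "C_infinity \<Phi>" "\<And>x. x \<in> \<Omega> \<Longrightarrow> 0 < \<Phi> x"
    and eqn: "\<And>x. x \<in> \<Omega> \<Longrightarrow> elliptic_op b c \<Phi> x = - \<mu> * \<Phi> x"
    and "dirichlet_eigenvalue b c \<Omega> \<nu>"
  shows "\<mu> \<le> Re \<nu>"
proof -
  obtain \<psi> where \<psi>: "complex_dirichlet_solution b c \<Omega> \<psi> (\<lambda>x. \<nu> * \<psi> x)"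
    and nz: "\<not> (AE x in M. \<psi> x = 0)"
    using assms(4) by (auto simp: dirichlet_eigenvalue_def)
  define p where "p = (\<lambda>x. Re (\<psi> x))"
  define q where "q = (\<lambda>x. Im (\<psi> x))"
  have p: "dirichlet_solution b c \<Omega> p (\<lambda>x. Re \<nu> * p x + (- Im \<nu>) * q x)"
    and q: "dirichlet_solution b c \<Omega> q (\<lambda>x. Im \<nu> * p x + Re \<nu> * q x)"
    using \<psi> by (simp_all add: complex_dirichlet_solution_def p_def q_def add.commute)
  have ps: "square_integrable \<Omega> p" and qs: "square_integrable \<Omega> q"
    using p q by (auto simp: dirichlet_solution_def H10_def)
  have lin: "square_integrable \<Omega> (\<lambda>x. s * p x + t * q x)" for s t
    using square_integrable_add[OF square_integrable_cmult[OF ps, of s] square_integrable_cmult[OF qs, of t]]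
    by simp
  obtain g where g: "H10 \<Omega> p g" "form p g p g = ip (\<lambda>x. Re \<nu> * p x + (- Im \<nu>) * q x) p"
    by (rule solution_form[OF p lin]) blast
  obtain h where h: "H10 \<Omega> q h" "form q h q h = ip (\<lambda>x. Im \<nu> * p x + Re \<nu> * q x) q"
    by (rule solution_form[OF q lin]) blast
  have "form p g p g + form q h q h = Re \<nu> * (ip p p + ip q q)"
    using g(2) h(2) ip_add_left[OF ps qs ps, of "Re \<nu>" "- Im \<nu>"]
      ip_add_left[OF ps qs qs, of "Im \<nu>" "Re \<nu>"] ip_commute[of p q]
    by (simp add: algebra_simps)
  moreover have "\<mu> * ip p p \<le> form p g p g" "\<mu> * ip q q \<le> form q h q h"
    using form_lower_bound[OF \<Phi> eqn] g(1) h(1) by blast+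
  ultimately have le: "\<mu> * (ip p p + ip q q) \<le> Re \<nu> * (ip p p + ip q q)"
    by (simp add: distrib_left)
  have "ip p p + ip q q \<noteq> 0"
  proof
    assume "ip p p + ip q q = 0"
    then have "ip p p = 0" "ip q q = 0" using ip_pos(1)[OF ps] ip_pos(1)[OF qs] by linarith+
    then have "AE x in M. p x = 0" "AE x in M. q x = 0"
      using ip_pos(2)[OF ps] ip_pos(2)[OF qs] by blast+
    then have "AE x in M. \<psi> x = 0"
      by eventually_elim (simp add: p_def q_def complex_eq_iff)
    with nz show False by contradiction
  qed
  then have "0 < ip p p + ip q q" using ip_pos(1)[OF ps] ip_pos(1)[OF qs] by linarith
  with le show ?thesis by (simp add: mult_le_cancel_right)
qed

text \<open>
  A positive solution with zero boundary values is the principal eigenfunction, so that exhibiting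
  one replaces an existence theory for eigenvalues.
\<close>

lemma positive_solution_principal:
  assumes \<Omega>: "\<Omega> = ball 0 R" "0 < R"
    and \<Phi>: "C_infinity \<Phi>" "\<And>x. x \<in> \<Omega> \<Longrightarrow> 0 < \<Phi> x"
    and eqn: "\<And>x. x \<in> \<Omega> \<Longrightarrow> elliptic_op b c \<Phi> x = - \<mu> * \<Phi> x"
    and bdry: "\<And>x. norm x = R \<Longrightarrow> \<Phi> x = 0"
  shows "is_principal_eigenvalue b c \<Omega> \<mu>"
proof -
  have "H10 \<Omega> \<Phi> (grad \<Phi>)"
    unfolding \<Omega>(1) by (rule H10_vanishing_on_sphere[OF \<Phi>(1) \<Omega>(2) bdry])
  then have sol: "dirichlet_solution b c \<Omega> \<Phi> (\<lambda>x. \<mu> * \<Phi> x)"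
    unfolding dirichlet_solution_def
    using classical_imp_weak[OF \<Phi>(1) eqn domain_measurable] by blast
  have simple: "\<exists>a::complex. AE x in M. \<psi> x = a * of_real (\<Phi> x)"
    if \<psi>: "complex_dirichlet_solution b c \<Omega> \<psi> (\<lambda>x. of_real \<mu> * \<psi> x + \<zeta> x)"
      and \<zeta>: "complex_dirichlet_solution b c \<Omega> \<zeta> (\<lambda>x. of_real \<mu> * \<zeta> x)" for \<psi> \<zeta>
  proof -
    have "dirichlet_solution b c \<Omega> (\<lambda>x. Re (\<psi> x)) (\<lambda>x. \<mu> * Re (\<psi> x) + Re (\<zeta> x))"
      "dirichlet_solution b c \<Omega> (\<lambda>x. Re (\<zeta> x)) (\<lambda>x. \<mu> * Re (\<zeta> x))"
      "dirichlet_solution b c \<Omega> (\<lambda>x. Im (\<psi> x)) (\<lambda>x. \<mu> * Im (\<psi> x) + Im (\<zeta> x))"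
      "dirichlet_solution b c \<Omega> (\<lambda>x. Im (\<zeta> x)) (\<lambda>x. \<mu> * Im (\<zeta> x))"
      using \<psi> \<zeta> by (simp_all add: complex_dirichlet_solution_def)
    from generalized_eigenfunction_multiple[OF \<Omega> \<Phi> eqn this(1,2)]
      generalized_eigenfunction_multiple[OF \<Omega> \<Phi> eqn this(3,4)]
    obtain a a' where "AE x in M. Re (\<psi> x) = a * \<Phi> x" "AE x in M. Im (\<psi> x) = a' * \<Phi> x"
      by blast
    then have "AE x in M. \<psi> x = Complex a a' * of_real (\<Phi> x)"
      by eventually_elim (simp add: complex_eq_iff)
    then show ?thesis by blast
  qed
  show ?thesis
    unfolding is_principal_eigenvalue_def
  proof (intro conjI exI[of _ \<Phi>] allI ballI impI)
    fix \<nu> assume eig: "dirichlet_eigenvalue b c \<Omega> \<nu>"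
    show "\<mu> \<le> Re \<nu>" by (rule eigenvalue_lower_bound[OF \<Phi> eqn eig])
  qed (use \<Phi>(2) sol simple in blast)+
qed

end

text \<open>
  The principal eigenvalue is determined by its defining property: each of two such numbers is an
  eigenvalue, so neither exceeds the other.
\<close>

lemma is_principal_eigenvalue_unique:
  fixes \<Omega> :: "'a::euclidean_space set"
  assumes \<Omega>: "open \<Omega>" "\<Omega> \<noteq> {}"
    and "is_principal_eigenvalue b c \<Omega> \<mu>" "is_principal_eigenvalue b c \<Omega> \<mu>'"
  shows "\<mu> = \<mu>'"
proof -
  have eig: "dirichlet_eigenvalue b c \<Omega> (of_real \<mu>)" if principal: "is_principal_eigenvalue b c \<Omega> \<mu>" for \<mu>
  proof -
    obtain \<phi> where \<phi>: "\<And>x. x \<in> \<Omega> \<Longrightarrow> 0 < \<phi> x" "dirichlet_solution b c \<Omega> \<phi> (\<lambda>x. \<mu> * \<phi> x)"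
      using principal unfolding is_principal_eigenvalue_def by blast
    have grad0: "grad (\<lambda>x::'a. 0) = (\<lambda>x. 0)"
      by (intro ext grad_eq) simp
    have "test_function \<Omega> (\<lambda>x. 0)" by (simp add: test_function_def C_infinity_const)
    then have "H10 \<Omega> (\<lambda>x. 0) (\<lambda>x. 0)"
      unfolding H10_def square_integrable_def by (auto simp: grad0 intro!: exI[of _ "\<lambda>_ _. 0"])
    then have zero: "dirichlet_solution b c \<Omega> (\<lambda>x. 0) (\<lambda>x. 0)"
      unfolding dirichlet_solution_def by (intro exI[of _ "\<lambda>x. 0"]) simp
    have "complex_dirichlet_solution b c \<Omega> (\<lambda>x. of_real (\<phi> x)) (\<lambda>x. of_real \<mu> * of_real (\<phi> x))"
      unfolding complex_dirichlet_solution_def using \<phi>(2) zero by simp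
    moreover have "\<not> (AE x in lebesgue_on \<Omega>. (of_real (\<phi> x) :: complex) = 0)"
    proof
      assume "AE x in lebesgue_on \<Omega>. (of_real (\<phi> x) :: complex) = 0"
      then have "AE x in lebesgue. x \<in> \<Omega> \<longrightarrow> \<phi> x = 0"
        using open_in_sets_lebesgue[OF \<Omega>(1)] by (simp add: AE_restrict_space_iff)
      then have "AE x in lebesgue. x \<notin> \<Omega>"
        by (rule eventually_mono) (use \<phi>(1) in force)
      then have "\<Omega> \<in> null_sets lebesgue"
        using open_in_sets_lebesgue[OF \<Omega>(1)] by (subst AE_iff_null_sets) auto
      then have "negligible \<Omega>" by (simp add: negligible_iff_null_sets)
      with \<Omega> show False using open_not_negligible by blast
    qed
    ultimately show ?thesis unfolding dirichlet_eigenvalue_def by blast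
  qed
  show ?thesis
    using eig[OF assms(3)] eig[OF assms(4)] assms(3,4) unfolding is_principal_eigenvalue_def
    by (metis Re_complex_of_real order_antisym)
qed

lemma principal_eigenvalue_eqI:
  assumes "open \<Omega>" "\<Omega> \<noteq> {}" "is_principal_eigenvalue b c \<Omega> \<mu>"
  shows "principal_eigenvalue b c \<Omega> = \<mu>"
  unfolding principal_eigenvalue_def
  using assms is_principal_eigenvalue_unique[OF assms(1,2)] by (intro the_equality) blast+

section \<open>Radial eigenfunctions of the Laplacian\<close>

lemma grad_radial:
  fixes x :: "'a::euclidean_space"
  assumes "(g has_real_derivative d) (at (x \<bullet> x))"
  shows "grad (\<lambda>x. g (x \<bullet> x)) x = (2 * d) *\<^sub>R x"
proof -
  have "((\<lambda>x. x \<bullet> x) has_derivative (\<lambda>h. 2 * (x \<bullet> h))) (at x)"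
    by (auto intro!: derivative_eq_intros simp: inner_commute)
  from has_derivative_compose[OF this assms[unfolded has_field_derivative_def]]
  show ?thesis by (intro grad_eq) (simp add: mult.assoc mult.left_commute)
qed

lemma laplacian_radial:
  fixes x :: "'a::euclidean_space"
  assumes g: "\<And>s. 0 \<le> s \<Longrightarrow> (g has_real_derivative g1 s) (at s)"
    and g1: "\<And>s. 0 \<le> s \<Longrightarrow> (g1 has_real_derivative g2 s) (at s)"
  shows "laplacian (\<lambda>x. g (x \<bullet> x)) x = 2 * real DIM('a) * g1 (x \<bullet> x) + 4 * (x \<bullet> x) * g2 (x \<bullet> x)"
proof -
  have sq: "((\<lambda>x. x \<bullet> x) has_derivative (\<lambda>h. 2 * (x \<bullet> h))) (at x)" for x :: 'a
    by (auto intro!: derivative_eq_intros simp: inner_commute)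
  have "partial_deriv i (partial_deriv i (\<lambda>x. g (x \<bullet> x))) x
      = 2 * g1 (x \<bullet> x) + 4 * ((x \<bullet> i) * (x \<bullet> i)) * g2 (x \<bullet> x)" if i: "i \<in> Basis" for i
  proof -
    have "partial_deriv i (\<lambda>x. g (x \<bullet> x)) = (\<lambda>x. 2 * (x \<bullet> i) * g1 (x \<bullet> x))"
    proof
      fix x :: 'a
      have "(g has_derivative (*) (g1 (x \<bullet> x))) (at (x \<bullet> x))"
        using g[of "x \<bullet> x"] by (simp add: has_field_derivative_def)
      from partial_deriv_eq[OF has_derivative_compose[OF sq this]]
      show "partial_deriv i (\<lambda>x. g (x \<bullet> x)) x = 2 * (x \<bullet> i) * g1 (x \<bullet> x)" by simp
    qed
    moreover have "((\<lambda>x. 2 * (x \<bullet> i) * g1 (x \<bullet> x)) has_derivative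
      (\<lambda>h. 2 * (x \<bullet> i) * (g1' * (2 * (x \<bullet> h))) + 2 * (h \<bullet> i) * g1 (x \<bullet> x))) (at x)"
      if "g1' = g2 (x \<bullet> x)" for g1'
    proof -
      have "(g1 has_derivative (*) g1') (at (x \<bullet> x))"
        using g1[of "x \<bullet> x"] that by (simp add: has_field_derivative_def)
      from has_derivative_compose[OF sq this] show ?thesis
        by (intro has_derivative_mult) (auto intro!: derivative_eq_intros)
    qed
    ultimately show ?thesis
      using i by (simp add: partial_deriv_eq algebra_simps)
  qed
  then have "laplacian (\<lambda>x. g (x \<bullet> x)) x
      = (\<Sum>i\<in>Basis. 2 * g1 (x \<bullet> x) + 4 * ((x \<bullet> i) * (x \<bullet> i)) * g2 (x \<bullet> x))"
    by (simp add: laplacian_def)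
  also have "\<dots> = 2 * real DIM('a) * g1 (x \<bullet> x) + 4 * (x \<bullet> x) * g2 (x \<bullet> x)"
    by (subst (4) euclidean_inner) (simp add: sum.distrib sum_distrib_left sum_distrib_right)
  finally show ?thesis .
qed

text \<open>
  \<open>radial_bessel d 0\<close> is the entire function \<open>F\<close> with \<open>F 0 = 1\<close> for which \<open>F (|x|\<^sup>2)\<close> is an
  eigenfunction of the Laplacian on \<open>\<real>\<^sup>d\<close> with eigenvalue \<open>- 1\<close>; up to a constant it is
  \<open>r\<close> to the power \<open>1 - d / 2\<close> times the Bessel function of order \<open>d / 2 - 1\<close> at \<open>r = sqrt s\<close>.
  The first index after \<open>d\<close> counts derivatives.
\<close>

primrec bessel_coeff :: "nat \<Rightarrow> nat \<Rightarrow> real" where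
  "bessel_coeff d 0 = 1"
| "bessel_coeff d (Suc k) = - bessel_coeff d k / (2 * real (Suc k) * (2 * real k + real d))"

definition radial_bessel :: "nat \<Rightarrow> nat \<Rightarrow> real \<Rightarrow> real" where
  "radial_bessel d m s = (\<Sum>n. (diffs ^^ m) (bessel_coeff d) n * s ^ n)"

lemma summable_bessel_coeff:
  assumes "0 < d"
  shows "summable (\<lambda>n. (diffs ^^ m) (bessel_coeff d) n * s ^ n)"
proof (induction m arbitrary: s)
  case 0
  obtain N :: nat where N: "\<bar>s\<bar> \<le> real N" using real_arch_simple by blast
  have "summable (\<lambda>n. bessel_coeff d n * s ^ n)"
  proof (rule summable_ratio_test[where c = "1 / 2" and N = N])
    fix n assume "N \<le> n"
    then have s: "\<bar>s\<bar> \<le> real (Suc n)" using N by simp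
    have "1 \<le> 2 * real n + real d" using assms by linarith
    then have "real (Suc n) * 1 \<le> real (Suc n) * (2 * real n + real d)" by (intro mult_left_mono) auto
    with s have "\<bar>s\<bar> \<le> real (Suc n) * (2 * real n + real d)" by (simp only: mult_1_right)
    moreover have pos: "0 < real (Suc n) * (2 * real n + real d)" using assms by simp
    ultimately have "\<bar>s\<bar> / (2 * real (Suc n) * (2 * real n + real d)) \<le> 1 / 2"
      by (simp only: mult.assoc) (simp add: divide_le_eq)
    then have "\<bar>s\<bar> / (2 * real (Suc n) * (2 * real n + real d)) * \<bar>bessel_coeff d n * s ^ n\<bar>
        \<le> 1 / 2 * \<bar>bessel_coeff d n * s ^ n\<bar>" by (rule mult_right_mono) simp
    moreover have eq: "\<bar>bessel_coeff d (Suc n) * s ^ Suc n\<bar>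
        = \<bar>s\<bar> / (2 * real (Suc n) * (2 * real n + real d)) * \<bar>bessel_coeff d n * s ^ n\<bar>"
      by (simp add: abs_mult)
    ultimately show "norm (bessel_coeff d (Suc n) * s ^ Suc n) \<le> 1 / 2 * norm (bessel_coeff d n * s ^ n)"
      unfolding real_norm_def eq by blast
  qed simp
  then show ?case by simp
next
  case (Suc m)
  then show ?case using termdiff_converges_all[of "(diffs ^^ m) (bessel_coeff d)" s] by simp
qed

lemma has_derivative_radial_bessel:
  assumes "0 < d"
  shows "(radial_bessel d m has_real_derivative radial_bessel d (Suc m) s) (at s)"
  using termdiffs_strong_converges_everywhere[OF summable_bessel_coeff[OF assms, of m], of s]
  unfolding radial_bessel_def[abs_def] by simp

lemma radial_bessel_0: "radial_bessel d 0 0 = 1"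
  by (simp add: radial_bessel_def)

lemma radial_bessel_ode:
  assumes d: "0 < d"
  shows "4 * s * radial_bessel d 2 s + 2 * real d * radial_bessel d 1 s + radial_bessel d 0 s = 0"
proof -
  let ?c = "bessel_coeff d"
  have "(\<lambda>n. real n * diffs ?c n * s ^ (n - Suc 0)) sums radial_bessel d 2 s"
    using diffs_equiv[of "diffs ?c" s] summable_bessel_coeff[OF d, of 2 s]
    by (simp add: radial_bessel_def numeral_2_eq_2)
  then have "(\<lambda>n. 4 * s * (real n * diffs ?c n * s ^ (n - Suc 0))) sums (4 * s * radial_bessel d 2 s)"
    by (rule sums_mult)
  moreover have "(\<lambda>n. 4 * s * (real n * diffs ?c n * s ^ (n - Suc 0))) = (\<lambda>n. 4 * real n * diffs ?c n * s ^ n)"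
  proof
    fix n show "4 * s * (real n * diffs ?c n * s ^ (n - Suc 0)) = 4 * real n * diffs ?c n * s ^ n"
      by (cases n) auto
  qed
  ultimately have s2: "(\<lambda>n. 4 * real n * diffs ?c n * s ^ n) sums (4 * s * radial_bessel d 2 s)" by simp
  have s1: "(\<lambda>n. 2 * real d * (diffs ?c n * s ^ n)) sums (2 * real d * radial_bessel d 1 s)"
    using summable_sums[OF summable_bessel_coeff[OF d, of 1 s]]
    by (intro sums_mult) (simp add: radial_bessel_def)
  have s0: "(\<lambda>n. ?c n * s ^ n) sums radial_bessel d 0 s"
    using summable_sums[OF summable_bessel_coeff[OF d, of 0 s]] by (simp add: radial_bessel_def)
  have "4 * real n * diffs ?c n * s ^ n + 2 * real d * (diffs ?c n * s ^ n) + ?c n * s ^ n = 0" for n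
  proof -
    have "diffs ?c n = - ?c n / (2 * (2 * real n + real d))"
      by (simp add: diffs_def del: of_nat_Suc)
    moreover have "2 * (2 * real n + real d) \<noteq> 0" using d by simp
    ultimately have "(2 * (2 * real n + real d)) * diffs ?c n = - ?c n" by simp
    then have "((2 * (2 * real n + real d)) * diffs ?c n + ?c n) * s ^ n = 0" by simp
    then show ?thesis by (simp add: algebra_simps)
  qed
  then have "(\<lambda>n. 0) sums (4 * s * radial_bessel d 2 s + 2 * real d * radial_bessel d 1 s + radial_bessel d 0 s)"
    using sums_add[OF sums_add[OF s2 s1] s0] by simp
  then show ?thesis using sums_zero sums_unique2 by blast
qed

lemma C_infinity_radial_bessel:
  assumes "0 < d"
  shows "C_infinity (\<lambda>x::'a::euclidean_space. radial_bessel d 0 (\<kappa> * (x \<bullet> x)))"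
  by (rule C_infinity_compose[where S = UNIV])
     (auto intro!: has_derivative_radial_bessel assms C_infinity_cmult C_infinity_inner C_infinity_ident)

lemma laplacian_radial_bessel:
  fixes x :: "'a::euclidean_space"
  shows "laplacian (\<lambda>x. a * radial_bessel DIM('a) 0 (\<kappa> * (x \<bullet> x))) x
    = - \<kappa> * (a * radial_bessel DIM('a) 0 (\<kappa> * (x \<bullet> x)))"
proof -
  let ?F = "radial_bessel DIM('a)"
  have D: "((\<lambda>s. e * ?F m (\<kappa> * s)) has_real_derivative e * \<kappa> * ?F (Suc m) (\<kappa> * s)) (at s)" for e m s
    by (auto intro!: derivative_eq_intros DERIV_chain2[OF has_derivative_radial_bessel])
  have "laplacian (\<lambda>x. a * ?F 0 (\<kappa> * (x \<bullet> x))) x = 2 * real DIM('a) * (a * \<kappa> * ?F 1 (\<kappa> * (x \<bullet> x)))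
      + 4 * (x \<bullet> x) * (a * \<kappa> * \<kappa> * ?F 2 (\<kappa> * (x \<bullet> x)))"
    using laplacian_radial[OF D D, of a 0 x] by (simp add: numeral_2_eq_2)
  also have "\<dots> = a * \<kappa> * (4 * (\<kappa> * (x \<bullet> x)) * ?F 2 (\<kappa> * (x \<bullet> x)) + 2 * real DIM('a) * ?F 1 (\<kappa> * (x \<bullet> x)))"
    by (simp add: algebra_simps)
  also have "4 * (\<kappa> * (x \<bullet> x)) * ?F 2 (\<kappa> * (x \<bullet> x)) + 2 * real DIM('a) * ?F 1 (\<kappa> * (x \<bullet> x))
      = - ?F 0 (\<kappa> * (x \<bullet> x))"
    using radial_bessel_ode[of "DIM('a)" "\<kappa> * (x \<bullet> x)"] by simp
  finally show ?thesis by simp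
qed

section \<open>Oscillation and amplitude of the radial eigenfunctions\<close>

text \<open>
  Solutions of \<open>w'' = (C / r\<^sup>2 - 1) w\<close> with derivative \<open>v\<close>; the point \<open>r0\<close> witnesses that \<open>w\<close> is
  not identically 0.
\<close>

locale perturbed_oscillator =
  fixes w v :: "real \<Rightarrow> real" and C r0 :: real
  assumes dw: "\<And>r. 0 < r \<Longrightarrow> (w has_real_derivative v r) (at r)"
    and dv: "\<And>r. 0 < r \<Longrightarrow> (v has_real_derivative (C / r\<^sup>2 - 1) * w r) (at r)"
    and r0: "0 < r0" "w r0 \<noteq> 0"
begin

text \<open>
  Sturm comparison with \<open>sin ((r - a) / 2)\<close>, whose frequency \<open>1 / 2\<close> is eventually below the
  frequency of \<open>w\<close>.
\<close>

lemma not_positive_on_long_interval: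
  assumes \<sigma>: "\<sigma> = 1 \<or> \<sigma> = (-1::real)" and a: "0 < a" "\<And>r. a \<le> r \<Longrightarrow> C / r\<^sup>2 \<le> 3 / 4"
    and pos: "\<And>r. a \<le> r \<Longrightarrow> r \<le> a + 2 * pi \<Longrightarrow> 0 < \<sigma> * w r"
  shows False
proof -
  define G where "G = (\<lambda>r. \<sigma> * v r * sin ((r - a) / 2) - \<sigma> * w r * (cos ((r - a) / 2) / 2))"
  have "G (a + 2 * pi) \<le> G a"
  proof (rule DERIV_nonpos_imp_nonincreasing[where f = G and a = a and b = "a + 2 * pi"])
    fix r assume r: "a \<le> r" "r \<le> a + 2 * pi"
    have "(G has_real_derivative (C / r\<^sup>2 - 3 / 4) * (\<sigma> * w r) * sin ((r - a) / 2)) (at r)"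
      unfolding G_def using r a(1)
      by (auto intro!: derivative_eq_intros dw dv simp: field_simps)
    moreover have "(C / r\<^sup>2 - 3 / 4) * (\<sigma> * w r) * sin ((r - a) / 2) \<le> 0"
      using a(2)[OF r(1)] pos[OF r] sin_ge_zero[of "(r - a) / 2"] r
      by (intro mult_nonpos_nonneg) auto
    ultimately show "\<exists>y. (G has_real_derivative y) (at r) \<and> y \<le> 0" by blast
  qed simp
  moreover have "G a = - (\<sigma> * w a) / 2" "G (a + 2 * pi) = \<sigma> * w (a + 2 * pi) / 2"
    by (simp_all add: G_def)
  ultimately show False using pos[of a] pos[of "a + 2 * pi"] by simp
qed

lemma ex_zero_above: "\<exists>r>A. 0 < r \<and> w r = 0"
proof (rule ccontr)
  assume none: "\<not> ?thesis"
  \<comment> \<open>Beyond \<open>a \<ge> max 1 (4 |C|)\<close> one has \<open>r\<^sup>2 \<ge> r \<ge> 4 |C|\<close>.\<close>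
  define a where "a = \<bar>A\<bar> + 1 + 4 * \<bar>C\<bar>"
  have a: "0 < a" "A < a" "1 \<le> a" by (auto simp: a_def)
  have C: "C / r\<^sup>2 \<le> 3 / 4" if "a \<le> r" for r
  proof -
    have "1 * r \<le> r * r" using that a by (intro mult_right_mono) auto
    then have "4 * \<bar>C\<bar> \<le> r\<^sup>2" using that by (simp add: a_def power2_eq_square)
    moreover have "0 < r\<^sup>2" using that a by simp
    ultimately show ?thesis by (simp add: divide_le_eq)
  qed
  have nz: "w r \<noteq> 0" if "a \<le> r" for r using none that a by (metis less_le_trans)
  have cont: "continuous_on {a..a + 2 * pi} w"
    by (intro continuous_at_imp_continuous_on ballI DERIV_isCont[OF dw]) (use a in auto)
  have conn: "connected (w ` {a..a + 2 * pi})" by (intro connected_continuous_image cont connected_Icc)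
  have "(\<forall>r\<in>{a..a + 2 * pi}. 0 < w r) \<or> (\<forall>r\<in>{a..a + 2 * pi}. w r < 0)"
  proof (rule ccontr)
    assume "\<not> ?thesis"
    then obtain r s where "r \<in> {a..a + 2 * pi}" "s \<in> {a..a + 2 * pi}" "w r \<le> 0" "0 \<le> w s"
      by (meson not_less)
    then have "0 \<in> w ` {a..a + 2 * pi}"
      using connectedD_interval[OF conn, of "w r" "w s" 0] by blast
    then show False using nz by auto
  qed
  then show False
    using not_positive_on_long_interval[of 1 a] not_positive_on_long_interval[of "-1" a] a(1) C by auto
qed

text \<open>The energy \<open>w\<^sup>2 + v\<^sup>2\<close> changes at a relative rate of at most \<open>|C| / r\<^sup>2\<close>, which is integrable.\<close>

lemma energy_bounds:
  obtains e E where "0 < e" "\<And>r. r0 \<le> r \<Longrightarrow> e \<le> (w r)\<^sup>2 + (v r)\<^sup>2" "\<And>r. r0 \<le> r \<Longrightarrow> (w r)\<^sup>2 + (v r)\<^sup>2 \<le> E"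
proof -
  define N where "N = (\<lambda>r. (w r)\<^sup>2 + (v r)\<^sup>2)"
  have dN: "((\<lambda>r. N r * exp (\<tau> * \<bar>C\<bar> / r)) has_real_derivative
      (2 * C * (w r * v r) - \<tau> * \<bar>C\<bar> * N r) / r\<^sup>2 * exp (\<tau> * \<bar>C\<bar> / r)) (at r)" if "0 < r" for \<tau> r
    unfolding N_def using that
    by (auto intro!: derivative_eq_intros dw dv simp: field_simps power2_eq_square)
  have le: "\<bar>2 * C * (w r * v r)\<bar> \<le> \<bar>C\<bar> * N r" for r
  proof -
    have "\<bar>2 * (w r * v r)\<bar> \<le> N r"
      unfolding N_def using sum_squares_bound[of "w r" "v r"] sum_squares_bound[of "w r" "- v r"]
      by (simp add: abs_le_iff)
    then have "\<bar>C\<bar> * \<bar>2 * (w r * v r)\<bar> \<le> \<bar>C\<bar> * N r" by (rule mult_left_mono) simp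
    then show ?thesis by (simp add: abs_mult mult_ac)
  qed
  have upper: "N r * exp (1 * \<bar>C\<bar> / r) \<le> N r0 * exp (1 * \<bar>C\<bar> / r0)" if "r0 \<le> r" for r
  proof (rule DERIV_nonpos_imp_nonincreasing[OF that])
    fix x assume "r0 \<le> x"
    then have x: "0 < x" using r0 by simp
    have "(2 * C * (w x * v x) - 1 * \<bar>C\<bar> * N x) / x\<^sup>2 * exp (1 * \<bar>C\<bar> / x) \<le> 0"
      using le[of x] by (intro mult_nonpos_nonneg divide_nonpos_nonneg) auto
    with dN[OF x, of 1] show "\<exists>y. ((\<lambda>r. N r * exp (1 * \<bar>C\<bar> / r)) has_real_derivative y) (at x) \<and> y \<le> 0"
      by blast
  qed
  have lower: "N r0 * exp (- 1 * \<bar>C\<bar> / r0) \<le> N r * exp (- 1 * \<bar>C\<bar> / r)" if "r0 \<le> r" for r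
  proof (rule DERIV_nonneg_imp_nondecreasing[OF that])
    fix x assume "r0 \<le> x"
    then have x: "0 < x" using r0 by simp
    have "0 \<le> (2 * C * (w x * v x) - (- 1) * \<bar>C\<bar> * N x) / x\<^sup>2 * exp (- 1 * \<bar>C\<bar> / x)"
      using le[of x] by (intro mult_nonneg_nonneg divide_nonneg_nonneg) auto
    with dN[OF x, of "- 1"] show "\<exists>y. ((\<lambda>r. N r * exp (- 1 * \<bar>C\<bar> / r)) has_real_derivative y) (at x) \<and> 0 \<le> y"
      by blast
  qed
  have N0: "0 \<le> N r" for r by (simp add: N_def)
  show thesis
  proof (rule that[of "N r0 * exp (- 1 * \<bar>C\<bar> / r0)" "N r0 * exp (1 * \<bar>C\<bar> / r0)"])
    have "0 < N r0" using r0 by (simp add: N_def add_pos_nonneg)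
    then show "0 < N r0 * exp (- 1 * \<bar>C\<bar> / r0)" by simp
    fix r assume r: "r0 \<le> r"
    have "N r * exp (- 1 * \<bar>C\<bar> / r) \<le> N r * 1"
      using N0 r r0 by (intro mult_left_mono) auto
    then show "N r0 * exp (- 1 * \<bar>C\<bar> / r0) \<le> (w r)\<^sup>2 + (v r)\<^sup>2"
      using lower[OF r] by (simp add: N_def)
    have "N r * 1 \<le> N r * exp (1 * \<bar>C\<bar> / r)"
      using N0 r r0 by (intro mult_left_mono) auto
    then show "(w r)\<^sup>2 + (v r)\<^sup>2 \<le> N r0 * exp (1 * \<bar>C\<bar> / r0)"
      using upper[OF r] by (simp add: N_def)
  qed
qed

lemma bounded_amplitude: "\<exists>B. \<forall>r\<ge>r0. \<bar>w r\<bar> \<le> B"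
proof -
  obtain E where E: "\<And>r. r0 \<le> r \<Longrightarrow> (w r)\<^sup>2 + (v r)\<^sup>2 \<le> E" using energy_bounds by metis
  have "\<bar>w r\<bar> \<le> sqrt E" if "r0 \<le> r" for r
  proof (rule real_le_rsqrt)
    show "\<bar>w r\<bar>\<^sup>2 \<le> E"
      unfolding power2_abs using E[OF that] zero_le_power2[of "v r"] by linarith
  qed
  then show ?thesis by blast
qed

text \<open>At a critical point between two zeros the whole energy is \<open>w\<^sup>2\<close>.\<close>

lemma amplitude_not_vanishing: "\<exists>m>0. \<forall>A. \<exists>r>A. 0 < r \<and> m \<le> \<bar>w r\<bar>"
proof -
  obtain e where e: "0 < e" "\<And>r. r0 \<le> r \<Longrightarrow> e \<le> (w r)\<^sup>2 + (v r)\<^sup>2" using energy_bounds by metis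
  have "\<exists>r>A. 0 < r \<and> sqrt e \<le> \<bar>w r\<bar>" for A
  proof -
    obtain a where a: "max A r0 < a" "w a = 0" using ex_zero_above by blast
    obtain b where b: "a < b" "w b = 0" using ex_zero_above by blast
    obtain z where z: "a < z" "z < b" "w b - w a = (b - a) * v z"
      using MVT2[OF b(1), of w v] dw a r0 by auto
    then have "v z = 0" using a b by simp
    then have "e \<le> (w z)\<^sup>2" using e(2)[of z] a z by simp
    then have "sqrt e \<le> \<bar>w z\<bar>" using real_sqrt_le_mono by fastforce
    then show ?thesis using a z r0 by (intro exI[of _ z]) auto
  qed
  moreover have "0 < sqrt e" using e by simp
  ultimately show ?thesis by blast
qed

end

text \<open>
  Multiplying \<open>F (r\<^sup>2)\<close> by the square root of \<open>r\<close> to the power \<open>d - 1\<close> removes the first-order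
  term of the radial Laplacian.
\<close>

lemma radial_bessel_oscillator:
  assumes d: "0 < d" and \<alpha>: "\<alpha> = (real d - 1) / 2"
  obtains v r0 where "perturbed_oscillator (\<lambda>r. r powr \<alpha> * radial_bessel d 0 (r\<^sup>2)) v (\<alpha> * (\<alpha> - 1)) r0"
proof -
  let ?F = "radial_bessel d"
  define v where "v = (\<lambda>r. 2 * (r powr (\<alpha> + 1) * ?F 1 (r\<^sup>2)) + \<alpha> * (r powr (\<alpha> - 1) * ?F 0 (r\<^sup>2)))"
  have D: "((\<lambda>r. r powr \<beta> * ?F m (r\<^sup>2)) has_real_derivative
      2 * (r powr (\<beta> + 1) * ?F (Suc m) (r\<^sup>2)) + \<beta> * (r powr (\<beta> - 1) * ?F m (r\<^sup>2))) (at r)"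
    if r: "0 < r" for r \<beta> m
  proof -
    have "((\<lambda>r. r powr \<beta>) has_real_derivative \<beta> * r powr (\<beta> - 1)) (at r)"
      using r by (rule has_real_derivative_powr)
    moreover have "((\<lambda>r. ?F m (r\<^sup>2)) has_real_derivative ?F (Suc m) (r\<^sup>2) * (2 * r)) (at r)"
      by (rule DERIV_chain2[OF has_derivative_radial_bessel[OF d]]) (auto intro!: derivative_eq_intros)
    ultimately have "((\<lambda>r. r powr \<beta> * ?F m (r\<^sup>2)) has_real_derivative
        \<beta> * r powr (\<beta> - 1) * ?F m (r\<^sup>2) + ?F (Suc m) (r\<^sup>2) * (2 * r) * r powr \<beta>) (at r)"
      by (rule DERIV_mult)
    then show ?thesis using r by (simp add: powr_add mult_ac add_ac)
  qed
  have cont: "isCont (?F 0) s" for s using has_derivative_radial_bessel[OF d] by (rule DERIV_isCont)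
  have "((\<lambda>r. ?F 0 (r\<^sup>2)) \<longlongrightarrow> ?F 0 (0\<^sup>2)) (at_right 0)"
    by (intro isCont_tendsto_compose[OF cont] tendsto_intros)
  then have "((\<lambda>r. ?F 0 (r\<^sup>2)) \<longlongrightarrow> 1) (at_right 0)" by (simp add: radial_bessel_0)
  then have "\<forall>\<^sub>F r in at_right 0. 0 < ?F 0 (r\<^sup>2)"
    by (rule order_tendstoD(1)) simp
  then have "\<forall>\<^sub>F r in at_right 0. 0 < ?F 0 (r\<^sup>2) \<and> (0::real) < r"
    by (intro eventually_conj eventually_at_right_less)
  then obtain r0 where r0: "0 < ?F 0 (r0\<^sup>2)" "(0::real) < r0"
    using eventually_happens[of _ "at_right (0::real)"] by auto
  have "perturbed_oscillator (\<lambda>r. r powr \<alpha> * ?F 0 (r\<^sup>2)) v (\<alpha> * (\<alpha> - 1)) r0"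
  proof
    fix r :: real assume r: "0 < r"
    show "((\<lambda>r. r powr \<alpha> * ?F 0 (r\<^sup>2)) has_real_derivative v r) (at r)"
      using D[OF r, of \<alpha> 0] by (simp add: v_def)
    have "(v has_real_derivative 2 * (2 * (r powr (\<alpha> + 1 + 1) * ?F (Suc 1) (r\<^sup>2)) + (\<alpha> + 1) * (r powr (\<alpha> + 1 - 1) * ?F 1 (r\<^sup>2)))
      + \<alpha> * (2 * (r powr (\<alpha> - 1 + 1) * ?F (Suc 0) (r\<^sup>2)) + (\<alpha> - 1) * (r powr (\<alpha> - 1 - 1) * ?F 0 (r\<^sup>2)))) (at r)"
      unfolding v_def by (intro DERIV_add DERIV_cmult D[OF r])
    moreover have "2 * (2 * (r powr (\<alpha> + 1 + 1) * ?F (Suc 1) (r\<^sup>2)) + (\<alpha> + 1) * (r powr (\<alpha> + 1 - 1) * ?F 1 (r\<^sup>2)))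
      + \<alpha> * (2 * (r powr (\<alpha> - 1 + 1) * ?F (Suc 0) (r\<^sup>2)) + (\<alpha> - 1) * (r powr (\<alpha> - 1 - 1) * ?F 0 (r\<^sup>2)))
      = (\<alpha> * (\<alpha> - 1) / r\<^sup>2 - 1) * (r powr \<alpha> * ?F 0 (r\<^sup>2))"
    proof -
      have p: "r powr (\<alpha> + 1 + 1) = r powr \<alpha> * r\<^sup>2" "r powr (\<alpha> - 1 - 1) = r powr \<alpha> / r\<^sup>2"
        using r by (simp_all add: powr_add powr_diff power2_eq_square)
      have F0: "?F 0 (r\<^sup>2) = - (4 * r\<^sup>2 * ?F 2 (r\<^sup>2) + 2 * real d * ?F 1 (r\<^sup>2))"
        using radial_bessel_ode[OF d, of "r\<^sup>2"] by simp
      have "2 * (2 * (r powr (\<alpha> + 1 + 1) * ?F (Suc 1) (r\<^sup>2)) + (\<alpha> + 1) * (r powr (\<alpha> + 1 - 1) * ?F 1 (r\<^sup>2)))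
        + \<alpha> * (2 * (r powr (\<alpha> - 1 + 1) * ?F (Suc 0) (r\<^sup>2)) + (\<alpha> - 1) * (r powr (\<alpha> - 1 - 1) * ?F 0 (r\<^sup>2)))
        = r powr \<alpha> * (4 * r\<^sup>2 * ?F 2 (r\<^sup>2) + (4 * \<alpha> + 2) * ?F 1 (r\<^sup>2)) + \<alpha> * (\<alpha> - 1) / r\<^sup>2 * (r powr \<alpha> * ?F 0 (r\<^sup>2))"
        unfolding p by (simp add: numeral_2_eq_2[symmetric] algebra_simps)
      also have "4 * \<alpha> + 2 = 2 * real d" by (simp add: \<alpha> field_simps)
      also have "4 * r\<^sup>2 * ?F 2 (r\<^sup>2) + 2 * real d * ?F 1 (r\<^sup>2) = - ?F 0 (r\<^sup>2)" using F0 by simp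
      finally show ?thesis by (simp add: algebra_simps)
    qed
    ultimately show "(v has_real_derivative (\<alpha> * (\<alpha> - 1) / r\<^sup>2 - 1) * (r powr \<alpha> * ?F 0 (r\<^sup>2))) (at r)"
      by simp
  qed (use r0 in auto)
  then show thesis by (rule that)
qed

lemma first_zero:
  fixes f :: "real \<Rightarrow> real"
  assumes cont: "continuous_on UNIV f" and "0 < f 0" and z: "0 < z" "f z = 0"
  obtains s where "0 < s" "f s = 0" "\<And>t. 0 \<le> t \<Longrightarrow> t < s \<Longrightarrow> 0 < f t"
proof -
  have "closed {t. f t = 0}" by (intro closed_Collect_eq cont continuous_on_const)
  then have "compact ({0..z} \<inter> {t. f t = 0})" by (intro compact_Int_closed compact_Icc)
  moreover have "z \<in> {0..z} \<inter> {t. f t = 0}" using z by simp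
  then have "{0..z} \<inter> {t. f t = 0} \<noteq> {}" by blast
  ultimately obtain s where s: "s \<in> {0..z} \<inter> {t. f t = 0}" and least: "\<And>t. t \<in> {0..z} \<inter> {t. f t = 0} \<Longrightarrow> s \<le> t"
    using compact_attains_inf by metis
  have nz: "f t \<noteq> 0" if "0 \<le> t" "t < s" for t using least[of t] s that by auto
  show thesis
  proof (rule that)
    show "0 < s" using s assms(2) by (cases "s = 0") auto
    show "f s = 0" using s by simp
    show "0 < f t" if t: "0 \<le> t" "t < s" for t
    proof (rule ccontr)
      assume "\<not> 0 < f t"
      then obtain u where "0 \<le> u" "u \<le> t" "f u = 0"
        using IVT2'[of f t 0 0] assms(2) t continuous_on_subset[OF cont] by auto
      then show False using nz[of u] t by simp
    qed
  qed
qed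

section \<open>Operators conjugate to the Laplacian\<close>

definition conj_drift :: "('a::euclidean_space \<Rightarrow> real) \<Rightarrow> 'a \<Rightarrow> 'a" where
  "conj_drift P x = (- (2 / P x)) *\<^sub>R grad P x"

definition conj_potential :: "real \<Rightarrow> ('a::euclidean_space \<Rightarrow> real) \<Rightarrow> 'a \<Rightarrow> real" where
  "conj_potential \<Lambda> P x = - \<Lambda> - (laplacian P x + conj_drift P x \<bullet> grad P x) / P x"

lemma laplacian_mult:
  fixes f g :: "'a::euclidean_space \<Rightarrow> real"
  assumes f: "C_infinity f" and g: "C_infinity g"
  shows "laplacian (\<lambda>x. f x * g x) x = f x * laplacian g x + 2 * (grad f x \<bullet> grad g x) + g x * laplacian f x"
proof -
  note prod = bounded_bilinear.partial_deriv_prod[OF bounded_bilinear_mult]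
  have "partial_deriv i (partial_deriv i (\<lambda>x. f x * g x)) x
      = f x * partial_deriv i (partial_deriv i g) x + 2 * (partial_deriv i f x * partial_deriv i g x)
        + g x * partial_deriv i (partial_deriv i f) x" if i: "i \<in> Basis" for i
  proof -
    have d: "f differentiable (at y)" "g differentiable (at y)"
      "partial_deriv i f differentiable (at y)" "partial_deriv i g differentiable (at y)" for y
      using f g i by (auto intro!: C_infinity_imp_differentiable C_infinity_partial_deriv)
    have dm: "(\<lambda>x. f x * partial_deriv i g x) differentiable (at y)"
      "(\<lambda>x. partial_deriv i f x * g x) differentiable (at y)" for y
      using d by (auto intro!: differentiable_mult)
    have "partial_deriv i (\<lambda>x. f x * g x) = (\<lambda>x. f x * partial_deriv i g x + partial_deriv i f x * g x)"
      by (intro ext prod d)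
    then show ?thesis
      by (simp add: partial_deriv_add[OF dm] prod[OF d(1,4)] prod[OF d(3,2)])
  qed
  then have "laplacian (\<lambda>x. f x * g x) x = (\<Sum>i\<in>Basis. f x * partial_deriv i (partial_deriv i g) x
      + 2 * (partial_deriv i f x * partial_deriv i g x) + g x * partial_deriv i (partial_deriv i f) x)"
    by (simp add: laplacian_def)
  also have "\<dots> = f x * laplacian g x + 2 * (\<Sum>i\<in>Basis. partial_deriv i f x * partial_deriv i g x)
      + g x * laplacian f x"
    by (simp add: laplacian_def sum.distrib sum_distrib_left)
  also have "(\<Sum>i\<in>Basis. partial_deriv i f x * partial_deriv i g x) = grad f x \<bullet> grad g x"
    by (subst euclidean_inner) (simp add: grad_inner_Basis)
  finally show ?thesis .
qed

text \<open>
  The drift is chosen so that in \<open>L (P w)\<close> the terms containing \<open>\<nabla>w\<close> cancel, and the potential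
  so that \<open>L P = - \<Lambda> P\<close>.
\<close>

lemma elliptic_op_conj:
  fixes P w :: "'a::euclidean_space \<Rightarrow> real"
  assumes P: "C_infinity P" "\<And>x. 0 < P x" and w: "C_infinity w"
  shows "elliptic_op (conj_drift P) (conj_potential \<Lambda> P) (\<lambda>x. P x * w x) x
    = P x * (laplacian w x - \<Lambda> * w x)"
proof -
  have g: "grad (\<lambda>x. P x * w x) x = P x *\<^sub>R grad w x + w x *\<^sub>R grad P x"
    by (intro grad_mult C_infinity_imp_differentiable P w)
  have d: "conj_drift P x \<bullet> (P x *\<^sub>R grad w x) = - 2 * (grad P x \<bullet> grad w x)"
    using P(2)[of x] by (simp add: conj_drift_def)
  have c: "conj_potential \<Lambda> P x * (P x * w x)
      = - \<Lambda> * (P x * w x) - (laplacian P x + conj_drift P x \<bullet> grad P x) * w x"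
    using P(2)[of x] by (simp add: conj_potential_def field_simps)
  show ?thesis
    unfolding elliptic_op_def laplacian_mult[OF P(1) w] g inner_add_right d c
    by (simp add: algebra_simps)
qed

context
  fixes P :: "'a::euclidean_space \<Rightarrow> real"
  assumes P: "C_infinity P" "\<And>x. 0 < P x"
begin

lemma C_infinity_inverse_weight: "C_infinity (\<lambda>x. P x powr - 1)"
  by (rule C_infinity_powr[OF P])

lemma C_infinity_conj_drift: "C_infinity (conj_drift P)"
proof -
  have "C_infinity (\<lambda>x. (- 2 * P x powr - 1) *\<^sub>R grad P x)"
    by (intro C_infinity_scaleR C_infinity_cmult C_infinity_inverse_weight C_infinity_grad P(1))
  moreover have "(- 2 * P x powr - 1) *\<^sub>R grad P x = conj_drift P x" for x
    using P(2)[of x] by (simp add: conj_drift_def powr_minus divide_inverse)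
  ultimately show ?thesis by simp
qed

lemma C_infinity_conj_potential: "C_infinity (conj_potential \<Lambda> P)"
proof -
  have "C_infinity (\<lambda>x. - \<Lambda> + (- 1) * (((\<Sum>i\<in>Basis. partial_deriv i (partial_deriv i P) x)
      + conj_drift P x \<bullet> grad P x) * P x powr - 1))"
    by (intro C_infinity_add C_infinity_const C_infinity_cmult C_infinity_mult C_infinity_sum
        C_infinity_partial_deriv C_infinity_inner C_infinity_conj_drift C_infinity_grad
        C_infinity_inverse_weight P(1) finite_Basis)
  moreover have "- \<Lambda> + (- 1) * (((\<Sum>i\<in>Basis. partial_deriv i (partial_deriv i P) x)
      + conj_drift P x \<bullet> grad P x) * P x powr - 1) = conj_potential \<Lambda> P x" for x
    using P(2)[of x] by (simp add: conj_potential_def laplacian_def powr_minus divide_inverse)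
  ultimately show ?thesis by simp
qed

text \<open>The weight is \<open>1 / P\<^sup>2\<close>, because conjugation with \<open>P\<close> turns \<open>L\<close> into the symmetric operator \<open>\<Delta> - \<Lambda>\<close>.\<close>

lemma symmetrizable_conj:
  assumes "open \<Omega>" "bounded \<Omega>"
  shows "symmetrizable \<Omega> (conj_drift P) (conj_potential \<Lambda> P) (\<lambda>x. P x powr - 2)"
proof
  show "C_infinity (\<lambda>x. P x powr - 2)" by (rule C_infinity_powr[OF P])
  show "grad (\<lambda>x. P x powr - 2) x = P x powr - 2 *\<^sub>R conj_drift P x" for x
  proof -
    have "((\<lambda>t. t powr - 2) has_real_derivative - 2 * P x powr (- 2 - 1)) (at (P x))"
      by (rule has_real_derivative_powr[OF P(2)])
    then have "grad (\<lambda>x. P x powr - 2) x = (- 2 * P x powr (- 2 - 1)) *\<^sub>R grad P x"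
      by (rule grad_compose) (rule C_infinity_imp_differentiable[OF P(1)])
    also have "P x powr (- 2 - 1) = P x powr - 2 / P x"
      using P(2)[of x] by (subst powr_diff) simp
    finally show ?thesis by (simp add: conj_drift_def)
  qed
  show "continuous_on UNIV (conj_potential \<Lambda> P)"
    by (rule C_infinity_imp_continuous_on[OF C_infinity_conj_potential])
qed (use assms P(2) in \<open>auto simp: less_imp_neq[symmetric]\<close>)

text \<open>Scaling moves the first zero of the radial eigenfunction to the boundary of the ball.\<close>

lemma principal_eigenvalue_conj_ball:
  assumes R: "0 < R" and s: "0 < s" "radial_bessel DIM('a) 0 s = 0"
    "\<And>t. 0 \<le> t \<Longrightarrow> t < s \<Longrightarrow> 0 < radial_bessel DIM('a) 0 t"
  shows "principal_eigenvalue (conj_drift P) (conj_potential \<Lambda> P) (ball 0 R) = \<Lambda> + s / R\<^sup>2"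
proof -
  let ?\<Omega> = "ball (0::'a) R"
  define \<kappa> where "\<kappa> = s / R\<^sup>2"
  define w where "w = (\<lambda>x::'a. 1 * radial_bessel DIM('a) 0 (\<kappa> * (x \<bullet> x)))"
  have \<kappa>: "0 < \<kappa>" using R s(1) by (simp add: \<kappa>_def)
  have Cw: "C_infinity w" unfolding w_def by (intro C_infinity_cmult C_infinity_radial_bessel) simp
  interpret symmetrizable ?\<Omega> "conj_drift P" "conj_potential \<Lambda> P" "\<lambda>x. P x powr - 2"
    by (rule symmetrizable_conj) auto
  have "is_principal_eigenvalue (conj_drift P) (conj_potential \<Lambda> P) ?\<Omega> (\<Lambda> + \<kappa>)"
  proof (rule positive_solution_principal[OF refl R, where \<Phi> = "\<lambda>x. P x * w x"])
    show "C_infinity (\<lambda>x. P x * w x)" by (rule C_infinity_mult[OF P(1) Cw])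
    show "0 < P x * w x" if x: "x \<in> ?\<Omega>" for x
    proof -
      have "(norm x)\<^sup>2 < R\<^sup>2" using x by (intro power_strict_mono) auto
      then have "\<kappa> * (x \<bullet> x) < s"
        using s(1) R by (simp add: \<kappa>_def power2_norm_eq_inner pos_divide_less_eq)
      then show ?thesis using s(3)[of "\<kappa> * (x \<bullet> x)"] \<kappa> P(2)[of x] by (simp add: w_def)
    qed
    show "elliptic_op (conj_drift P) (conj_potential \<Lambda> P) (\<lambda>x. P x * w x) x = - (\<Lambda> + \<kappa>) * (P x * w x)" for x
      unfolding elliptic_op_conj[OF P Cw] unfolding w_def laplacian_radial_bessel
      by (simp add: algebra_simps)
    show "P x * w x = 0" if "norm x = R" for x
    proof -
      have "\<kappa> * (x \<bullet> x) = s" using that R by (simp add: \<kappa>_def power2_norm_eq_inner[symmetric])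
      then show ?thesis using s(2) by (simp add: w_def)
    qed
  qed
  then show ?thesis
    unfolding \<kappa>_def using R by (intro principal_eigenvalue_eqI) auto
qed

end

section \<open>The conjugating weight\<close>

text \<open>
  The exponential produces the decay of the solution, and the power of \<open>1 + |x|\<^sup>2\<close> compensates the
  decay of the radial eigenfunction of the Laplacian, so that the amplitude of the product is
  comparable to \<open>exp (- |x|)\<close>.
\<close>

definition decay_weight :: "'a::euclidean_space \<Rightarrow> real" where
  "decay_weight x = exp (- sqrt (1 + x \<bullet> x)) * (1 + x \<bullet> x) powr ((real DIM('a) - 1) / 4)"

lemma one_plus_inner_pos: "0 < 1 + x \<bullet> (x::'a::euclidean_space)"
  by (simp add: add_pos_nonneg)

lemma decay_weight_pos: "0 < decay_weight x"
  using one_plus_inner_pos[of x] by (simp add: decay_weight_def less_imp_neq[symmetric])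

lemma C_infinity_decay_weight: "C_infinity (decay_weight :: 'a::euclidean_space \<Rightarrow> real)"
proof -
  have y: "C_infinity (\<lambda>x::'a. 1 + x \<bullet> x)"
    by (intro C_infinity_add C_infinity_const C_infinity_inner C_infinity_ident)
  have "C_infinity (\<lambda>x::'a. exp ((- 1) * (1 + x \<bullet> x) powr (1 / 2)) * (1 + x \<bullet> x) powr ((real DIM('a) - 1) / 4))"
    by (intro C_infinity_mult C_infinity_exp C_infinity_cmult C_infinity_powr y one_plus_inner_pos)
  moreover have "(\<lambda>x::'a. exp ((- 1) * (1 + x \<bullet> x) powr (1 / 2)) * (1 + x \<bullet> x) powr ((real DIM('a) - 1) / 4))
      = decay_weight"
    by (simp add: fun_eq_iff decay_weight_def powr_half_sqrt)
  ultimately show ?thesis by simp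
qed

text \<open>
  In terms of \<open>s = |x|\<^sup>2\<close> the logarithmic derivative \<open>q\<close> of the weight is a polynomial in
  \<open>z = 1 / sqrt (1 + s)\<close> without constant term, and \<open>s z\<^sup>2 \<le> 1\<close> compensates the factors \<open>x\<close>
  and \<open>s\<close> produced by differentiation.
\<close>

lemma decay_weight_coefficients_bounded:
  "bounded (range (conj_drift (decay_weight :: 'a::euclidean_space \<Rightarrow> real)))"
  "bounded (range (conj_potential \<Lambda> (decay_weight :: 'a \<Rightarrow> real)))"
proof -
  define n where "n = real DIM('a)"
  define \<beta> where "\<beta> = (n - 1) / 4"
  have \<beta>: "0 \<le> \<beta>" by (simp add: \<beta>_def n_def)
  define z where "z = (\<lambda>s::real. 1 / sqrt (1 + s))"
  define q where "q = (\<lambda>s. - (1 / 2) * z s + \<beta> * (z s)\<^sup>2)"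
  define q' where "q' = (\<lambda>s. (1 / 4) * (z s) ^ 3 - \<beta> * (z s) ^ 4)"
  define g where "g = (\<lambda>s. exp (- sqrt (1 + s)) * (1 + s) powr \<beta>)"
  have W: "decay_weight = (\<lambda>x::'a. g (x \<bullet> x))"
    by (simp add: fun_eq_iff decay_weight_def g_def \<beta>_def n_def)
  have zsq: "(z s)\<^sup>2 = 1 / (1 + s)" if "0 \<le> s" for s
    using that by (simp add: z_def power_divide)
  have dz: "(z has_real_derivative - (1 / 2) * (z s) ^ 3) (at s)" if "0 \<le> s" for s
  proof -
    have "sqrt (1 + s) \<noteq> 0" using that by simp
    then show ?thesis unfolding z_def using that
      by (auto intro!: derivative_eq_intros simp: field_simps power3_eq_cube)
  qed
  have dq: "(q has_real_derivative q' s) (at s)" if "0 \<le> s" for s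
    unfolding q_def q'_def
    by (rule derivative_eq_intros dz[OF that] refl)+ (simp add: power2_eq_square power3_eq_cube power4_eq_xxxx)
  have dg: "(g has_real_derivative q s * g s) (at s)" if "0 \<le> s" for s
  proof -
    have d1: "((\<lambda>s. (1 + s) powr \<beta>) has_real_derivative \<beta> * (1 + s) powr (\<beta> - 1) * 1) (at s)"
      using that by (intro DERIV_chain2[where f = "\<lambda>t. t powr \<beta>"] has_real_derivative_powr)
        (auto intro!: derivative_eq_intros)
    have d2: "((\<lambda>s. exp (- sqrt (1 + s))) has_real_derivative exp (- sqrt (1 + s)) * (- (1 / 2) * z s)) (at s)"
      using that by (auto intro!: derivative_eq_intros simp: z_def field_simps)
    have "(g has_real_derivative exp (- sqrt (1 + s)) * (- (1 / 2) * z s) * (1 + s) powr \<beta>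
        + \<beta> * (1 + s) powr (\<beta> - 1) * 1 * exp (- sqrt (1 + s))) (at s)"
      unfolding g_def by (rule DERIV_mult[OF d2 d1])
    moreover have "(1 + s) powr (\<beta> - 1) = (1 + s) powr \<beta> * (z s)\<^sup>2"
      using that by (simp add: zsq powr_diff)
    ultimately show ?thesis by (simp add: q_def g_def algebra_simps)
  qed
  have dg1: "((\<lambda>s. q s * g s) has_real_derivative (q' s + (q s)\<^sup>2) * g s) (at s)" if "0 \<le> s" for s
    using DERIV_mult[OF dq[OF that] dg[OF that]] by (simp add: power2_eq_square algebra_simps)
  have gp: "0 < g (x \<bullet> x)" for x :: 'a using decay_weight_pos[of x] by (simp add: W)
  have grad: "grad (\<lambda>x::'a. g (x \<bullet> x)) x = (2 * (q (x \<bullet> x) * g (x \<bullet> x))) *\<^sub>R x" for x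
    by (rule grad_radial[OF dg]) simp
  have drift: "conj_drift decay_weight x = (- 4 * q (x \<bullet> x)) *\<^sub>R x" for x :: 'a
    using gp[of x] unfolding W conj_drift_def grad by simp
  have lap: "laplacian (\<lambda>x::'a. g (x \<bullet> x)) x = 2 * n * (q (x \<bullet> x) * g (x \<bullet> x))
      + 4 * (x \<bullet> x) * ((q' (x \<bullet> x) + (q (x \<bullet> x))\<^sup>2) * g (x \<bullet> x))" for x
    unfolding n_def by (rule laplacian_radial[OF dg dg1])
  have pot: "conj_potential \<Lambda> decay_weight x = - \<Lambda> - 2 * n * q (x \<bullet> x)
      - 4 * ((x \<bullet> x) * q' (x \<bullet> x)) + 4 * ((x \<bullet> x) * (q (x \<bullet> x))\<^sup>2)" for x :: 'a
    unfolding conj_potential_def drift unfolding W lap grad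
    using gp[of x] by (simp add: field_simps power2_eq_square)
  define A where "A = 1 / 2 + \<beta>"
  have z01: "0 \<le> z s" "z s \<le> 1" if "0 \<le> s" for s
    using that by (auto simp: z_def)
  have szz: "s * (z s)\<^sup>2 \<le> 1" if "0 \<le> s" for s using that by (simp add: zsq)
  have qz: "\<bar>q s\<bar> \<le> A * z s" if "0 \<le> s" for s
  proof -
    have "\<bar>q s\<bar> \<le> \<bar>- (1 / 2) * z s\<bar> + \<bar>\<beta> * (z s)\<^sup>2\<bar>" unfolding q_def by (rule abs_triangle_ineq)
    also have "\<dots> = (1 / 2) * z s + \<beta> * (z s * z s)"
      using z01[OF that] \<beta> by (simp add: abs_mult power2_eq_square)
    also have "\<beta> * (z s * z s) \<le> \<beta> * (z s * 1)"
      using z01[OF that] \<beta> by (intro mult_left_mono) auto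
    finally show ?thesis by (simp add: A_def algebra_simps)
  qed
  have A: "0 \<le> A" using \<beta> by (simp add: A_def)
  have q1: "\<bar>q s\<bar> \<le> A" if "0 \<le> s" for s
    using qz[OF that] mult_left_mono[OF z01(2)[OF that] A] by simp
  have q2: "s * (q s)\<^sup>2 \<le> A\<^sup>2" if "0 \<le> s" for s
  proof -
    have "\<bar>q s\<bar>\<^sup>2 \<le> (A * z s)\<^sup>2" using qz[OF that] by (intro power_mono) auto
    then have "s * (q s)\<^sup>2 \<le> s * (A\<^sup>2 * (z s)\<^sup>2)"
      using that by (intro mult_left_mono) (auto simp: power_mult_distrib)
    also have "\<dots> = A\<^sup>2 * (s * (z s)\<^sup>2)" by simp
    also have "\<dots> \<le> A\<^sup>2 * 1" using szz[OF that] by (intro mult_left_mono) auto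
    finally show ?thesis by simp
  qed
  have q'1: "\<bar>s * q' s\<bar> \<le> A" if "0 \<le> s" for s
  proof -
    have "s * q' s = (s * (z s)\<^sup>2) * (z s / 4 - \<beta> * (z s * z s))"
      by (simp add: q'_def power2_eq_square power3_eq_cube power4_eq_xxxx algebra_simps)
    then have "\<bar>s * q' s\<bar> = \<bar>s * (z s)\<^sup>2\<bar> * \<bar>z s / 4 - \<beta> * (z s * z s)\<bar>"
      by (simp only: abs_mult)
    also have "\<bar>s * (z s)\<^sup>2\<bar> = s * (z s)\<^sup>2" using that by simp
    also have "s * (z s)\<^sup>2 * \<bar>z s / 4 - \<beta> * (z s * z s)\<bar> \<le> 1 * A"
    proof (rule mult_mono)
      have "\<beta> * (z s * z s) \<le> \<beta> * (1 * 1)" "0 \<le> \<beta> * (z s * z s)"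
        using z01[OF that] \<beta> by (intro mult_left_mono mult_mono mult_nonneg_nonneg; simp)+
      then show "\<bar>z s / 4 - \<beta> * (z s * z s)\<bar> \<le> A"
        using z01[OF that] by (simp add: A_def abs_le_iff)
    qed (use szz[OF that] in auto)
    finally show ?thesis by simp
  qed
  have "norm (conj_drift decay_weight x) \<le> 4 * A" for x :: 'a
  proof -
    have "(norm (conj_drift decay_weight x))\<^sup>2 = 16 * ((x \<bullet> x) * (q (x \<bullet> x))\<^sup>2)"
      unfolding drift by (simp add: power_mult_distrib power2_norm_eq_inner)
    also have "\<dots> \<le> 16 * A\<^sup>2" using q2[of "x \<bullet> x"] by simp
    also have "\<dots> = (4 * A)\<^sup>2" by (simp add: power_mult_distrib)
    finally show ?thesis by (rule power2_le_imp_le) (use A in simp)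
  qed
  then show "bounded (range (conj_drift (decay_weight :: 'a \<Rightarrow> real)))"
    unfolding bounded_iff by blast
  have "norm (conj_potential \<Lambda> decay_weight x) \<le> \<bar>\<Lambda>\<bar> + 2 * n * A + 4 * A + 4 * A\<^sup>2" for x :: 'a
  proof -
    have "\<bar>2 * n * q (x \<bullet> x)\<bar> \<le> 2 * n * A"
      using q1[of "x \<bullet> x"] by (simp add: abs_mult n_def mult_left_mono)
    moreover have "0 \<le> (x \<bullet> x) * (q (x \<bullet> x))\<^sup>2" by simp
    ultimately show ?thesis
      unfolding pot real_norm_def using q'1[OF inner_ge_zero, of x] q2[OF inner_ge_zero, of x]
      by linarith
  qed
  then show "bounded (range (conj_potential \<Lambda> (decay_weight :: 'a \<Rightarrow> real)))"
    unfolding bounded_iff by blast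
qed

section \<open>The decaying solution\<close>

lemma Limsup_at_infinity_eq_pos_real:
  fixes h :: "'a::euclidean_space \<Rightarrow> real"
  assumes "0 < lo" and up: "\<And>x. A \<le> norm x \<Longrightarrow> h x \<le> hi"
    and low: "\<And>A. \<exists>x. A < norm x \<and> lo \<le> h x"
  obtains l where "0 < l" "Limsup at_infinity (\<lambda>x. ereal (h x)) = ereal l"
proof -
  let ?L = "Limsup at_infinity (\<lambda>x. ereal (h x))"
  have "?L \<le> ereal hi"
    using up by (intro Limsup_bounded) (auto simp: eventually_at_infinity)
  moreover have "ereal lo \<le> ?L"
  proof (rule ccontr)
    assume "\<not> ?thesis"
    then have "\<forall>\<^sub>F x in at_infinity. ereal (h x) < ereal lo"
      by (intro Limsup_lessD) simp
    then obtain B where "\<And>x. B \<le> norm x \<Longrightarrow> h x < lo"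
      by (auto simp: eventually_at_infinity)
    moreover obtain x where "B < norm x" "lo \<le> h x" using low by blast
    ultimately show False by (smt (verit))
  qed
  ultimately show thesis
    using that assms(1) by (cases ?L) auto
qed

text \<open>
  The power of \<open>1 + |x|\<^sup>2\<close> in the weight and the power of \<open>r\<close> that turns the radial eigenfunction
  into an oscillator of bounded amplitude differ only by a factor bounded above and away from 0.
\<close>

lemma amplitude_formula:
  fixes x :: "'a::euclidean_space"
  assumes k: "0 < k" and x: "0 < norm x" and \<alpha>: "\<alpha> = (real DIM('a) - 1) / 2"
  shows "exp (norm x) * \<bar>decay_weight x * F ((k * norm x)\<^sup>2)\<bar>
    = exp (norm x - sqrt (1 + (norm x)\<^sup>2)) * (sqrt (1 + (norm x)\<^sup>2) / (k * norm x)) powr \<alpha>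
        * \<bar>(k * norm x) powr \<alpha> * F ((k * norm x)\<^sup>2)\<bar>"
proof -
  define r where "r = norm x"
  have r: "0 < r" using x by (simp add: r_def)
  have kr: "0 < k * r" using r k by simp
  have y: "0 < 1 + r\<^sup>2" by (simp add: add_pos_nonneg)
  have "decay_weight x = exp (- sqrt (1 + r\<^sup>2)) * (1 + r\<^sup>2) powr (\<alpha> / 2)"
    unfolding decay_weight_def r_def power2_norm_eq_inner \<alpha> by simp
  also have "(1 + r\<^sup>2) powr (\<alpha> / 2) = sqrt (1 + r\<^sup>2) powr \<alpha>"
    using y by (simp add: powr_half_sqrt[symmetric] powr_powr)
  also have "sqrt (1 + r\<^sup>2) powr \<alpha> = (sqrt (1 + r\<^sup>2) / (k * r)) powr \<alpha> * (k * r) powr \<alpha>"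
    using r k by (simp add: powr_mult[symmetric])
  finally have P: "decay_weight x = exp (- sqrt (1 + r\<^sup>2)) * ((sqrt (1 + r\<^sup>2) / (k * r)) powr \<alpha> * (k * r) powr \<alpha>)" .
  have "exp r * \<bar>decay_weight x * F ((k * r)\<^sup>2)\<bar>
    = (exp r * exp (- sqrt (1 + r\<^sup>2))) * (sqrt (1 + r\<^sup>2) / (k * r)) powr \<alpha>
        * \<bar>(k * r) powr \<alpha> * F ((k * r)\<^sup>2)\<bar>"
    unfolding P by (simp add: abs_mult mult_ac)
  also have "exp r * exp (- sqrt (1 + r\<^sup>2)) = exp (r - sqrt (1 + r\<^sup>2))"
    by (simp flip: exp_add)
  finally show ?thesis by (simp add: r_def)
qed

lemma amplitude_factor_bounds:
  fixes r k \<alpha> :: real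
  assumes k: "0 < k" and r: "1 \<le> r" and \<alpha>: "0 \<le> \<alpha>"
  defines "T \<equiv> exp (r - sqrt (1 + r\<^sup>2)) * (sqrt (1 + r\<^sup>2) / (k * r)) powr \<alpha>"
  shows "exp (- 1) * (1 / k) powr \<alpha> \<le> T" "T \<le> (2 / k) powr \<alpha>"
proof -
  have s: "r \<le> sqrt (1 + r\<^sup>2)" by (intro real_le_rsqrt) simp
  have s': "sqrt (1 + r\<^sup>2) \<le> 1 + r"
    using r by (intro real_le_lsqrt) (auto simp: power2_eq_square algebra_simps)
  have "1 / k = r / (k * r)" using r by simp
  also have "\<dots> \<le> sqrt (1 + r\<^sup>2) / (k * r)" using s k r by (intro divide_right_mono) auto
  finally have 1: "1 / k \<le> sqrt (1 + r\<^sup>2) / (k * r)" .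
  have "sqrt (1 + r\<^sup>2) / (k * r) \<le> (2 * r) / (k * r)"
    using s' k r by (intro divide_right_mono) auto
  also have "\<dots> = 2 / k" using r by simp
  finally have 2: "sqrt (1 + r\<^sup>2) / (k * r) \<le> 2 / k" .
  show "exp (- 1) * (1 / k) powr \<alpha> \<le> T"
    unfolding T_def using s' 1 k \<alpha> by (intro mult_mono powr_mono2) auto
  have "T \<le> 1 * (2 / k) powr \<alpha>"
    unfolding T_def using s 2 k r \<alpha> by (intro mult_mono powr_mono2) auto
  then show "T \<le> (2 / k) powr \<alpha>" by simp
qed

lemma decaying_solution_amplitude:
  assumes k: "0 < k"
  obtains l where "0 < l"
    "Limsup at_infinity (\<lambda>x::'a::euclidean_space.
        ereal (exp (norm x) * \<bar>decay_weight x * radial_bessel DIM('a) 0 ((k * norm x)\<^sup>2)\<bar>)) = ereal l"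
proof -
  define \<alpha> where "\<alpha> = (real DIM('a) - 1) / 2"
  have \<alpha>: "0 \<le> \<alpha>" by (simp add: \<alpha>_def)
  let ?F = "radial_bessel DIM('a) 0"
  obtain v r0 where "perturbed_oscillator (\<lambda>r. r powr \<alpha> * ?F (r\<^sup>2)) v (\<alpha> * (\<alpha> - 1)) r0"
    using radial_bessel_oscillator[OF _ \<alpha>_def] by (metis DIM_positive)
  then interpret perturbed_oscillator "\<lambda>r. r powr \<alpha> * ?F (r\<^sup>2)" v "\<alpha> * (\<alpha> - 1)" r0 .
  obtain B where B: "\<And>r. r0 \<le> r \<Longrightarrow> \<bar>r powr \<alpha> * ?F (r\<^sup>2)\<bar> \<le> B" using bounded_amplitude by blast
  obtain m where m: "0 < m" "\<And>A. \<exists>r>A. 0 < r \<and> m \<le> \<bar>r powr \<alpha> * ?F (r\<^sup>2)\<bar>"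
    using amplitude_not_vanishing by blast
  let ?h = "\<lambda>x::'a. exp (norm x) * \<bar>decay_weight x * ?F ((k * norm x)\<^sup>2)\<bar>"
  have B0: "0 \<le> B" using B[of r0] by linarith
  show thesis
  proof (rule Limsup_at_infinity_eq_pos_real)
    show "0 < exp (- 1) * (1 / k) powr \<alpha> * m" using k m(1) by simp
    show "?h x \<le> (2 / k) powr \<alpha> * B" if x: "max 1 (r0 / k) \<le> norm x" for x
    proof -
      have "r0 \<le> k * norm x" using x k by (simp add: pos_divide_le_eq mult.commute)
      then have "\<bar>(k * norm x) powr \<alpha> * ?F ((k * norm x)\<^sup>2)\<bar> \<le> B" by (rule B)
      moreover have n: "0 < norm x" "1 \<le> norm x" using x by auto
      ultimately show ?thesis
        unfolding amplitude_formula[OF k n(1) \<alpha>_def, of ?F]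
        by (intro mult_mono[OF amplitude_factor_bounds(2)[OF k n(2) \<alpha>]]) auto
    qed
    show "\<exists>x. A < norm x \<and> exp (- 1) * (1 / k) powr \<alpha> * m \<le> ?h x" for A
    proof -
      obtain r where r: "k * max A 1 < r" "m \<le> \<bar>r powr \<alpha> * ?F (r\<^sup>2)\<bar>" using m(2) by blast
      define x :: 'a where "x = (r / k) *\<^sub>R (SOME i. i \<in> Basis)"
      have rk: "max A 1 < r / k" using r(1) k by (simp only: pos_less_divide_eq mult.commute[of k])
      have "norm x = \<bar>r / k\<bar>" by (simp only: x_def norm_scaleR norm_Basis[OF SOME_Basis] mult_1_right)
      with rk have nx: "norm x = r / k" by linarith
      then have kn: "k * norm x = r" using k by simp
      have n: "A < norm x" "1 \<le> norm x" "0 < norm x" using rk nx by auto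
      have "exp (- 1) * (1 / k) powr \<alpha> * m \<le> ?h x"
        unfolding amplitude_formula[OF k n(3) \<alpha>_def, of ?F]
        by (rule mult_mono[OF amplitude_factor_bounds(1)[OF k n(2) \<alpha>]]) (use r(2) m(1) kn in auto)
      with n show ?thesis by blast
    qed
  qed (rule that)
qed

theorem proposition2p11:
  fixes \<Lambda> :: real
  assumes "CARD('n::finite) \<ge> 2" and "\<Lambda> < 0"
  shows "\<exists>(b :: real^'n \<Rightarrow> real^'n) (c :: real^'n \<Rightarrow> real).
    C_infinity b \<and> bounded (range b) \<and> C_infinity c \<and> bounded (range c) \<and>
    ((\<lambda>R. principal_eigenvalue b c (ball 0 R)) \<longlongrightarrow> \<Lambda>) at_top \<and>
    (\<exists>(u :: real^'n \<Rightarrow> real) (R :: nat \<Rightarrow> real) (K :: real).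
       C_k 2 u \<and> (\<forall>x. elliptic_op b c u x = 0) \<and>
       (\<forall>i. 0 < R i) \<and> filterlim R at_top sequentially \<and>
       (\<forall>i x. norm x = R i \<longrightarrow> u x = 0) \<and>
       0 < K \<and>
       Limsup at_infinity (\<lambda>x. ereal (exp (K * norm x) * \<bar>u x\<bar>)) = 1)"
proof -
  define P :: "real^'n \<Rightarrow> real" where "P = decay_weight"
  define F where "F = radial_bessel DIM(real^'n) 0"
  have P: "C_infinity P" "\<And>x. 0 < P x"
    by (simp_all add: P_def C_infinity_decay_weight decay_weight_pos)
  \<comment> \<open>The solution is the radial function with \<open>\<Delta> w = \<Lambda> w\<close>, whose frequency is \<open>k\<close>.\<close>
  define k where "k = sqrt (- \<Lambda>)"
  have k: "0 < k" "k\<^sup>2 = - \<Lambda>" using assms(2) by (simp_all add: k_def)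
  have kx: "(k * norm x)\<^sup>2 = - \<Lambda> * (x \<bullet> x)" for x :: "real^'n"
    by (simp add: power_mult_distrib k(2) power2_norm_eq_inner)
  obtain v r0 where osc: "perturbed_oscillator (\<lambda>r. r powr ((real DIM(real^'n) - 1) / 2) * F (r\<^sup>2)) v
      (((real DIM(real^'n) - 1) / 2) * ((real DIM(real^'n) - 1) / 2 - 1)) r0"
    unfolding F_def by (rule radial_bessel_oscillator[OF DIM_positive refl])
  have zeros: "\<exists>r>A. 0 < r \<and> F (r\<^sup>2) = 0" for A
    using perturbed_oscillator.ex_zero_above[OF osc, of A] by auto

  have contF: "continuous_on UNIV F"
    unfolding F_def by (intro continuous_at_imp_continuous_on ballI
        DERIV_isCont[OF has_derivative_radial_bessel[OF DIM_positive]])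
  obtain z where z: "0 < z" "F (z\<^sup>2) = 0" using zeros by blast
  obtain s where s: "0 < s" "F s = 0" "\<And>t. 0 \<le> t \<Longrightarrow> t < s \<Longrightarrow> 0 < F t"
    by (rule first_zero[OF contF, of "z\<^sup>2"]) (use z in \<open>auto simp: F_def radial_bessel_0\<close>)
  have "principal_eigenvalue (conj_drift P) (conj_potential \<Lambda> P) (ball 0 R) = \<Lambda> + s / R\<^sup>2" if "0 < R" for R
    using principal_eigenvalue_conj_ball[OF P that s(1)] s(2,3) unfolding F_def by blast
  then have "\<forall>\<^sub>F R in at_top. \<Lambda> + s / R\<^sup>2 = principal_eigenvalue (conj_drift P) (conj_potential \<Lambda> P) (ball 0 R)"
    by (intro eventually_mono[OF eventually_gt_at_top[of 0]]) simp
  moreover have "((\<lambda>R::real. \<Lambda> + s / R\<^sup>2) \<longlongrightarrow> \<Lambda> + 0) at_top"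
    by (intro tendsto_add tendsto_const tendsto_divide_0[OF tendsto_const]
        filterlim_at_top_imp_at_infinity filterlim_pow_at_top filterlim_ident) simp
  ultimately have eigen: "((\<lambda>R. principal_eigenvalue (conj_drift P) (conj_potential \<Lambda> P) (ball 0 R)) \<longlongrightarrow> \<Lambda>) at_top"
    by (simp add: tendsto_cong)

  obtain l where l: "0 < l" "Limsup at_infinity (\<lambda>x. ereal (exp (norm x) * \<bar>P x * F ((k * norm x)\<^sup>2)\<bar>)) = ereal l"
    unfolding P_def F_def by (rule decaying_solution_amplitude[OF k(1)])
  \<comment> \<open>Division by \<open>l\<close> normalizes the upper limit to 1.\<close>
  define w where "w = (\<lambda>x::real^'n. (1 / l) * F (- \<Lambda> * (x \<bullet> x)))"
  define u where "u = (\<lambda>x. P x * w x)"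
  have Cw: "C_infinity w"
    unfolding w_def F_def by (intro C_infinity_cmult C_infinity_radial_bessel DIM_positive)
  have Cu: "C_infinity u" unfolding u_def by (rule C_infinity_mult[OF P(1) Cw])
  have eq: "elliptic_op (conj_drift P) (conj_potential \<Lambda> P) u x = 0" for x
    unfolding u_def elliptic_op_conj[OF P Cw] unfolding w_def F_def laplacian_radial_bessel by simp
  have "Limsup at_infinity (\<lambda>x. ereal (exp (1 * norm x) * \<bar>u x\<bar>))
    = Limsup at_infinity (\<lambda>x. ereal (1 / l) * ereal (exp (norm x) * \<bar>P x * F ((k * norm x)\<^sup>2)\<bar>))"
    using l(1) by (simp add: u_def w_def kx abs_mult mult_ac)
  also have "\<dots> = ereal (1 / l) * ereal l"
    using l by (subst Limsup_ereal_mult_left) (auto simp: trivial_limit_at_infinity)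
  also have "\<dots> = 1" using l(1) by simp
  finally have Lim: "Limsup at_infinity (\<lambda>x. ereal (exp (1 * norm x) * \<bar>u x\<bar>)) = 1" .

  have "\<forall>i::nat. \<exists>r. real i < r \<and> 0 < r \<and> F (r\<^sup>2) = 0" using zeros by blast
  then obtain \<rho> where \<rho>: "\<And>i::nat. real i < \<rho> i" "\<And>i. 0 < \<rho> i" "\<And>i. F ((\<rho> i)\<^sup>2) = 0" by metis
  have "filterlim \<rho> at_top sequentially"
    by (rule filterlim_at_top_mono[OF filterlim_real_sequentially]) (use \<rho>(1) in \<open>auto intro!: always_eventually less_imp_le\<close>)
  then have "filterlim (\<lambda>i. (1 / k) * \<rho> i) at_top sequentially"
    using k(1) by (intro filterlim_tendsto_pos_mult_at_top[OF tendsto_const]) auto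
  moreover have "\<forall>i (x::real^'n). norm x = (1 / k) * \<rho> i \<longrightarrow> u x = 0"
  proof (intro allI impI)
    fix i and x :: "real^'n" assume nx: "norm x = (1 / k) * \<rho> i"
    have "k * norm x = \<rho> i" using nx k(1) by simp
    then have "F (- \<Lambda> * (x \<bullet> x)) = 0" using \<rho>(3)[of i] kx[of x] by simp
    then show "u x = 0" by (simp add: u_def w_def)
  qed
  moreover have "\<forall>i. 0 < (1 / k) * \<rho> i" using \<rho>(2) k(1) by simp
  moreover have "C_k 2 u" using Cu by (simp add: C_infinity_def)
  moreover have "\<forall>x. elliptic_op (conj_drift P) (conj_potential \<Lambda> P) u x = 0" using eq by blast
  ultimately have "\<exists>(u :: real^'n \<Rightarrow> real) (R :: nat \<Rightarrow> real) (K :: real).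
       C_k 2 u \<and> (\<forall>x. elliptic_op (conj_drift P) (conj_potential \<Lambda> P) u x = 0) \<and>
       (\<forall>i. 0 < R i) \<and> filterlim R at_top sequentially \<and>
       (\<forall>i x. norm x = R i \<longrightarrow> u x = 0) \<and> 0 < K \<and>
       Limsup at_infinity (\<lambda>x. ereal (exp (K * norm x) * \<bar>u x\<bar>)) = 1"
    by (intro exI[of _ u] exI[of _ "\<lambda>i. (1 / k) * \<rho> i"] exI[of _ "1::real"] conjI)
      (assumption | rule Lim zero_less_one)+
  moreover have "bounded (range (conj_drift P))" "bounded (range (conj_potential \<Lambda> P))"
    unfolding P_def by (rule decay_weight_coefficients_bounded)+
  ultimately show ?thesis
    using eigen C_infinity_conj_drift[OF P] C_infinity_conj_potential[OF P, of \<Lambda>] by blast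
qed

end
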